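(* Let $0<\alpha<\beta<\pi$ satisfy $$\frac{c_\alpha}{\sin\alpha}=\frac{c_\beta}{\sin\beta}=:c_{\alpha\beta}.$$ Then an entire solution $V(t,x,y)$ of $u_t-\Delta u=f(x,y,u)$ on $\mathbb{R}\times\mathbb{R}^2$ satisfying $$\lim_{R\to+\infty}\ \sup_{x^2+(y-c_{\alpha\beta}t)^2>R^2}\big|V(t,x,y)-U^-_{\alpha\beta}(t,x,y)\big|=0\qquad( * )$$ (supremum over all $(t,x,y)\in\mathbb{R}\times\mathbb{R}^2$ satisfying the indicated inequality) is unique; that is, if $V$ and $V^*$ are two entire solutions both satisfying $( * )$, then $V^*(t,x,y)=V(t,x,y)$ for all $(t,x,y)\in\mathbb{R}\times\mathbb{R}^2$.
   Context: Let $L=(L_1,L_2)$ with $L_1,L_2>0$ and $\mathbb{T}^2=[0,L_1]\times[0,L_2]$ (periodicity cell). The equation is $u_t-\Delta u=f(x,y,u)$, $(t,x,y)\in\mathbb{R}\times\mathbb{R}^2$, $\Delta=\partial_{xx}+\partial_{yy}$. Assumptions on $f$: (F1) $f$ is continuous, of class $C^{a}$ in $(x,y)$ uniformly in $u\in[0,1]$ for some $a\in(0,1)$, of class $C^2$ in $u$ uniformly in $(x,y)\in\mathbb{R}^2$, with $f_u,f_{uu}$ Lipschitz continuous in $u\in\mathbb{R}$; (F2) $f(x+k_1L_1,y+k_2L_2,u)=f(x,y,u)$ for all $k_1,k_2\in\mathbb{Z}$; (F3) $f(x,y,0)=f(x,y,1)=0$ for all $(x,y)$, and there are $\lambda>0$,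 $\sigma\in(0,1/2)$ with $-f_u(x,y,u)\ge\lambda$ for all $(x,y)\in\mathbb{R}^2$ and $u\in[0,\sigma]\cup[1-\sigma,1]$; moreover $f$ is extended outside $u\in[0,1]$ so that $-f_u\ge\lambda$ for $u\in(-\infty,\sigma]\cup[1-\sigma,+\infty)$, and $f$ is globally Lipschitz in $u$. A pulsating front in the unit direction $e\in\mathbb{S}\subset\mathbb{R}^2$ (connecting $0$ and $1$) with speed $c_e\in\mathbb{R}$ is a pair $(U_e,c_e)$, $U_e:\mathbb{R}\times\mathbb{T}^2\to\mathbb{R}$, with $U_e(\xi,x,y)$ $L$-periodic in $(x,y)$, $U_e(+\infty,x,y)=0$ and $U_e(-\infty,x,y)=1$ uniformly in $(x,y)$, and such that $u(t,x,y)=U_e((x,y)\cdot e-c_et,x,y)$ is a classical entire solution of the equation. Standing assumptions: $\int_{\mathbb{T}^2\times[0,1]}f(x,y,u)\,dx\,dy\,du>0$, and for every unit vector $e$ there is a pulsating front $(U_e,c_e)$ with $c_e\ne0$. Known consequences: $c_e>0$ for all $e$; $c_e$ is unique and $U_e$ is unique up to shifts in $\xi$, and is normalized by $U_e(0,0,0)=1/2$. Notation: for an angle $\theta$, $U_\theta:=U_{(\cos\theta,\sin\theta)}$ and $c_\theta:=c_{(\cos\theta,\sin\theta)}$. For $\alpha,\beta\in(0,\pi)$, $$U^-_{\alpha\beta}(t,x,y):=\max\{U_\alpha(x\cos\alpha+y\sin\alpha-c_\alpha t,x,y),\ U_\beta(x\cos\beta+y\sin\beta-c_\beta t,x,y)\}.$$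 *)

theory Defs
  imports "HOL-Analysis.Analysis"
begin

text \<open>
  The nonlinearity is a curried function \<open>f x y u\<close>; \<open>deriv (f x y)\<close> and
  \<open>deriv (deriv (f x y))\<close> are \<open>f\<^sub>u\<close> and \<open>f\<^sub>u\<^sub>u\<close>.
\<close>

text \<open>
  The constants \<open>H\<close> and \<open>K\<close> do not depend on the other variables. The Lipschitz bounds
  subsume continuity of \<open>f\<^sub>u\<close> and \<open>f\<^sub>u\<^sub>u\<close> in \<open>u\<close>, with moduli uniform in \<open>(x,y)\<close>. For
  periodic bistable \<open>f\<close>, the \<open>C\<^sup>a\<close> norms of \<open>f\<close> (for \<open>u \<in> [0,1]\<close>) and the suprema of \<open>f\<^sub>u\<close>, \<open>f\<^sub>u\<^sub>u\<close> are
  then automatically bounded, so only the seminorms are mentioned.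
\<close>
definition regular_nonlinearity :: "(real \<Rightarrow> real \<Rightarrow> real \<Rightarrow> real) \<Rightarrow> bool" where
  "regular_nonlinearity f \<longleftrightarrow>
     continuous_on UNIV (\<lambda>(x, y, u). f x y u) \<and>
     (\<exists>a\<in>{0<..<1}. \<exists>H. \<forall>u\<in>{0..1}. \<forall>x y x' y'.
        \<bar>f x y u - f x' y' u\<bar> \<le> H * dist (x, y) (x', y') powr a) \<and>
     (\<forall>x y u. f x y differentiable at u \<and> deriv (f x y) differentiable at u) \<and>
     (\<exists>K. \<forall>x y. K-lipschitz_on UNIV (deriv (f x y)) \<and>
                K-lipschitz_on UNIV (deriv (deriv (f x y))))"

definition periodic_nonlinearity :: "real \<Rightarrow> real \<Rightarrow> (real \<Rightarrow> real \<Rightarrow> real \<Rightarrow> real) \<Rightarrow> bool" where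
  "periodic_nonlinearity L1 L2 f \<longleftrightarrow>
     (\<forall>x y u. \<forall>k1 k2 :: int. f (x + of_int k1 * L1) (y + of_int k2 * L2) u = f x y u)"

text \<open>This includes the conditions on the extension of \<open>f\<close> to \<open>u \<notin> [0,1]\<close>.\<close>
definition bistable_nonlinearity :: "(real \<Rightarrow> real \<Rightarrow> real \<Rightarrow> real) \<Rightarrow> bool" where
  "bistable_nonlinearity f \<longleftrightarrow>
     (\<forall>x y. f x y 0 = 0 \<and> f x y 1 = 0) \<and>
     (\<exists>lam>0. \<exists>\<sigma>\<in>{0<..<1/2}. \<forall>x y. \<forall>u\<in>{..\<sigma>} \<union> {1 - \<sigma>..}. - deriv (f x y) u \<ge> lam) \<and>
     (\<exists>K. \<forall>x y. K-lipschitz_on UNIV (f x y))"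

text \<open>
  Classical solutions of \<open>u\<^sub>t - \<Delta>u = f(x,y,u)\<close> on all of \<open>\<real> \<times> \<real>\<^sup>2\<close>: \<open>u\<close> is \<open>C\<^sup>1\<close> in \<open>t\<close> and
  \<open>C\<^sup>2\<close> in \<open>(x,y)\<close>, all derivatives being jointly continuous in \<open>(t,x,y)\<close>.
\<close>
definition classical_entire_solution ::
  "(real \<Rightarrow> real \<Rightarrow> real \<Rightarrow> real) \<Rightarrow> (real \<Rightarrow> real \<Rightarrow> real \<Rightarrow> real) \<Rightarrow> bool" where
  "classical_entire_solution f u \<longleftrightarrow>
     (\<exists>ut ux uy uxx uxy uyy.
        (\<forall>g\<in>{u, ut, ux, uy, uxx, uxy, uyy}. continuous_on UNIV (\<lambda>(t, x, y). g t x y)) \<and>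
        (\<forall>t x y.
           ((\<lambda>s. u s x y) has_real_derivative ut t x y) (at t) \<and>
           ((\<lambda>s. u t s y) has_real_derivative ux t x y) (at x) \<and>
           ((\<lambda>s. u t x s) has_real_derivative uy t x y) (at y) \<and>
           ((\<lambda>s. ux t s y) has_real_derivative uxx t x y) (at x) \<and>
           ((\<lambda>s. ux t x s) has_real_derivative uxy t x y) (at y) \<and>
           ((\<lambda>s. uy t s y) has_real_derivative uxy t x y) (at x) \<and>
           ((\<lambda>s. uy t x s) has_real_derivative uyy t x y) (at y) \<and>
           ut t x y - (uxx t x y + uyy t x y) = f x y (u t x y)))"

definition pulsating_front ::
  "real \<Rightarrow> real \<Rightarrow> (real \<Rightarrow> real \<Rightarrow> real \<Rightarrow> real) \<Rightarrow> real \<times> real \<Rightarrow>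
   (real \<Rightarrow> real \<Rightarrow> real \<Rightarrow> real) \<Rightarrow> real \<Rightarrow> bool" where
  "pulsating_front L1 L2 f e U c \<longleftrightarrow>
     (\<forall>\<xi> x y. \<forall>k1 k2 :: int. U \<xi> (x + of_int k1 * L1) (y + of_int k2 * L2) = U \<xi> x y) \<and>
     uniform_limit UNIV (\<lambda>\<xi> (x, y). U \<xi> x y) (\<lambda>_. 0) at_top \<and>
     uniform_limit UNIV (\<lambda>\<xi> (x, y). U \<xi> x y) (\<lambda>_. 1) at_bot \<and>
     classical_entire_solution f (\<lambda>t x y. U ((x, y) \<bullet> e - c * t) x y)"

definition dir :: "real \<Rightarrow> real \<times> real" where
  "dir \<theta> = (cos \<theta>, sin \<theta>)"

text \<open>\<open>U\<close> and \<open>c\<close> are families of profiles and speeds, indexed by the unit direction.\<close>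
definition U_minus ::
  "(real \<times> real \<Rightarrow> real \<Rightarrow> real \<Rightarrow> real \<Rightarrow> real) \<Rightarrow> (real \<times> real \<Rightarrow> real) \<Rightarrow>
   real \<Rightarrow> real \<Rightarrow> real \<Rightarrow> real \<Rightarrow> real \<Rightarrow> real" where
  "U_minus U c \<alpha> \<beta> t x y =
     max (U (dir \<alpha>) (x * cos \<alpha> + y * sin \<alpha> - c (dir \<alpha>) * t) x y)
         (U (dir \<beta>) (x * cos \<beta> + y * sin \<beta> - c (dir \<beta>) * t) x y)"

text \<open>
  The supremum is taken in \<^typ>\<open>ereal\<close>, so that it is \<open>\<infinity>\<close> (and not an unspecified number) when the
  difference is unbounded on the region.
\<close>
definition asymptotic_away_from_tip ::
  "real \<Rightarrow> (real \<Rightarrow> real \<Rightarrow> real \<Rightarrow> real) \<Rightarrow> (real \<Rightarrow> real \<Rightarrow> real \<Rightarrow> real) \<Rightarrow> bool" where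
  "asymptotic_away_from_tip s V W \<longleftrightarrow>
     ((\<lambda>R. SUP (t, x, y)\<in>{(t, x, y). x\<^sup>2 + (y - s * t)\<^sup>2 > R\<^sup>2}. ereal \<bar>V t x y - W t x y\<bar>)
        \<longlongrightarrow> 0) at_top"

end

theory Submission
  imports Defs
begin

text \<open>
  The tip of the profile \<open>U_minus\<close> moves along the \<open>y\<close>-axis with velocity \<open>s = c\<^sub>\<alpha>\<^sub>\<beta>\<close>, and advancing time by
  \<open>\<tau> / s\<close> moves the tip by \<open>\<tau>\<close> and lowers the phase of the front in direction \<open>\<theta>\<close> by \<open>\<tau> sin \<theta>\<close>.
  Two solutions are compared by sliding in time: with \<open>V\<^sub>\<tau> = V(t + \<tau> / s)\<close>, the claim is \<open>V' \<le> V\<^sub>\<tau>\<close>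
  for all \<open>\<tau> \<ge> 0\<close>; \<open>\<tau> = 0\<close> and exchanging the solutions give equality.

  \<^item> For large \<open>\<tau>\<close> every point has \<open>V' \<le> \<sigma>\<close> or \<open>V\<^sub>\<tau> \<ge> 1 - \<sigma>\<close>. Wherever \<open>V' > V\<^sub>\<tau>\<close>, both values then
    lie in a range where the reaction is dissipative, and the maximum principle forbids this
    (\<open>comparison\<close>).
  \<^item> Lower \<open>\<tau>\<close> as far as possible (\<open>sliding\<close>). If this stopped at some \<open>\<tau>1 > 0\<close>, then \<open>V'\<close> and
    \<open>V\<^sub>\<tau>\<close> with \<open>\<tau> = \<tau>1\<close> would be separated by a fixed gap on the set where neither value is
    in the dissipative range: far from the tip because both solutions are close to \<open>U_minus\<close> and
    fronts increase strictly under the shift (\<open>front_strict\<close>, \<open>front_mono\<close>); near the tip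
    because an explicit subsolution transports the gap from a far point of the interface to the tip
    within one unit of time (\<open>gap_propagates\<close>). As solutions are uniformly continuous in
    time, \<open>\<tau>\<close> could be lowered further. The argument is \<open>two_front_comparison\<close>; monotonicity of the
    fronts is the same sliding argument with a single front.

  All steps are quantitative and translation invariant, so limits of translated solutions and
  parabolic compactness do not enter: suprema over the non-compact space-time are handled by a small
  quadratic penalty (\<open>max_principle\<close>), equicontinuity comes from explicit barriers
  (\<open>space_lipschitz\<close>, \<open>time_modulus\<close>), and the Harnack-type step from \<open>lower_barrier\<close>.

  The maximum principle needs bounded functions, but the asymptotic condition bounds \<open>V\<close> only away
  from the tip. Forward in time dissipation controls \<open>V\<close>; as \<open>t \<rightarrow> -\<infinity>\<close> a solution might still grow
  inside the moving disc around the tip. Excluding this is a matter of unique continuation: a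
  solution that is moderate on an annulus around the tip cannot be arbitrarily large inside. A Carleman
  inequality (\<open>carleman_inequality\<close>) with a weight that degenerates at both ends of a unit time
  interval yields a bound for the mean square of \<open>V\<close> over the disc at some time in the interval
  (\<open>observability\<close>), with the same constant for every interval. Since the mass above the
  level \<open>M\<close> decays at a fixed exponential rate and is bounded along a sequence of times going to
  \<open>-\<infinity>\<close>, it vanishes (\<open>bounded_above_of_damped\<close>).
\<close>

section \<open>The maximum principle on unbounded domains\<close>

text \<open>
  The heat operator \<open>u\<^sub>t - \<Delta>u\<close> of \<open>u\<close> at the single point \<open>(t, x, y)\<close> has the value \<open>H\<close>. The maximum
  principle inspects only one point at a time, so barriers and differences of solutions can be treated
  without naming their derivatives as functions.
\<close>
definition has_heat :: "(real \<Rightarrow> real \<Rightarrow> real \<Rightarrow> real) \<Rightarrow> real \<Rightarrow> real \<Rightarrow> real \<Rightarrow> real \<Rightarrow> bool" where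
  "has_heat u t x y H \<longleftrightarrow>
     (\<exists>a ux uy b d. ((\<lambda>s. u s x y) has_real_derivative a) (at t) \<and>
        (\<forall>s. ((\<lambda>s. u t s y) has_real_derivative ux s) (at s)) \<and>
        (ux has_real_derivative b) (at x) \<and>
        (\<forall>s. ((\<lambda>s. u t x s) has_real_derivative uy s) (at s)) \<and>
        (uy has_real_derivative d) (at y) \<and> H = a - (b + d))"

lemma has_heatI:
  assumes "((\<lambda>s. u s x y) has_real_derivative a) (at t)"
    and "\<And>s. ((\<lambda>s. u t s y) has_real_derivative ux s) (at s)"
    and "(ux has_real_derivative b) (at x)"
    and "\<And>s. ((\<lambda>s. u t x s) has_real_derivative uy s) (at s)"
    and "(uy has_real_derivative d) (at y)"
    and "H = a - (b + d)"
  shows "has_heat u t x y H"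
  unfolding has_heat_def using assms by blast

abbreviation jcont :: "(real \<Rightarrow> real \<Rightarrow> real \<Rightarrow> real) \<Rightarrow> bool" where
  "jcont u \<equiv> continuous_on UNIV (\<lambda>(t, x, y). u t x y)"

lemma jcont_compose:
  assumes "jcont u" "continuous_on S a" "continuous_on S b" "continuous_on S d"
  shows "continuous_on S (\<lambda>p. u (a p) (b p) (d p))"
proof -
  have "continuous_on S (\<lambda>p. (a p, b p, d p))"
    using assms by (intro continuous_intros)
  from continuous_on_compose2[OF assms(1) this] show ?thesis by simp
qed

lemma has_heat_lincomb:
  assumes "has_heat u t x y H" "has_heat v t x y J"
  shows "has_heat (\<lambda>t x y. p * u t x y + q * v t x y) t x y (p * H + q * J)"
proof -
  from assms(1) obtain a ux uy b d where 1:
    "((\<lambda>s. u s x y) has_real_derivative a) (at t)"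
    "\<And>s. ((\<lambda>s. u t s y) has_real_derivative ux s) (at s)"
    "(ux has_real_derivative b) (at x)"
    "\<And>s. ((\<lambda>s. u t x s) has_real_derivative uy s) (at s)"
    "(uy has_real_derivative d) (at y)" "H = a - (b + d)"
    unfolding has_heat_def by blast
  from assms(2) obtain a' ux' uy' b' d' where 2:
    "((\<lambda>s. v s x y) has_real_derivative a') (at t)"
    "\<And>s. ((\<lambda>s. v t s y) has_real_derivative ux' s) (at s)"
    "(ux' has_real_derivative b') (at x)"
    "\<And>s. ((\<lambda>s. v t x s) has_real_derivative uy' s) (at s)"
    "(uy' has_real_derivative d') (at y)" "J = a' - (b' + d')"
    unfolding has_heat_def by blast
  show ?thesis
    by (rule has_heatI[where a="p * a + q * a'" and b="p * b + q * b'" and d="p * d + q * d'"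
          and ux="\<lambda>s. p * ux s + q * ux' s" and uy="\<lambda>s. p * uy s + q * uy' s"])
       (use 1 2 in \<open>auto intro!: derivative_eq_intros simp: algebra_simps\<close>)
qed

lemma has_heat_diff:
  assumes "has_heat u t x y H" "has_heat v t x y J"
  shows "has_heat (\<lambda>t x y. u t x y - v t x y) t x y (H - J)"
  using has_heat_lincomb[OF assms, of 1 "-1"] by simp

lemma has_heat_minus:
  assumes "has_heat u t x y H"
  shows "has_heat (\<lambda>t x y. - u t x y) t x y (- H)"
  using has_heat_lincomb[OF assms assms, of "-1" 0] by simp

lemma has_heat_shift:
  assumes "has_heat u (t + p) (x + q) (y + r) H"
  shows "has_heat (\<lambda>t x y. u (t + p) (x + q) (y + r)) t x y H"
proof -
  from assms obtain a ux uy b d where 1: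
    "((\<lambda>s. u s (x+q) (y+r)) has_real_derivative a) (at (t+p))"
    "\<And>s. ((\<lambda>s. u (t+p) s (y+r)) has_real_derivative ux s) (at s)"
    "(ux has_real_derivative b) (at (x+q))"
    "\<And>s. ((\<lambda>s. u (t+p) (x+q) s) has_real_derivative uy s) (at s)"
    "(uy has_real_derivative d) (at (y+r))" "H = a - (b + d)"
    unfolding has_heat_def by blast
  have sh: "((\<lambda>s. g (s + z)) has_real_derivative D) (at s)"
    if "(g has_real_derivative D) (at (s + z))" for g D s z
    using that by (simp add: DERIV_shift)
  show ?thesis
    by (rule has_heatI[where a=a and b=b and d=d and ux="\<lambda>s. ux (s+q)" and uy="\<lambda>s. uy (s+r)"])
       (fact sh[OF 1(1)] sh[OF 1(2)] sh[OF 1(3)] sh[OF 1(4)] sh[OF 1(5)] 1(6))+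
qed

lemma has_heat_reflect:
  assumes "has_heat u t (q - x) y H"
  shows "has_heat (\<lambda>t x y. u t (q - x) y) t x y H"
proof -
  from assms obtain a ux uy b d where 1:
    "((\<lambda>s. u s (q - x) y) has_real_derivative a) (at t)"
    "\<And>s. ((\<lambda>s. u t s y) has_real_derivative ux s) (at s)"
    "(ux has_real_derivative b) (at (q - x))"
    "\<And>s. ((\<lambda>s. u t (q - x) s) has_real_derivative uy s) (at s)"
    "(uy has_real_derivative d) (at y)" "H = a - (b + d)"
    unfolding has_heat_def by blast
  have e: "((\<lambda>s. q - s) has_real_derivative -1) (at s)" for s
    by (auto intro!: derivative_eq_intros)
  have 2: "((\<lambda>s. u t (q - s) y) has_real_derivative - ux (q - s)) (at s)" for s
    using DERIV_chain2[OF 1(2)[of "q - s"] e[of s]] by simp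
  have 3: "((\<lambda>s. - ux (q - s)) has_real_derivative b) (at x)"
    using DERIV_minus[OF DERIV_chain2[OF 1(3) e[of x]]] by simp
  show ?thesis
    by (rule has_heatI[OF 1(1) 2 3 1(4) 1(5) 1(6)])
qed

lemma has_heat_swap:
  assumes "has_heat u t y x H"
  shows "has_heat (\<lambda>t x y. u t y x) t x y H"
  using assms unfolding has_heat_def by (metis add.commute)

lemma second_deriv_nonpos_at_max:
  fixes f :: "real \<Rightarrow> real"
  assumes d: "\<And>s. (f has_real_derivative f' s) (at s)" and d2: "(f' has_real_derivative D) (at x)"
    and e: "e > 0" and mx: "\<And>s. \<bar>s - x\<bar> < e \<Longrightarrow> f s \<le> f x"
  shows "D \<le> 0"
proof (rule ccontr)
  assume "\<not> D \<le> 0" hence D: "D > 0" by simp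
  have z: "f' x = 0"
    by (rule DERIV_local_max[OF d e]) (use mx in \<open>auto simp: abs_minus_commute\<close>)
  from DERIV_pos_inc_right[OF d2 D] obtain \<delta> where \<delta>: "\<delta> > 0" "\<And>h. 0 < h \<Longrightarrow> h < \<delta> \<Longrightarrow> f' x < f' (x + h)"
    by blast
  define h where "h = min \<delta> e / 2"
  have h: "h > 0" "h < \<delta>" "h < e" using \<delta>(1) e by (auto simp: h_def)
  obtain \<xi> where \<xi>: "x < \<xi>" "\<xi> < x + h" "f (x + h) - f x = (x + h - x) * f' \<xi>"
    using MVT2[of x "x + h" f f'] h(1) d by auto
  have "f' \<xi> > 0" using \<delta>(2)[of "\<xi> - x"] \<xi> h z by auto
  hence "f (x + h) - f x > 0" using \<xi>(3) h by (simp add: zero_less_mult_iff)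
  thus False using mx[of "x + h"] h by auto
qed

text \<open>
  The supremum of \<open>w\<close> need not be attained. At a point where \<open>w\<close> is within \<open>\<delta>\<close> of a positive
  supremum, subtracting \<open>2\<delta>\<close> times the squared distance produces a maximum within distance 1. There all
  derivatives of \<open>w\<close> are those of the penalty, hence of size \<open>O(\<delta>)\<close>, which contradicts \<open>H \<le> - lam w\<close>.
  The boundary of \<open>G\<close> enters only through the assumption that points with \<open>w > 0\<close> are interior; \<open>G\<close>
  may be a strip, a future half-space, or everything.
\<close>
lemma max_principle:
  assumes cont: "jcont w" and G: "closed G" and lam: "lam > (0::real)"
    and bd: "\<And>t x y. (t, x, y) \<in> G \<Longrightarrow> w t x y \<le> B"
    and step: "\<And>t x y. (t, x, y) \<in> G \<Longrightarrow> w t x y > 0 \<Longrightarrow>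
       (t, x, y) \<in> interior G \<and> (\<exists>H. has_heat w t x y H \<and> H \<le> - lam * w t x y)"
    and p: "(t, x, y) \<in> G"
  shows "w t x y \<le> 0"
proof (rule ccontr)
  assume "\<not> w t x y \<le> 0"
  hence pos: "w t x y > 0" by simp
  define W where "W = (\<lambda>(t, x, y). w t x y)"
  define m where "m = Sup (W ` G)"
  have bdd: "bdd_above (W ` G)" using bd by (auto simp: W_def intro!: bdd_aboveI2)
  have Wm: "W q \<le> m" if "q \<in> G" for q
    unfolding m_def using that bdd by (auto intro: cSup_upper)
  have m: "m > 0" using Wm[OF p] pos by (auto simp: W_def)
  define \<delta> where "\<delta> = lam * m / (2 * (12 + lam))"
  have \<delta>: "\<delta> > 0" using m lam by (auto simp: \<delta>_def)
  have "\<delta> \<le> m / 2" using m lam by (simp add: \<delta>_def field_simps)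
  hence \<delta>m: "\<delta> < m" using m by linarith
  have key: "12 * \<delta> < lam * (m - \<delta>)"
    using m lam by (simp add: \<delta>_def field_simps) (simp add: add_pos_pos)
  obtain q0 where q0: "q0 \<in> G" "W q0 > m - \<delta>"
  proof -
    have "\<exists>z\<in>W ` G. m - \<delta> < z"
      using p \<delta> by (intro less_cSupD) (auto simp: m_def)
    thus ?thesis using that by auto
  qed
  obtain t0 x0 y0 where q0e: "q0 = (t0, x0, y0)" by (cases q0)
  define \<psi> where "\<psi> = (\<lambda>(t, x, y). w t x y - 2 * \<delta> * ((t - t0)\<^sup>2 + (x - x0)\<^sup>2 + (y - y0)\<^sup>2))"
  have psi: "\<psi> q = W q - 2 * \<delta> * (dist q q0)\<^sup>2" for q
    by (cases q) (simp add: \<psi>_def W_def q0e dist_Pair_Pair dist_real_def)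
  have cW: "continuous_on UNIV W" using cont by (simp add: W_def)
  have cpsi: "continuous_on UNIV \<psi>"
    unfolding psi[abs_def] by (intro continuous_intros cW)
  have cmp: "compact (G \<inter> cball q0 1)" using G by (simp add: closed_Int_compact)
  have "\<exists>q1\<in>G \<inter> cball q0 1. \<forall>q\<in>G \<inter> cball q0 1. \<psi> q \<le> \<psi> q1"
    using q0 by (intro continuous_attains_sup cmp continuous_on_subset[OF cpsi]) auto
  then obtain q1 where q1: "q1 \<in> G" "dist q0 q1 \<le> 1"
    and mx: "\<And>q. q \<in> G \<Longrightarrow> dist q0 q \<le> 1 \<Longrightarrow> \<psi> q \<le> \<psi> q1" by auto
  have "\<psi> q0 = W q0" by (simp add: psi)
  hence p1: "\<psi> q1 > m - \<delta>" using mx[of q0] q0 by simp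
  have "dist q1 q0 < 1"
  proof (rule ccontr)
    assume "\<not> ?thesis"
    hence "dist q1 q0 = 1" using q1 by (simp add: dist_commute)
    hence "\<psi> q1 \<le> m - 2 * \<delta>" using Wm[OF q1(1)] by (simp add: psi)
    thus False using p1 \<delta> by linarith
  qed
  have W1: "W q1 > m - \<delta>"
  proof -
    have "0 \<le> 2 * \<delta> * (dist q1 q0)\<^sup>2" using \<delta> by simp
    thus ?thesis using p1 psi[of q1] by linarith
  qed
  obtain t1 x1 y1 where q1e: "q1 = (t1, x1, y1)" by (cases q1)
  have int: "q1 \<in> interior G" and "\<exists>H. has_heat w t1 x1 y1 H \<and> H \<le> - lam * w t1 x1 y1"
    using step[of t1 x1 y1] q1 W1 \<delta>m by (auto simp: q1e W_def)
  then obtain H where H: "has_heat w t1 x1 y1 H" "H \<le> - lam * w t1 x1 y1" by blast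
  have "open (interior G \<inter> ball q0 1)" by auto
  moreover have "q1 \<in> interior G \<inter> ball q0 1"
    using int \<open>dist q1 q0 < 1\<close> by (simp add: dist_commute)
  ultimately obtain e where e: "e > 0" "ball q1 e \<subseteq> interior G \<inter> ball q0 1"
    by (meson openE)
  have loc: "\<psi> q \<le> \<psi> q1" if "dist q1 q < e" for q
  proof -
    have "q \<in> interior G \<inter> ball q0 1" using e(2) that by auto
    thus ?thesis using mx[of q] interior_subset[of G] by auto
  qed
  from H obtain a ux uy b d where h:
    "((\<lambda>s. w s x1 y1) has_real_derivative a) (at t1)"
    "\<And>s. ((\<lambda>s. w t1 s y1) has_real_derivative ux s) (at s)"
    "(ux has_real_derivative b) (at x1)"
    "\<And>s. ((\<lambda>s. w t1 x1 s) has_real_derivative uy s) (at s)"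
    "(uy has_real_derivative d) (at y1)" "H = a - (b + d)"
    unfolding has_heat_def by blast
  have "a - 4 * \<delta> * (t1 - t0) = 0"
  proof (rule DERIV_local_max[OF _ e(1)])
    show "((\<lambda>s. \<psi> (s, x1, y1)) has_real_derivative a - 4 * \<delta> * (t1 - t0)) (at t1)"
      unfolding \<psi>_def using h(1) by (auto intro!: derivative_eq_intros)
    show "\<forall>s. \<bar>t1 - s\<bar> < e \<longrightarrow> \<psi> (s, x1, y1) \<le> \<psi> (t1, x1, y1)"
      using loc by (auto simp: q1e dist_Pair_Pair dist_real_def)
  qed
  moreover have "\<bar>t1 - t0\<bar> \<le> 1"
  proof -
    have "dist t1 t0 \<le> dist q1 q0" using dist_fst_le[of q1 q0] by (simp add: q1e q0e)
    thus ?thesis using \<open>dist q1 q0 < 1\<close> by (simp add: dist_real_def)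
  qed
  moreover from this have "\<delta> * (t1 - t0) \<ge> \<delta> * (- 1)"
    using \<delta> by (intro mult_left_mono) auto
  ultimately have a: "a \<ge> - 4 * \<delta>"
    by simp
  have "b - 4 * \<delta> \<le> 0"
  proof (rule second_deriv_nonpos_at_max[OF _ _ e(1)])
    show "((\<lambda>s. \<psi> (t1, s, y1)) has_real_derivative ux s - 4 * \<delta> * (s - x0)) (at s)" for s
      unfolding \<psi>_def using h(2) by (auto intro!: derivative_eq_intros)
    show "((\<lambda>s. ux s - 4 * \<delta> * (s - x0)) has_real_derivative b - 4 * \<delta>) (at x1)"
      using h(3) by (auto intro!: derivative_eq_intros)
    show "\<psi> (t1, s, y1) \<le> \<psi> (t1, x1, y1)" if "\<bar>s - x1\<bar> < e" for s
      using loc that by (auto simp: q1e dist_Pair_Pair dist_real_def abs_minus_commute)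
  qed
  moreover have "d - 4 * \<delta> \<le> 0"
  proof (rule second_deriv_nonpos_at_max[OF _ _ e(1)])
    show "((\<lambda>s. \<psi> (t1, x1, s)) has_real_derivative uy s - 4 * \<delta> * (s - y0)) (at s)" for s
      unfolding \<psi>_def using h(4) by (auto intro!: derivative_eq_intros)
    show "((\<lambda>s. uy s - 4 * \<delta> * (s - y0)) has_real_derivative d - 4 * \<delta>) (at y1)"
      using h(5) by (auto intro!: derivative_eq_intros)
    show "\<psi> (t1, x1, s) \<le> \<psi> (t1, x1, y1)" if "\<bar>s - y1\<bar> < e" for s
      using loc that by (auto simp: q1e dist_Pair_Pair dist_real_def abs_minus_commute)
  qed
  ultimately have "H \<ge> - 12 * \<delta>" using a h(6) by linarith
  moreover have "lam * w t1 x1 y1 > lam * (m - \<delta>)" using W1 lam by (simp add: W_def q1e)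
  ultimately show False using H(2) key by linarith
qed

section \<open>Equicontinuity of bounded solutions\<close>

lemma has_heat_quad:
  "has_heat (\<lambda>t x y. k * (x * (2 - x))) t x y (2 * k)"
  by (rule has_heatI[where a=0 and b="- 2 * k" and d=0 and ux="\<lambda>s. k * (2 - 2 * s)" and uy="\<lambda>_. 0"])
     (auto intro!: derivative_eq_intros simp: algebra_simps)

text \<open>
  For a centre \<open>q\<close>, the odd difference \<open>u(t, q + x, y) - u(t, q - x, y)\<close> vanishes at \<open>x = 0\<close>, is at
  most \<open>2M\<close> at \<open>x = 1\<close> and solves a heat equation with right-hand side at most \<open>2C\<close>. The concave barrier
  \<open>N x (2 - x)\<close> dominates it on the strip \<open>0 \<le> x \<le> 1\<close>.
\<close>
lemma space_lipschitz_one_sided: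
  assumes cont: "jcont u" and heat: "\<And>t x y. has_heat u t x y (g t x y)"
    and M: "\<And>t x y. \<bar>u t x y\<bar> \<le> M" and C: "\<And>t x y. \<bar>g t x y\<bar> \<le> C" and le: "x2 \<le> x1"
  shows "u t x1 y - u t x2 y \<le> (2 * M + C + 1) * (x1 - x2)"
proof -
  define N where "N = 2 * M + C + 1"
  have M0: "M \<ge> 0" "C \<ge> 0" using M[of 0 0 0] C[of 0 0 0] by linarith+
  define k where "k = (x1 - x2) / 2"
  define q where "q = (x1 + x2) / 2"
  show ?thesis
  proof (cases "k \<le> 1")
    case False
    hence "N * 1 \<le> N * (x1 - x2)" using M0 by (intro mult_left_mono) (auto simp: k_def N_def)
    moreover have "u t x1 y - u t x2 y \<le> 2 * M" using M[of t x1 y] M[of t x2 y] by linarith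
    moreover have "2 * M \<le> N" using M0 by (simp add: N_def)
    ultimately show ?thesis unfolding N_def[symmetric] by linarith
  next
    case True
    define w where "w = (\<lambda>t x y. (u t (x + q) y - u t (q - x) y) - N * (x * (2 - x)))"
    define G where "G = {(t :: real, x :: real, y :: real). 0 \<le> x \<and> x \<le> 1}"
    have wle: "w t x y \<le> 2 * M" if "0 \<le> x" "x \<le> 1" for t x y
    proof -
      have "0 \<le> N * (x * (2 - x))" using that M0 by (intro mult_nonneg_nonneg) (auto simp: N_def)
      thus ?thesis using M[of t "x + q" y] M[of t "q - x" y] by (auto simp: w_def)
    qed
    have "w t k y \<le> 0"
    proof (rule max_principle[where w=w and G=G and lam="1 / (2 * M + 1)" and B="2 * M"])
      show "jcont w" unfolding w_def case_prod_beta
        by (intro jcont_compose[OF cont] continuous_intros)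
      have "G = (\<lambda>p. fst (snd p)) -` {0..1}" by (auto simp: G_def)
      thus "closed G" by (simp add: closed_vimage continuous_on_fst continuous_on_snd)
      show "(t, k, y) \<in> G" using le True by (auto simp: G_def k_def)
    next
      fix t x y assume G: "(t, x, y) \<in> G" and pos: "w t x y > 0"
      have "x \<noteq> 0" using pos by (auto simp: w_def)
      moreover have "x \<noteq> 1"
        using pos M[of t "1 + q" y] M[of t "q - 1" y] M0 by (auto simp: w_def N_def)
      ultimately have x: "0 < x" "x < 1" using G by (auto simp: G_def)
      have "open ((\<lambda>p :: real \<times> real \<times> real. fst (snd p)) -` {0<..<1})"
        by (simp add: open_vimage continuous_on_fst continuous_on_snd)
      hence "(t, x, y) \<in> interior G"
        by (rule interiorI) (use x in \<open>auto simp: G_def\<close>)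
      moreover have "has_heat w t x y ((g t (x + q) y - g t (q - x) y) - 2 * N)"
        unfolding w_def
        by (intro has_heat_diff has_heat_quad has_heat_reflect[OF heat]
            has_heat_shift[where p=0 and r=0, simplified] heat)
      moreover have "(g t (x + q) y - g t (q - x) y) - 2 * N \<le> - 1"
        using C[of t "x + q" y] C[of t "q - x" y] M0 by (auto simp: N_def)
      moreover have "- 1 \<le> - (1 / (2 * M + 1)) * w t x y"
        using wle[of x t y] x M0 by (simp add: field_simps)
      ultimately show "(t, x, y) \<in> interior G \<and>
          (\<exists>H. has_heat w t x y H \<and> H \<le> - (1 / (2 * M + 1)) * w t x y)"
        by (meson order_trans)
    qed (use M0 wle in \<open>auto simp: G_def\<close>)
    hence "u t x1 y - u t x2 y \<le> N * (k * (2 - k))"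
      by (simp add: w_def k_def q_def field_simps)
    also have "\<dots> \<le> N * (2 * k)"
    proof (rule mult_left_mono)
      have "0 \<le> k * k" by simp
      thus "k * (2 - k) \<le> 2 * k" by (simp add: algebra_simps)
    qed (use M0 in \<open>simp add: N_def\<close>)
    also have "N * (2 * k) = N * (x1 - x2)" by (simp add: k_def)
    finally show ?thesis by (simp only: N_def)
  qed
qed

lemma space_lipschitz:
  assumes cont: "jcont u" and heat: "\<And>t x y. has_heat u t x y (g t x y)"
    and M: "\<And>t x y. \<bar>u t x y\<bar> \<le> M" and C: "\<And>t x y. \<bar>g t x y\<bar> \<le> C"
  shows "\<bar>u t x1 y1 - u t x2 y2\<bar> \<le> (2 * M + C + 1) * (\<bar>x1 - x2\<bar> + \<bar>y1 - y2\<bar>)"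
proof -
  have X: "\<bar>v t a b - v t a' b\<bar> \<le> (2 * M + C + 1) * \<bar>a - a'\<bar>"
    if v: "jcont v" "\<And>t x y. has_heat v t x y (k t x y)" "\<And>t x y. \<bar>v t x y\<bar> \<le> M"
      "\<And>t x y. \<bar>k t x y\<bar> \<le> C" for v k t a a' b
  proof -
    have mv: "jcont (\<lambda>t x y. - v t x y)"
      using continuous_on_minus[OF v(1)] by (simp add: case_prod_beta)
    have *: "v t p b - v t p' b \<le> (2 * M + C + 1) * (p - p')"
      "- v t p b - - v t p' b \<le> (2 * M + C + 1) * (p - p')" if "p' \<le> p" for p p'
      using space_lipschitz_one_sided[OF v that] 
        space_lipschitz_one_sided[OF mv has_heat_minus[OF v(2)], of M C p' p] v(3,4) that by auto
    show ?thesis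
    proof (cases "a \<le> a'")
      case True thus ?thesis using *[of a a'] by (simp add: abs_le_iff)
    next
      case False thus ?thesis using *[of a' a] by (simp add: abs_le_iff)
    qed
  qed
  have sw: "jcont (\<lambda>t x y. u t y x)"
    unfolding case_prod_beta by (intro jcont_compose[OF cont] continuous_intros)
  have "\<bar>u t x1 y1 - u t x2 y1\<bar> \<le> (2 * M + C + 1) * \<bar>x1 - x2\<bar>"
    by (rule X[OF cont heat M C])
  moreover have "\<bar>u t x2 y1 - u t x2 y2\<bar> \<le> (2 * M + C + 1) * \<bar>y1 - y2\<bar>"
    by (rule X[OF sw has_heat_swap[OF heat] M C])
  ultimately show ?thesis by (simp add: distrib_left abs_le_iff)
qed

lemma has_heat_parabola:
  "has_heat (\<lambda>t x y. l + k * ((x - x0)\<^sup>2 + (y - y0)\<^sup>2) + m * (t - t0)) t x y (m - 4 * k)"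
  by (rule has_heatI[where a=m and b="2 * k" and d="2 * k" and ux="\<lambda>s. 2 * k * (s - x0)"
        and uy="\<lambda>s. 2 * k * (s - y0)"])
     (auto intro!: derivative_eq_intros simp: algebra_simps)

text \<open>
  The spatial Lipschitz bound puts \<open>u(t0, \<cdot>)\<close> below the paraboloid \<open>u(t0, x, y) + e + k r\<^sup>2\<close>, and the
  paraboloid rising at the rate \<open>4k + C + 1\<close> is a strict supersolution from then on.
\<close>
lemma time_modulus_one_sided:
  assumes cont: "jcont u" and heat: "\<And>t x y. has_heat u t x y (g t x y)"
    and M: "\<And>t x y. \<bar>u t x y\<bar> \<le> M" and C: "\<And>t x y. \<bar>g t x y\<bar> \<le> C"
    and e: "e > 0" and le: "t0 \<le> t"
  shows "u t x y - u t0 x y \<le> e + (2 * (2 * M + C + 1)\<^sup>2 / e + C + 1) * (t - t0)"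
proof -
  define N where "N = 2 * M + C + 1"
  have M0: "M \<ge> 0" "C \<ge> 0" using M[of 0 0 0] C[of 0 0 0] by linarith+
  hence N0: "N > 0" by (simp add: N_def)
  \<comment> \<open>the curvature for which \<open>N |z| \<le> e / 2 + k z\<^sup>2\<close>\<close>
  define k where "k = N\<^sup>2 / (2 * e)"
  define m where "m = 4 * k + C + 1"
  have k: "k > 0" using N0 e by (simp add: k_def)
  have m: "m > 0" using k M0 by (simp add: m_def)
  have am: "N * \<bar>z\<bar> \<le> e / 2 + k * z\<^sup>2" for z
  proof -
    have "0 \<le> (N * \<bar>z\<bar> - e)\<^sup>2" by simp
    hence "2 * e * (N * \<bar>z\<bar>) \<le> e\<^sup>2 + N\<^sup>2 * z\<^sup>2"
      by (simp add: power2_diff power_mult_distrib algebra_simps)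
    thus ?thesis using e by (simp add: k_def field_simps power2_eq_square)
  qed
  define w where "w = (\<lambda>s a b. u s a b - (u t0 x y + e + k * ((a - x)\<^sup>2 + (b - y)\<^sup>2) + m * (s - t0)))"
  define G where "G = {(s :: real, a :: real, b :: real). t0 \<le> s}"
  have w0: "w t0 a b \<le> 0" for a b
  proof -
    have "u t0 a b - u t0 x y \<le> N * (\<bar>a - x\<bar> + \<bar>b - y\<bar>)"
      using space_lipschitz[OF cont heat M C, of t0 a b x y] by (simp add: N_def)
    thus ?thesis using am[of "a - x"] am[of "b - y"] by (simp add: w_def algebra_simps)
  qed
  have wle: "w s a b \<le> 2 * M" if "s \<ge> t0" for s a b
  proof -
    have "0 \<le> k * ((a - x)\<^sup>2 + (b - y)\<^sup>2)" "0 \<le> m * (s - t0)" using k m that by simp_all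
    thus ?thesis using M[of s a b] M[of t0 x y] e unfolding w_def by linarith
  qed
  have "w t x y \<le> 0"
  proof (rule max_principle[where w=w and G=G and lam="1 / (2 * M + 1)" and B="2 * M"])
    show "jcont w" unfolding w_def case_prod_beta
      by (intro jcont_compose[OF cont] continuous_intros)
    have "G = fst -` {t0..}" by (auto simp: G_def)
    thus "closed G" by (simp add: closed_vimage continuous_on_fst continuous_on_snd)
    show "(t, x, y) \<in> G" using le by (auto simp: G_def)
  next
    fix s a b assume G: "(s, a, b) \<in> G" and pos: "w s a b > 0"
    have "s \<noteq> t0" using pos w0[of a b] by auto
    hence s: "s > t0" using G by (auto simp: G_def)
    have "open (fst -` {t0<..} :: (real \<times> real \<times> real) set)"
      by (simp add: open_vimage continuous_on_fst continuous_on_snd)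
    hence "(s, a, b) \<in> interior G"
      by (rule interiorI) (use s in \<open>auto simp: G_def\<close>)
    moreover have "has_heat w s a b (g s a b - (m - 4 * k))"
      unfolding w_def by (intro has_heat_diff heat has_heat_parabola)
    moreover have "g s a b - (m - 4 * k) \<le> - 1"
      using C[of s a b] by (auto simp: m_def)
    moreover have "- 1 \<le> - (1 / (2 * M + 1)) * w s a b"
      using wle[of s a b] s M0 by (simp add: field_simps)
    ultimately show "(s, a, b) \<in> interior G \<and>
        (\<exists>H. has_heat w s a b H \<and> H \<le> - (1 / (2 * M + 1)) * w s a b)"
      by (meson order_trans)
  qed (use M0 wle in \<open>auto simp: G_def\<close>)
  thus ?thesis by (simp add: w_def m_def k_def N_def algebra_simps)
qed

lemma time_modulus:
  assumes cont: "jcont u" and heat: "\<And>t x y. has_heat u t x y (g t x y)"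
    and M: "\<And>t x y. \<bar>u t x y\<bar> \<le> M" and C: "\<And>t x y. \<bar>g t x y\<bar> \<le> C" and e: "e > 0"
  shows "\<exists>h>0. \<forall>t s x y. \<bar>t - s\<bar> \<le> h \<longrightarrow> \<bar>u t x y - u s x y\<bar> \<le> e"
proof -
  have M0: "M \<ge> 0" "C \<ge> 0" using M[of 0 0 0] C[of 0 0 0] by linarith+
  define k where "k = 2 * (2 * M + C + 1)\<^sup>2 / (e / 2) + C + 1"
  have k: "k > 0" using M0 e by (auto simp: k_def intro!: add_nonneg_pos add_nonneg_nonneg divide_nonneg_pos)
  have mv: "jcont (\<lambda>t x y. - u t x y)"
    using continuous_on_minus[OF cont] by (simp add: case_prod_beta)
  have main: "\<bar>u t x y - u s x y\<bar> \<le> e" if "s \<le> t" "t - s \<le> e / (2 * k)" for t s x y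
  proof -
    have "u t x y - u s x y \<le> e / 2 + k * (t - s)"
      using time_modulus_one_sided[OF cont heat M C, of "e / 2" s t x y] that e by (simp add: k_def)
    moreover have "- u t x y - - u s x y \<le> e / 2 + k * (t - s)"
      using time_modulus_one_sided[OF mv has_heat_minus[OF heat], of M C "e / 2" s t x y] M C that e
      by (simp add: k_def)
    moreover have "k * (t - s) \<le> e / 2"
      using that(2) k by (simp add: field_simps)
    ultimately show ?thesis by linarith
  qed
  show ?thesis
  proof (intro exI[of _ "e / (2 * k)"] conjI allI impI)
    fix t s x y assume "\<bar>t - s\<bar> \<le> e / (2 * k)"
    thus "\<bar>u t x y - u s x y\<bar> \<le> e"
      using main[of s t x y] main[of t s x y] by (cases "s \<le> t") (auto simp: abs_minus_commute)
  qed (use k e in simp)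
qed

section \<open>Propagation of a positive lower bound\<close>

lemma has_heat_barrier:
  fixes N c a r t1 x1 y1 :: real
  defines "q \<equiv> \<lambda>t x y. r\<^sup>2 + a * (t - t1) - ((x - x1)\<^sup>2 + (y - y1)\<^sup>2)"
  shows "has_heat (\<lambda>t x y. c * exp (- N * (t - t1)) * (q t x y)\<^sup>2) t x y
     (c * exp (- N * (t - t1)) * (- N * (q t x y)\<^sup>2 + 2 * a * q t x y
        - 8 * ((x - x1)\<^sup>2 + (y - y1)\<^sup>2) + 8 * q t x y))"
proof -
  define E where "E = c * exp (- N * (t - t1))"
  have d1: "((\<lambda>s. k * (A - ((s - p)\<^sup>2 + B))\<^sup>2) has_real_derivative
      k * (- 4 * (s - p) * (A - ((s - p)\<^sup>2 + B)))) (at s)" for k A B p s :: real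
    by (rule derivative_eq_intros refl | simp)+
  have d2: "((\<lambda>s. k * (- 4 * (s - p) * (A - ((s - p)\<^sup>2 + B)))) has_real_derivative
      k * (8 * (s - p)\<^sup>2 - 4 * (A - ((s - p)\<^sup>2 + B)))) (at s)" for k A B p s :: real
    by (rule derivative_eq_intros refl | simp)+ (simp add: algebra_simps power2_eq_square)
  have d3: "((\<lambda>s. c * exp (- N * (s - t1)) * (A + a * (s - t1) - B)\<^sup>2) has_real_derivative
      c * exp (- N * (s - t1)) * (- N * (A + a * (s - t1) - B)\<^sup>2 + 2 * a * (A + a * (s - t1) - B)))
      (at s)" for A B s :: real
    by (rule derivative_eq_intros refl | simp)+ algebra
  have "E * (- N * (q t x y)\<^sup>2 + 2 * a * q t x y - 8 * ((x - x1)\<^sup>2 + (y - y1)\<^sup>2) + 8 * q t x y)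
      = E * (- N * (q t x y)\<^sup>2 + 2 * a * q t x y)
        - (E * (8 * (x - x1)\<^sup>2 - 4 * q t x y) + E * (8 * (y - y1)\<^sup>2 - 4 * q t x y))"
    by (simp add: algebra_simps)
  note eq = this[unfolded E_def q_def]
  note d1' = d1[where k="c * exp (- N * (t - t1))" and A="r\<^sup>2 + a * (t - t1)"]
  note d2' = d2[where k="c * exp (- N * (t - t1))" and A="r\<^sup>2 + a * (t - t1)"]
  show ?thesis
    unfolding q_def
  proof (rule has_heatI)
    show "((\<lambda>s. c * exp (- N * (t - t1)) * (r\<^sup>2 + a * (t - t1) - ((s - x1)\<^sup>2 + (y - y1)\<^sup>2))\<^sup>2)
        has_real_derivative c * exp (- N * (t - t1)) * (- 4 * (s - x1) *
          (r\<^sup>2 + a * (t - t1) - ((s - x1)\<^sup>2 + (y - y1)\<^sup>2)))) (at s)" for s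
      by (rule d1')
    show "((\<lambda>s. c * exp (- N * (t - t1)) * (r\<^sup>2 + a * (t - t1) - ((x - x1)\<^sup>2 + (s - y1)\<^sup>2))\<^sup>2)
        has_real_derivative c * exp (- N * (t - t1)) * (- 4 * (s - y1) *
          (r\<^sup>2 + a * (t - t1) - ((s - y1)\<^sup>2 + (x - x1)\<^sup>2)))) (at s)" for s
      using d1'[where B="(x - x1)\<^sup>2" and p=y1 and s=s] by (simp only: add.commute)
    show "((\<lambda>s. c * exp (- N * (t - t1)) * (- 4 * (s - y1) *
          (r\<^sup>2 + a * (t - t1) - ((s - y1)\<^sup>2 + (x - x1)\<^sup>2)))) has_real_derivative
        c * exp (- N * (t - t1)) * (8 * (y - y1)\<^sup>2
          - 4 * (r\<^sup>2 + a * (t - t1) - ((x - x1)\<^sup>2 + (y - y1)\<^sup>2)))) (at y)"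
      using d2'[where B="(x - x1)\<^sup>2" and p=y1 and s=y] by (simp only: add.commute)
  qed (rule d3 d2' eq)+
qed

text \<open>
  A quantitative strong maximum principle. The function \<open>\<zeta> = c exp (- N (t - t1)) q\<^sup>2\<close> on the region
  \<open>q = r\<^sup>2 + a (t - t1) - |z - z1|\<^sup>2 \<ge> 0\<close> vanishes on the lateral boundary of an expanding paraboloid. It is a
  subsolution of \<open>w\<^sub>t - \<Delta>w = - K w\<close>: near the boundary the term \<open>- 8|z - z1|\<^sup>2\<close> dominates, and away from
  it the decay rate \<open>N\<close> does. The speed \<open>a\<close> is chosen such that the disc of radius \<open>\<rho>\<close> is well inside the
  paraboloid at time \<open>t1 + T1\<close>.
\<close>
lemma lower_barrier:
  assumes K: "K > 0" and r: "r > 0" and \<delta>: "\<delta> > 0" and \<rho>: "\<rho> > 0" and T1: "T1 > 0"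
  shows "\<exists>\<epsilon>>0. \<forall>w t1 x1 y1 t x y.
     jcont w \<longrightarrow> (\<forall>t x y. 0 \<le> w t x y) \<longrightarrow>
     (\<forall>t x y. \<exists>H. has_heat w t x y H \<and> - K * w t x y \<le> H) \<longrightarrow>
     (\<forall>x y. (x - x1)\<^sup>2 + (y - y1)\<^sup>2 \<le> r\<^sup>2 \<longrightarrow> \<delta> \<le> w t1 x y) \<longrightarrow>
     T1 \<le> t - t1 \<longrightarrow> t - t1 \<le> T2 \<longrightarrow> (x - x1)\<^sup>2 + (y - y1)\<^sup>2 \<le> \<rho>\<^sup>2 \<longrightarrow> \<epsilon> \<le> w t x y"
proof -
  define a where "a = 2 * \<rho>\<^sup>2 / T1"
  define b where "b = 2 * a + 16"
  \<comment> \<open>The second summand makes the barrier a subsolution, the third keeps it below \<open>\<delta>\<close> while it expands.\<close>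
  define N where "N = K + b\<^sup>2 / (32 * r\<^sup>2) + 2 * a / r\<^sup>2"
  define c where "c = \<delta> / r ^ 4"
  have a: "a > 0" and c: "c > 0" using \<rho> T1 \<delta> r by (auto simp: a_def c_def)
  have N: "N > 0" "N \<ge> 2 * a / r\<^sup>2" "N - b\<^sup>2 / (32 * r\<^sup>2) \<ge> K"
    using K a r by (auto simp: N_def intro!: add_pos_nonneg)
  show ?thesis
  proof (rule exI[of _ "\<delta> * exp (- N * T2)"], intro conjI allI impI)
    show "0 < \<delta> * exp (- N * T2)" using \<delta> by simp
    fix w t1 x1 y1 t x y
    assume cont: "jcont w" and nn: "\<forall>t x y. 0 \<le> w t x y"
      and heat: "\<forall>t x y. \<exists>H. has_heat w t x y H \<and> - K * w t x y \<le> H"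
      and ini: "\<forall>x y. (x - x1)\<^sup>2 + (y - y1)\<^sup>2 \<le> r\<^sup>2 \<longrightarrow> \<delta> \<le> w t1 x y"
      and t: "T1 \<le> t - t1" "t - t1 \<le> T2" and z: "(x - x1)\<^sup>2 + (y - y1)\<^sup>2 \<le> \<rho>\<^sup>2"
    define q where "q = (\<lambda>t x y. r\<^sup>2 + a * (t - t1) - ((x - x1)\<^sup>2 + (y - y1)\<^sup>2))"
    define \<zeta> where "\<zeta> = (\<lambda>t x y. c * exp (- N * (t - t1)) * (q t x y)\<^sup>2)"
    define G where "G = {(t, x, y). t1 \<le> t \<and> 0 \<le> q t x y}"
    have zle: "\<zeta> t x y \<le> \<delta>" if "t1 \<le> t" "0 \<le> q t x y" for t x y
    proof -
      define \<tau> where "\<tau> = t - t1"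
      have \<tau>: "\<tau> \<ge> 0" using that by (simp add: \<tau>_def)
      have "q t x y \<le> r\<^sup>2 + a * \<tau>" by (simp add: q_def \<tau>_def)
      also have "\<dots> = r\<^sup>2 * (1 + a * \<tau> / r\<^sup>2)" using r by (simp add: field_simps)
      also have "\<dots> \<le> r\<^sup>2 * exp (a * \<tau> / r\<^sup>2)" using r by (intro mult_left_mono) auto
      finally have "(q t x y)\<^sup>2 \<le> (r\<^sup>2 * exp (a * \<tau> / r\<^sup>2))\<^sup>2"
        using that by (intro power_mono) auto
      also have "\<dots> = r ^ 4 * exp (2 * a / r\<^sup>2 * \<tau>)"
        using exp_double[of "a * \<tau> / r\<^sup>2"] by (simp add: power_mult_distrib mult_ac)
      also have "\<dots> \<le> r ^ 4 * exp (N * \<tau>)"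
        using mult_right_mono[OF N(2) \<tau>] by (intro mult_left_mono) auto
      finally have "exp (- N * \<tau>) * (q t x y)\<^sup>2 \<le> exp (- N * \<tau>) * (r ^ 4 * exp (N * \<tau>))"
        by (intro mult_left_mono) auto
      also have "\<dots> = r ^ 4" by (simp add: exp_minus field_simps)
      finally have "c * (exp (- N * \<tau>) * (q t x y)\<^sup>2) \<le> c * r ^ 4"
        using c by (intro mult_left_mono) auto
      thus ?thesis using r by (simp add: \<zeta>_def \<tau>_def c_def mult.assoc)
    qed
    have open_q: "continuous_on UNIV (\<lambda>(t, x, y). q t x y)"
      unfolding q_def case_prod_beta by (intro continuous_intros)
    have dz: "\<zeta> t x y - w t x y \<le> 0" if "(t, x, y) \<in> G" for t x y
    proof (rule max_principle[where G=G and lam=K and B=\<delta> and w="\<lambda>t x y. \<zeta> t x y - w t x y", OF _ _ K])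
      show "jcont (\<lambda>t x y. \<zeta> t x y - w t x y)" unfolding \<zeta>_def q_def case_prod_beta
        by (intro jcont_compose[OF cont] continuous_intros)
      have "G = fst -` {t1..} \<inter> (\<lambda>(t, x, y). q t x y) -` {0..}" by (auto simp: G_def)
      thus "closed G"
        using open_q by (simp add: closed_vimage closed_Int continuous_on_fst)
      show "(t, x, y) \<in> G" by fact
      show "\<zeta> t x y - w t x y \<le> \<delta>" if "(t, x, y) \<in> G" for t x y
        using that zle[of t x y] nn[rule_format, of t x y] by (simp add: G_def)
    next
      fix t x y assume G: "(t, x, y) \<in> G" and pos: "\<zeta> t x y - w t x y > 0"
      have "t \<noteq> t1"
      proof
        assume t: "t = t1"
        hence "(x - x1)\<^sup>2 + (y - y1)\<^sup>2 \<le> r\<^sup>2" using G by (simp add: G_def q_def)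
        hence "\<delta> \<le> w t x y" using ini t by simp
        moreover have "\<zeta> t x y \<le> \<delta>" using zle[of t x y] G by (simp add: G_def)
        ultimately show False using pos by simp
      qed
      moreover have "q t x y \<noteq> 0"
        using pos nn[rule_format, of t x y] by (auto simp: \<zeta>_def)
      ultimately have tq: "t1 < t" "0 < q t x y" using G by (auto simp: G_def)
      have "open (fst -` {t1<..} \<inter> (\<lambda>(t, x, y). q t x y) -` {0<..})"
        using open_q by (simp add: open_vimage open_Int continuous_on_fst)
      hence "(t, x, y) \<in> interior G"
        by (rule interiorI) (use tq in \<open>auto simp: G_def\<close>)
      moreover obtain H where H: "has_heat w t x y H" "- K * w t x y \<le> H" using heat by blast
      define J where "J = c * exp (- N * (t - t1)) * (- N * (q t x y)\<^sup>2 + 2 * a * q t x y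
        - 8 * ((x - x1)\<^sup>2 + (y - y1)\<^sup>2) + 8 * q t x y)"
      have "has_heat \<zeta> t x y J"
        unfolding \<zeta>_def J_def q_def by (rule has_heat_barrier)
      hence "has_heat (\<lambda>t x y. \<zeta> t x y - w t x y) t x y (J - H)"
        by (rule has_heat_diff) (rule H)
      moreover have "J - H \<le> - K * (\<zeta> t x y - w t x y)"
      proof -
        let ?q = "q t x y"
        have "(x - x1)\<^sup>2 + (y - y1)\<^sup>2 = r\<^sup>2 + a * (t - t1) - ?q" by (simp add: q_def)
        also have "\<dots> \<ge> r\<^sup>2 - ?q" using a tq by simp
        finally have z: "(x - x1)\<^sup>2 + (y - y1)\<^sup>2 \<ge> r\<^sup>2 - ?q" .
        have "0 \<le> (16 * r\<^sup>2 - b * ?q)\<^sup>2" by simp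
        hence "32 * r\<^sup>2 * (b * ?q) \<le> 32 * r\<^sup>2 * (8 * r\<^sup>2) + b\<^sup>2 * ?q\<^sup>2"
          by (simp add: power2_eq_square algebra_simps)
        hence bq: "b * ?q \<le> 8 * r\<^sup>2 + b\<^sup>2 / (32 * r\<^sup>2) * ?q\<^sup>2"
          using r by (simp add: field_simps)
        have "K * ?q\<^sup>2 \<le> (N - b\<^sup>2 / (32 * r\<^sup>2)) * ?q\<^sup>2"
          using N(3) by (intro mult_right_mono) auto
        hence "- N * ?q\<^sup>2 + 2 * a * ?q - 8 * ((x - x1)\<^sup>2 + (y - y1)\<^sup>2) + 8 * ?q \<le> - K * ?q\<^sup>2"
          using z bq by (simp add: b_def algebra_simps)
        hence "J \<le> c * exp (- N * (t - t1)) * (- K * ?q\<^sup>2)"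
          unfolding J_def using c by (intro mult_left_mono) auto
        also have "\<dots> = - K * \<zeta> t x y" by (simp add: \<zeta>_def)
        finally show ?thesis using H(2) by (simp add: algebra_simps)
      qed
      ultimately show "(t, x, y) \<in> interior G \<and>
          (\<exists>H. has_heat (\<lambda>t x y. \<zeta> t x y - w t x y) t x y H \<and> H \<le> - K * (\<zeta> t x y - w t x y))"
        by blast
    qed
    have "a * (t - t1) \<ge> a * T1" using t a by (intro mult_left_mono) auto
    hence "a * (t - t1) \<ge> 2 * \<rho>\<^sup>2" using T1 by (simp add: a_def)
    moreover have "0 \<le> \<rho>\<^sup>2" by simp
    ultimately have q: "q t x y \<ge> r\<^sup>2" using z unfolding q_def by linarith
    have "0 \<le> q t x y" using q zero_le_power2[of r] by linarith
    hence "(t, x, y) \<in> G" using t T1 by (auto simp: G_def)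
    from dz[OF this] have "\<zeta> t x y \<le> w t x y" by simp
    moreover have "\<delta> * exp (- N * T2) \<le> \<zeta> t x y"
    proof -
      have "(r\<^sup>2)\<^sup>2 \<le> (q t x y)\<^sup>2" using q by (intro power_mono) auto
      moreover have "exp (- N * T2) \<le> exp (- N * (t - t1))"
        using t N(1) by (simp add: mult_left_mono)
      ultimately have "exp (- N * T2) * (r\<^sup>2)\<^sup>2 \<le> exp (- N * (t - t1)) * (q t x y)\<^sup>2"
        by (intro mult_mono) auto
      hence "c * (exp (- N * T2) * (r\<^sup>2)\<^sup>2) \<le> c * (exp (- N * (t - t1)) * (q t x y)\<^sup>2)"
        using c by (intro mult_left_mono) auto
      moreover have "c * (exp (- N * T2) * (r\<^sup>2)\<^sup>2) = \<delta> * exp (- N * T2)"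
        using r by (simp add: c_def)
      ultimately show ?thesis by (simp only: \<zeta>_def mult.assoc)
    qed
    ultimately show "\<delta> * exp (- N * T2) \<le> w t x y" by linarith
  qed
qed

section \<open>Integrals over squares\<close>

abbreviation cont2 :: "(real \<Rightarrow> real \<Rightarrow> real) \<Rightarrow> bool" where
  "cont2 F \<equiv> continuous_on UNIV (\<lambda>(x, y). F x y)"

text \<open>
  Squares suffice in place of the plane: every function that is integrated by parts vanishes on the boundary.
\<close>
definition sqint :: "real \<Rightarrow> (real \<Rightarrow> real \<Rightarrow> real) \<Rightarrow> real" where
  "sqint b F = integral (cbox (- b, - b) (b, b)) (\<lambda>(x, y). F x y)"

lemma sqint_integrable:
  "cont2 F \<Longrightarrow> (\<lambda>(x, y). F x y) integrable_on cbox (- b, - b) (b :: real, b :: real)"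
  by (intro integrable_continuous) (rule continuous_on_subset, auto)

lemma sqint_add:
  assumes "cont2 F" "cont2 G"
  shows "sqint b (\<lambda>x y. F x y + G x y) = sqint b F + sqint b G"
  using integral_add[OF assms[THEN sqint_integrable], of b]
  by (simp add: sqint_def case_prod_unfold)

lemma sqint_cmult: "sqint b (\<lambda>x y. k * F x y) = k * sqint b F"
  by (simp add: sqint_def case_prod_unfold)

lemma sqint_minus: "sqint b (\<lambda>x y. - F x y) = - sqint b F"
  by (simp add: sqint_def case_prod_unfold)

lemma sqint_diff:
  assumes "cont2 F" "cont2 G"
  shows "sqint b (\<lambda>x y. F x y - G x y) = sqint b F - sqint b G"
  using integral_diff[OF assms[THEN sqint_integrable], of b]
  by (simp add: sqint_def case_prod_unfold)

lemma sqint_mono: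
  assumes "cont2 F" "cont2 G" "\<And>x y. \<bar>x\<bar> \<le> b \<Longrightarrow> \<bar>y\<bar> \<le> b \<Longrightarrow> F x y \<le> G x y"
  shows "sqint b F \<le> sqint b G"
  unfolding sqint_def
  by (intro integral_le sqint_integrable assms) (use assms(3) in \<open>auto simp: abs_le_iff\<close>)

lemma sqint_nonneg:
  assumes "cont2 F" "\<And>x y. \<bar>x\<bar> \<le> b \<Longrightarrow> \<bar>y\<bar> \<le> b \<Longrightarrow> 0 \<le> F x y"
  shows "0 \<le> sqint b F"
  unfolding sqint_def
  by (intro integral_nonneg sqint_integrable assms) (use assms(2) in \<open>auto simp: abs_le_iff\<close>)

lemma sqint_abs_le:
  assumes "cont2 F" "cont2 G" "\<And>x y. \<bar>x\<bar> \<le> b \<Longrightarrow> \<bar>y\<bar> \<le> b \<Longrightarrow> \<bar>F x y\<bar> \<le> G x y"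
  shows "\<bar>sqint b F\<bar> \<le> sqint b G"
proof -
  have "cont2 (\<lambda>x y. - F x y)"
    using continuous_on_minus[OF assms(1)] by (simp add: case_prod_beta)
  hence "- sqint b F \<le> sqint b G"
    using sqint_mono[of "\<lambda>x y. - F x y" G b] assms by (force simp: sqint_minus abs_le_iff)
  moreover have "sqint b F \<le> sqint b G" by (intro sqint_mono assms(1,2)) (use assms(3) in \<open>force simp: abs_le_iff\<close>)
  ultimately show ?thesis by linarith
qed

lemma sqint_const: "b \<ge> 0 \<Longrightarrow> sqint b (\<lambda>_ _. k) = (2 * b)\<^sup>2 * k"
  by (simp add: sqint_def case_prod_unfold content_Pair power2_eq_square)

lemma sqint_zero_imp:
  assumes c: "cont2 F" and nn: "\<And>x y. 0 \<le> F x y" and z: "sqint b F = 0" and b: "b > 0"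
    and xy: "\<bar>x\<bar> \<le> b" "\<bar>y\<bar> \<le> b"
  shows "F x y = 0"
proof -
  have ne: "box (- b, - b) (b, b) \<noteq> {}" using b by (simp add: box_ne_empty Basis_prod_def)
  have *: "\<forall>p\<in>cbox (- b, - b) (b, b). (\<lambda>(x, y). F x y) p = 0"
    by (subst integral_cbox_eq_0_iff[symmetric])
       (use c nn z ne in \<open>auto simp: sqint_def intro: continuous_on_subset\<close>)
  have "(x, y) \<in> cbox (- b, - b) (b, b)" using xy by (auto simp: abs_le_iff)
  from bspec[OF * this] show ?thesis by simp
qed

lemma sqint_dx:
  assumes c: "cont2 Fx" and b: "b \<ge> 0"
    and d: "\<And>x y. ((\<lambda>s. F s y) has_real_derivative Fx x y) (at x)"
    and bd: "\<And>y. F b y = F (- b) y"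
  shows "sqint b Fx = 0"
proof -
  have "integral {- b..b} (\<lambda>x. Fx x y) = F b y - F (- b) y" for y
    using b d by (intro integral_unique fundamental_theorem_of_calculus)
      (auto simp: has_real_derivative_iff_has_vector_derivative[symmetric] intro: has_field_derivative_at_within)
  hence z: "integral {- b..b} (\<lambda>x. Fx x y) = 0" for y by (simp add: bd)
  have c': "continuous_on (cbox (- b, - b) (b, b)) (\<lambda>(x, y). Fx x y)"
    by (rule continuous_on_subset[OF c]) auto
  have "sqint b Fx = integral {- b..b} (\<lambda>x. integral {- b..b} (Fx x))"
    unfolding sqint_def by (subst integral_prod_continuous[OF c']) simp
  also have "\<dots> = integral {- b..b} (\<lambda>y. integral {- b..b} (\<lambda>x. Fx x y))"
    using integral_swap_continuous[OF c'] by simp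
  also have "\<dots> = 0" by (simp add: z)
  finally show ?thesis .
qed

lemma sqint_dy:
  assumes c: "cont2 Fy" and b: "b \<ge> 0"
    and d: "\<And>x y. ((\<lambda>s. F x s) has_real_derivative Fy x y) (at y)"
    and bd: "\<And>x. F x b = F x (- b)"
  shows "sqint b Fy = 0"
proof -
  have "integral {- b..b} (Fy x) = F x b - F x (- b)" for x
    using b d by (intro integral_unique fundamental_theorem_of_calculus)
      (auto simp: has_real_derivative_iff_has_vector_derivative[symmetric] intro: has_field_derivative_at_within)
  hence z: "integral {- b..b} (Fy x) = 0" for x by (simp add: bd)
  have c': "continuous_on (cbox (- b, - b) (b, b)) (\<lambda>(x, y). Fy x y)"
    by (rule continuous_on_subset[OF c]) auto
  have "sqint b Fy = integral {- b..b} (\<lambda>x. integral {- b..b} (Fy x))"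
    unfolding sqint_def by (subst integral_prod_continuous[OF c']) simp
  also have "\<dots> = 0" by (simp add: z)
  finally show ?thesis .
qed

abbreviation cont3 :: "real set \<Rightarrow> (real \<Rightarrow> real \<Rightarrow> real \<Rightarrow> real) \<Rightarrow> bool" where
  "cont3 T u \<equiv> continuous_on (T \<times> UNIV) (\<lambda>(t, x, y). u t x y)"

lemma cont3_cont2:
  assumes "cont3 T u" "t \<in> T"
  shows "cont2 (u t)"
proof -
  have "continuous_on UNIV (\<lambda>p :: real \<times> real. (t, p))" by (intro continuous_intros)
  from continuous_on_compose2[OF assms(1) this] assms(2) show ?thesis by (auto simp: case_prod_beta)
qed

lemma sqint_derivative:
  assumes T: "open T" "t \<in> T" and c: "cont3 T u" "cont3 T ut"
    and d: "\<And>s x y. s \<in> T \<Longrightarrow> ((\<lambda>s. u s x y) has_real_derivative ut s x y) (at s)"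
  shows "((\<lambda>s. sqint b (u s)) has_real_derivative sqint b (ut t)) (at t)"
proof -
  obtain e where e: "e > 0" "ball t e \<subseteq> T" using T openE by blast
  have "((\<lambda>s. integral (cbox (- b, - b) (b, b)) (\<lambda>(x, y). u s x y)) has_real_derivative
      integral (cbox (- b, - b) (b, b)) ((\<lambda>s (x, y). ut s x y) t)) (at t within ball t e)"
  proof (rule leibniz_rule_field_derivative)
    show "continuous_on (ball t e \<times> cbox (- b, - b) (b, b)) (\<lambda>(s, p). (\<lambda>s (x, y). ut s x y) s p)"
      by (rule continuous_on_subset[of "T \<times> UNIV"]) (use c(2) e in \<open>auto simp: case_prod_beta\<close>)
    show "(\<lambda>(x, y). u s x y) integrable_on cbox (- b, - b) (b, b)" if "s \<in> ball t e" for s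
      using sqint_integrable[OF cont3_cont2[OF c(1), of s]] that e by auto
    show "((\<lambda>s. case p of (x, y) \<Rightarrow> u s x y) has_real_derivative (case p of (x, y) \<Rightarrow> ut s x y))
        (at s within ball t e)" if "s \<in> ball t e" for s p
      using has_field_derivative_at_within[OF d[of s "fst p" "snd p"], of "ball t e"] that e
      by (auto simp: case_prod_beta)
  qed (use e in auto)
  thus ?thesis unfolding sqint_def using at_within_open[of t "ball t e"] e by simp
qed

lemma sqint_continuous:
  assumes c: "cont3 T u"
  shows "continuous_on T (\<lambda>s. sqint b (u s))"
  unfolding sqint_def
  by (rule integral_continuous_on_param)
     (rule continuous_on_subset[of "T \<times> UNIV"], use c in \<open>auto simp: case_prod_beta\<close>)

section \<open>Calculus of classical functions of time and two space variables\<close>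

text \<open>
  The derivatives are arguments rather than existentially bound because they occur in the
  integrands below. No derivative of \<open>ux\<close> or \<open>uy\<close> in \<open>t\<close> is assumed to exist; the energy
  identities must do without it.
\<close>
definition C12 where
  "C12 T u ut ux uy uxx uxy uyy \<longleftrightarrow>
     (\<forall>g\<in>{u, ut, ux, uy, uxx, uxy, uyy}. cont3 T g) \<and>
     (\<forall>t\<in>T. \<forall>x y.
           ((\<lambda>s. u s x y) has_real_derivative ut t x y) (at t) \<and>
           ((\<lambda>s. u t s y) has_real_derivative ux t x y) (at x) \<and>
           ((\<lambda>s. u t x s) has_real_derivative uy t x y) (at y) \<and>
           ((\<lambda>s. ux t s y) has_real_derivative uxx t x y) (at x) \<and>
           ((\<lambda>s. ux t x s) has_real_derivative uxy t x y) (at y) \<and>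
           ((\<lambda>s. uy t s y) has_real_derivative uxy t x y) (at x) \<and>
           ((\<lambda>s. uy t x s) has_real_derivative uyy t x y) (at y))"

lemma C12_cont:
  assumes "C12 T u ut ux uy uxx uxy uyy"
  shows "cont3 T u" "cont3 T ut" "cont3 T ux" "cont3 T uy" "cont3 T uxx" "cont3 T uxy" "cont3 T uyy"
  using assms unfolding C12_def by auto

lemma C12_deriv:
  assumes "C12 T u ut ux uy uxx uxy uyy" "t \<in> T"
  shows "((\<lambda>s. u s x y) has_real_derivative ut t x y) (at t)"
    "((\<lambda>s. u t s y) has_real_derivative ux t x y) (at x)"
    "((\<lambda>s. u t x s) has_real_derivative uy t x y) (at y)"
    "((\<lambda>s. ux t s y) has_real_derivative uxx t x y) (at x)"
    "((\<lambda>s. ux t x s) has_real_derivative uxy t x y) (at y)"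
    "((\<lambda>s. uy t s y) has_real_derivative uxy t x y) (at x)"
    "((\<lambda>s. uy t x s) has_real_derivative uyy t x y) (at y)"
  using assms unfolding C12_def by auto

lemma cont3_un:
  assumes "cont3 T u"
  shows "cont3 T (\<lambda>t x y. - u t x y)" "cont3 T (\<lambda>t x y. (u t x y)\<^sup>2)" "cont3 T (\<lambda>t x y. k * u t x y)"
  using assms unfolding case_prod_unfold by (intro continuous_intros; simp)+

lemma cont3_bin:
  assumes "cont3 T u" "cont3 T v"
  shows "cont3 T (\<lambda>t x y. u t x y + v t x y)" "cont3 T (\<lambda>t x y. u t x y - v t x y)"
    "cont3 T (\<lambda>t x y. u t x y * v t x y)"
  using assms unfolding case_prod_unfold by (intro continuous_intros; simp)+

lemma cont2_un:
  assumes "cont2 u"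
  shows "cont2 (\<lambda>x y. - u x y)" "cont2 (\<lambda>x y. (u x y)\<^sup>2)" "cont2 (\<lambda>x y. k * u x y)"
  using assms unfolding case_prod_unfold by (intro continuous_intros; simp)+

lemma cont2_bin:
  assumes "cont2 u" "cont2 v"
  shows "cont2 (\<lambda>x y. u x y + v x y)" "cont2 (\<lambda>x y. u x y - v x y)" "cont2 (\<lambda>x y. u x y * v x y)"
  using assms unfolding case_prod_unfold by (intro continuous_intros; simp)+

lemmas cont3_lin = cont3_un cont3_bin
lemmas cont2_lin = cont2_un cont2_bin

lemma C12_mult:
  assumes u: "C12 T u ut ux uy uxx uxy uyy" and v: "C12 T v vt vx vy vxx vxy vyy"
  shows "C12 T (\<lambda>t x y. u t x y * v t x y)
     (\<lambda>t x y. ut t x y * v t x y + u t x y * vt t x y)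
     (\<lambda>t x y. ux t x y * v t x y + u t x y * vx t x y)
     (\<lambda>t x y. uy t x y * v t x y + u t x y * vy t x y)
     (\<lambda>t x y. uxx t x y * v t x y + 2 * (ux t x y * vx t x y) + u t x y * vxx t x y)
     (\<lambda>t x y. uxy t x y * v t x y + (ux t x y * vy t x y + uy t x y * vx t x y) + u t x y * vxy t x y)
     (\<lambda>t x y. uyy t x y * v t x y + 2 * (uy t x y * vy t x y) + u t x y * vyy t x y)"
  unfolding C12_def
proof (intro conjI ballI allI)
  fix t x y assume t: "t \<in> T"
  note [derivative_intros] = C12_deriv[OF u t] C12_deriv[OF v t]
  show "((\<lambda>s. u s x y * v s x y) has_real_derivative ut t x y * v t x y + u t x y * vt t x y) (at t)"
    by (auto intro!: derivative_eq_intros)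
  show "((\<lambda>s. u t s y * v t s y) has_real_derivative ux t x y * v t x y + u t x y * vx t x y) (at x)"
    by (auto intro!: derivative_eq_intros)
  show "((\<lambda>s. u t x s * v t x s) has_real_derivative uy t x y * v t x y + u t x y * vy t x y) (at y)"
    by (auto intro!: derivative_eq_intros)
  show "((\<lambda>s. ux t s y * v t s y + u t s y * vx t s y) has_real_derivative
      uxx t x y * v t x y + 2 * (ux t x y * vx t x y) + u t x y * vxx t x y) (at x)"
    by (auto intro!: derivative_eq_intros)
  show "((\<lambda>s. ux t x s * v t x s + u t x s * vx t x s) has_real_derivative
      uxy t x y * v t x y + (ux t x y * vy t x y + uy t x y * vx t x y) + u t x y * vxy t x y) (at y)"
    by (auto intro!: derivative_eq_intros)
  show "((\<lambda>s. uy t s y * v t s y + u t s y * vy t s y) has_real_derivative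
      uxy t x y * v t x y + (ux t x y * vy t x y + uy t x y * vx t x y) + u t x y * vxy t x y) (at x)"
    by (auto intro!: derivative_eq_intros)
  show "((\<lambda>s. uy t x s * v t x s + u t x s * vy t x s) has_real_derivative
      uyy t x y * v t x y + 2 * (uy t x y * vy t x y) + u t x y * vyy t x y) (at y)"
    by (auto intro!: derivative_eq_intros)
qed (use C12_cont[OF u] C12_cont[OF v] in \<open>auto intro!: cont3_lin\<close>)

lemma C12_subset:
  assumes "C12 T u ut ux uy uxx uxy uyy" "S \<subseteq> T"
  shows "C12 S u ut ux uy uxx uxy uyy"
proof -
  have "S \<times> (UNIV :: (real \<times> real) set) \<subseteq> T \<times> UNIV" using assms(2) by auto
  from continuous_on_subset[OF _ this] show ?thesis using assms unfolding C12_def by auto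
qed

lemma cont3_bounded:
  assumes c: "cont3 T g" and S: "compact S" "S \<subseteq> T"
  shows "\<exists>C\<ge>0. \<forall>s\<in>S. \<forall>x y. \<bar>x\<bar> \<le> b \<longrightarrow> \<bar>y\<bar> \<le> b \<longrightarrow> \<bar>g s x y\<bar> \<le> C"
proof -
  have "S \<times> cbox (- b, - b) (b, b) \<subseteq> T \<times> UNIV" using S by auto
  hence "compact ((\<lambda>(t, x, y). g t x y) ` (S \<times> cbox (- b, - b) (b, b)))"
    by (intro compact_continuous_image compact_Times S compact_cbox continuous_on_subset[OF c])
  then obtain C where C: "\<And>z. z \<in> (\<lambda>(t, x, y). g t x y) ` (S \<times> cbox (- b, - b) (b, b)) \<Longrightarrow> norm z \<le> C"
    using compact_imp_bounded bounded_iff by metis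
  show ?thesis
  proof (intro exI[of _ "max C 0"] conjI ballI allI impI)
    fix s x y assume "s \<in> S" "\<bar>x\<bar> \<le> b" "\<bar>y\<bar> \<le> b"
    hence "g s x y \<in> (\<lambda>(t, x, y). g t x y) ` (S \<times> cbox (- b, - b) (b, b))"
      by (intro image_eqI[of _ _ "(s, x, y)"]) (auto simp: abs_le_iff)
    from C[OF this] show "\<bar>g s x y\<bar> \<le> max C 0" by simp
  qed simp
qed

text \<open>
  Formally this is integration by parts in \<open>2 \<integral> \<nabla>h \<cdot> \<nabla>h\<^sub>t\<close>, but \<open>\<nabla>h\<^sub>t\<close> need not exist. The difference of
  the energies at two times is \<open>- \<integral> (h(s) - h(t)) (\<Delta>h(s) + \<Delta>h(t))\<close> exactly, and dividing by \<open>s - t\<close> only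
  differentiates \<open>h\<close> itself. In the proof \<open>J1\<close> carries the derivative and \<open>J2\<close> is \<open>o(s - t)\<close>.
\<close>
lemma dirichlet_energy_derivative:
  assumes h: "C12 T h ht hx hy hxx hxy hyy" and T: "open T" "t \<in> T" and b: "b \<ge> 0"
    and bdx: "\<And>s y. s \<in> T \<Longrightarrow> h s b y = 0" "\<And>s y. s \<in> T \<Longrightarrow> h s (- b) y = 0"
    and bdy: "\<And>s x. s \<in> T \<Longrightarrow> h s x b = 0" "\<And>s x. s \<in> T \<Longrightarrow> h s x (- b) = 0"
  shows "((\<lambda>s. sqint b (\<lambda>x y. (hx s x y)\<^sup>2 + (hy s x y)\<^sup>2)) has_real_derivative
     - 2 * sqint b (\<lambda>x y. ht t x y * (hxx t x y + hyy t x y))) (at t)"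
proof -
  note c = C12_cont[OF h]
  define L where "L = (\<lambda>s x y. hxx s x y + hyy s x y)"
  have cL: "cont3 T L" unfolding L_def by (intro cont3_lin c)
  define G where "G = (\<lambda>s. sqint b (\<lambda>x y. (hx s x y)\<^sup>2 + (hy s x y)\<^sup>2))"
  define J1 where "J1 = (\<lambda>s. sqint b (\<lambda>x y. h s x y * (2 * L t x y)))"
  define J2 where "J2 = (\<lambda>s. sqint b (\<lambda>x y. (h s x y - h t x y) * (L s x y - L t x y)))"
  have eq: "G s = G t - (J1 s - J1 t) - J2 s" if s: "s \<in> T" for s
  proof -
    note cs = cont3_cont2[OF c(1) s] cont3_cont2[OF c(3) s] cont3_cont2[OF c(4) s]
       cont3_cont2[OF c(5) s] cont3_cont2[OF c(7) s] cont3_cont2[OF cL s]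
    note ct = cont3_cont2[OF c(1) T(2)] cont3_cont2[OF c(3) T(2)] cont3_cont2[OF c(4) T(2)]
       cont3_cont2[OF c(5) T(2)] cont3_cont2[OF c(7) T(2)] cont3_cont2[OF cL T(2)]
    note ds = C12_deriv[OF h s] C12_deriv[OF h T(2)]
    define P where "P = (\<lambda>x y. (hx s x y - hx t x y) * (hx s x y + hx t x y) +
        (h s x y - h t x y) * (hxx s x y + hxx t x y))"
    define R where "R = (\<lambda>x y. (hy s x y - hy t x y) * (hy s x y + hy t x y) +
        (h s x y - h t x y) * (hyy s x y + hyy t x y))"
    have "sqint b P = 0"
    proof (rule sqint_dx[OF _ b])
      show "cont2 P" unfolding P_def by (intro cont2_lin cs ct)
      show "((\<lambda>z. (h s z y - h t z y) * (hx s z y + hx t z y)) has_real_derivative P x y) (at x)" for x y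
        unfolding P_def by (rule derivative_eq_intros ds refl)+ simp
    qed (use bdx s T in simp)
    moreover have "sqint b R = 0"
    proof (rule sqint_dy[OF _ b])
      show "cont2 R" unfolding R_def by (intro cont2_lin cs ct)
      show "((\<lambda>z. (h s x z - h t x z) * (hy s x z + hy t x z)) has_real_derivative R x y) (at y)" for x y
        unfolding R_def by (rule derivative_eq_intros ds refl)+ simp
    qed (use bdy s T in simp)
    moreover have "sqint b (\<lambda>x y. P x y + R x y) = sqint b P + sqint b R"
      by (rule sqint_add) (simp_all only: P_def R_def, (intro cont2_lin cs ct)+)
    moreover have "(\<lambda>x y. P x y + R x y) =
       (\<lambda>x y. ((((hx s x y)\<^sup>2 + (hy s x y)\<^sup>2) - ((hx t x y)\<^sup>2 + (hy t x y)\<^sup>2)) +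
          (h s x y * (2 * L t x y) - h t x y * (2 * L t x y))) +
          (h s x y - h t x y) * (L s x y - L t x y))"
      by (intro ext) (simp add: P_def R_def L_def algebra_simps power2_eq_square)
    moreover have "sqint b \<dots> = G s - G t + (J1 s - J1 t) + J2 s"
      unfolding G_def J1_def J2_def
      by (simp add: sqint_add sqint_diff cont2_lin cs ct)
    ultimately show ?thesis by simp
  qed
  have dJ1: "(J1 has_real_derivative sqint b (\<lambda>x y. ht t x y * (2 * L t x y))) (at t)"
    unfolding J1_def
  proof (rule sqint_derivative[OF T, where ut="\<lambda>s x y. ht s x y * (2 * L t x y)"])
    have cLt: "cont3 T (\<lambda>s x y. 2 * L t x y)"
    proof -
      have "continuous_on (T \<times> UNIV) (snd :: real \<times> real \<times> real \<Rightarrow> _)" by (intro continuous_intros)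
      from continuous_on_compose2[OF cont3_cont2[OF cL T(2)] this]
      show ?thesis by (auto simp: case_prod_beta intro!: continuous_intros)
    qed
    show "cont3 T (\<lambda>s x y. h s x y * (2 * L t x y))" "cont3 T (\<lambda>s x y. ht s x y * (2 * L t x y))"
      by (intro cont3_bin(3) cLt c)+
  qed (auto intro!: derivative_eq_intros C12_deriv[OF h])
  have dJ2: "(J2 has_real_derivative 0) (at t)"
  proof -
    obtain e where e: "e > 0" "cball t e \<subseteq> T" using T open_contains_cball by blast
    obtain C where C: "\<And>s x y. s \<in> cball t e \<Longrightarrow> \<bar>x\<bar> \<le> b \<Longrightarrow> \<bar>y\<bar> \<le> b \<Longrightarrow> \<bar>ht s x y\<bar> \<le> C"
      using cont3_bounded[OF c(2) compact_cball e(2), of b] by blast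
    define W where "W = (\<lambda>s. sqint b (\<lambda>x y. \<bar>L s x y - L t x y\<bar>))"
    have cW: "cont3 T (\<lambda>s x y. \<bar>L s x y - L t x y\<bar>)"
    proof -
      have "continuous_on (T \<times> UNIV) (snd :: real \<times> real \<times> real \<Rightarrow> _)" by (intro continuous_intros)
      from continuous_on_compose2[OF cont3_cont2[OF cL T(2)] this] cL
      show ?thesis by (auto simp: case_prod_beta intro!: continuous_intros)
    qed
    have W0: "(W \<longlongrightarrow> 0) (at t)"
    proof -
      have "continuous_on T W" unfolding W_def by (rule sqint_continuous[OF cW])
      hence "isCont W t" using T by (simp add: continuous_on_eq_continuous_at)
      moreover have "W t = 0" by (simp add: W_def sqint_const b)
      ultimately show ?thesis by (simp add: isCont_def)
    qed
    have bound: "\<bar>J2 s\<bar> \<le> \<bar>s - t\<bar> * (C * W s)" if s: "s \<in> cball t e" for s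
    proof -
      have sT: "s \<in> T" using s e by auto
      have "\<bar>J2 s\<bar> \<le> sqint b (\<lambda>x y. (\<bar>s - t\<bar> * C) * \<bar>L s x y - L t x y\<bar>)"
        unfolding J2_def
      proof (rule sqint_abs_le)
        show "cont2 (\<lambda>x y. (h s x y - h t x y) * (L s x y - L t x y))"
          by (intro cont2_lin cont3_cont2[OF c(1)] cont3_cont2[OF cL] T sT)
        show "cont2 (\<lambda>x y. (\<bar>s - t\<bar> * C) * \<bar>L s x y - L t x y\<bar>)"
          by (rule cont2_un(3)) (rule cont3_cont2[OF cW sT] | rule cont3_cont2[OF c(1) sT])+
        fix x y assume xy: "\<bar>x\<bar> \<le> b" "\<bar>y\<bar> \<le> b"
        have "norm (h s x y - h t x y) \<le> C * norm (s - t)"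
        proof (rule field_differentiable_bound[where S="cball t e" and f'="\<lambda>s. ht s x y"])
          fix z assume z: "z \<in> cball t e"
          show "((\<lambda>s. h s x y) has_field_derivative ht z x y) (at z within cball t e)"
            using has_field_derivative_at_within[OF C12_deriv(1)[OF h, of z x y]] z e by auto
          show "norm (ht z x y) \<le> C" using C[OF z xy] by simp
        qed (use s e in auto)
        thus "\<bar>(h s x y - h t x y) * (L s x y - L t x y)\<bar> \<le> (\<bar>s - t\<bar> * C) * \<bar>L s x y - L t x y\<bar>"
          using mult_right_mono[of "\<bar>h s x y - h t x y\<bar>" "\<bar>s - t\<bar> * C" "\<bar>L s x y - L t x y\<bar>"]
          by (simp add: abs_mult mult.commute)
      qed
      thus ?thesis by (simp add: sqint_cmult W_def)
    qed
    have J2t: "J2 t = 0" by (simp add: J2_def sqint_const b)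
    show ?thesis
      unfolding has_field_derivative_iff
    proof (rule Lim_null_comparison)
      show "((\<lambda>s. C * W s) \<longlongrightarrow> 0) (at t)" using tendsto_mult_left[OF W0, of C] by simp
      have "\<forall>\<^sub>F s in at t. s \<in> ball t e"
        using e by (intro eventually_at_in_open') auto
      thus "\<forall>\<^sub>F s in at t. norm ((J2 s - J2 t) / (s - t)) \<le> C * W s"
        using eventually_neq_at_within[of t t UNIV]
      proof eventually_elim
        case (elim s)
        hence "\<bar>J2 s\<bar> \<le> \<bar>s - t\<bar> * (C * W s)" using bound[of s] by auto
        thus ?case using elim(2) by (simp add: J2t field_simps abs_divide)
      qed
    qed
  qed
  have "((\<lambda>s. G t - (J1 s - J1 t) - J2 s) has_real_derivative
      - sqint b (\<lambda>x y. ht t x y * (2 * L t x y))) (at t)"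
    by (auto intro!: derivative_eq_intros dJ1 dJ2)
  hence "(G has_real_derivative - sqint b (\<lambda>x y. ht t x y * (2 * L t x y))) (at t)"
    by (rule has_field_derivative_transform_within_open[OF _ T]) (use eq in auto)
  moreover have "(\<lambda>x y. ht t x y * (2 * L t x y)) = (\<lambda>x y. 2 * (ht t x y * (hxx t x y + hyy t x y)))"
    by (simp add: L_def algebra_simps)
  ultimately show ?thesis unfolding G_def by (simp add: sqint_cmult)
qed

section \<open>A Carleman inequality\<close>

lemma cont3_time: "continuous_on T g \<Longrightarrow> cont3 T (\<lambda>t x y. g t)"
  unfolding case_prod_unfold
  by (rule continuous_on_compose2[of T g _ fst]) (auto intro!: continuous_intros)

lemma cont3_space: "cont2 g \<Longrightarrow> cont3 T (\<lambda>t x y. g x y)"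
  unfolding case_prod_unfold
  by (rule continuous_on_compose2[of UNIV "\<lambda>p. g (fst p) (snd p)" _ snd]) (auto intro!: continuous_intros)

lemma cont2_x: "continuous_on UNIV g \<Longrightarrow> cont2 (\<lambda>x y. g x)"
  unfolding case_prod_unfold
  by (rule continuous_on_compose2[of UNIV g _ fst]) (auto intro!: continuous_intros)

text \<open>
  Conjugating \<open>\<partial>\<^sub>t - \<Delta> - drift \<partial>\<^sub>y\<close> with the weight \<open>exp (th \<psi>)\<close> gives \<open>S + A\<close>, where \<open>S\<close> is symmetric and
  \<open>A\<close> antisymmetric in space-time. The product \<open>S A\<close> is a sum of exact derivatives and of the positive
  terms of the commutator; \<open>X\<close> and \<open>Y\<close> collect the derivatives in \<open>x\<close> and \<open>y\<close>. The weight depends on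
  \<open>x\<close> but not on \<open>y\<close>, so convexity in one variable is all that is used, and the drift in
  the \<open>y\<close>-direction contributes derivatives only.
\<close>
lemma carleman_identity:
  fixes th th1 th2 :: "real \<Rightarrow> real" and r C0 drift :: real
  assumes h: "C12 T h ht hx hy hxx hxy hyy" and T: "open T" "t \<in> T" and b: "b \<ge> 0"
    and bd: "\<And>s x y. s \<in> T \<Longrightarrow> \<not> (\<bar>x\<bar> < b \<and> \<bar>y\<bar> < b) \<Longrightarrow> h s x y = 0 \<and> hx s x y = 0 \<and> hy s x y = 0"
    and th: "\<And>s. s \<in> T \<Longrightarrow> (th has_real_derivative th1 s) (at s)"
      "\<And>s. s \<in> T \<Longrightarrow> (th1 has_real_derivative th2 s) (at s)" "continuous_on T th2"
  defines "\<psi> \<equiv> \<lambda>x. (x + r)\<^sup>2 / 2 - C0"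
  defines "q \<equiv> \<lambda>s x. (th s)\<^sup>2 * (x + r)\<^sup>2 + th1 s * \<psi> x"
  defines "S \<equiv> \<lambda>x y. - (hxx t x y + hyy t x y) - q t x * h t x y"
    and "A \<equiv> \<lambda>x y. ht t x y + 2 * (th t * (x + r)) * hx t x y + th t * h t x y
      - drift * hy t x y"
  shows "((\<lambda>s. sqint b (\<lambda>x y. (hx s x y)\<^sup>2 + (hy s x y)\<^sup>2 - q s x * (h s x y)\<^sup>2) / 2)
     has_real_derivative sqint b (\<lambda>x y. S x y * A x y)
       - sqint b (\<lambda>x y. 2 * th t * (hx t x y)\<^sup>2 +
           (2 * th t ^ 3 * (x + r)\<^sup>2 + 2 * th t * th1 t * (x + r)\<^sup>2 + th2 t * \<psi> x / 2) * (h t x y)\<^sup>2)) (at t)"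
proof -
  have cth: "continuous_on T th" "continuous_on T th1"
    using th by (auto intro!: continuous_at_imp_continuous_on DERIV_isCont)
  have cr: "cont2 (\<lambda>x y. x + r)" by (intro cont2_x continuous_intros)
  have c\<psi>: "cont2 (\<lambda>x y. \<psi> x)" unfolding \<psi>_def by (intro cont2_x continuous_intros) auto
  note c = C12_cont[OF h] cont3_time[OF cth(1)] cont3_time[OF cth(2)] cont3_time[OF th(3)]
    cont3_space[OF cr] cont3_space[OF c\<psi>]
  define qt where "qt = (\<lambda>s x. 2 * (th s * th1 s) * (x + r)\<^sup>2 + th2 s * \<psi> x)"
  have cq: "cont3 T (\<lambda>s x y. q s x)" "cont3 T (\<lambda>s x y. qt s x)"
    unfolding q_def qt_def by (intro cont3_lin c)+
  note c = c cq
  have dq: "((\<lambda>s. q s x) has_real_derivative qt s x) (at s)" if "s \<in> T" for s x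
    unfolding q_def qt_def by (rule derivative_eq_intros th that refl | simp)+
  define P where "P = (\<lambda>s. sqint b (\<lambda>x y. q s x * (h s x y)\<^sup>2))"
  have dP: "(P has_real_derivative
      sqint b (\<lambda>x y. qt t x * (h t x y)\<^sup>2 + 2 * (q t x * (h t x y * ht t x y)))) (at t)"
    unfolding P_def
  proof (rule sqint_derivative[OF T,
        where ut="\<lambda>s x y. qt s x * (h s x y)\<^sup>2 + 2 * (q s x * (h s x y * ht s x y))"])
    show "((\<lambda>s. q s x * (h s x y)\<^sup>2) has_real_derivative
       qt s x * (h s x y)\<^sup>2 + 2 * (q s x * (h s x y * ht s x y))) (at s)" if "s \<in> T" for s x y
      by (rule derivative_eq_intros dq[OF that] C12_deriv(1)[OF h that] refl | simp)+
  qed (intro cont3_lin c)+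
  define G where "G = (\<lambda>s. sqint b (\<lambda>x y. (hx s x y)\<^sup>2 + (hy s x y)\<^sup>2))"
  have dG: "(G has_real_derivative - 2 * sqint b (\<lambda>x y. ht t x y * (hxx t x y + hyy t x y))) (at t)"
    unfolding G_def by (rule dirichlet_energy_derivative[OF h T b]; rule bd[THEN conjunct1]; use b in auto)
  note c2 = c[THEN cont3_cont2, OF T(2)]
  note dh = C12_deriv[OF h T(2)]
  have Deq: "sqint b (\<lambda>x y. (hx s x y)\<^sup>2 + (hy s x y)\<^sup>2 - q s x * (h s x y)\<^sup>2) / 2 = G s / 2 - P s / 2"
    if "s \<in> T" for s
  proof -
    note c2 = c[THEN cont3_cont2, OF that]
    have "sqint b (\<lambda>x y. (hx s x y)\<^sup>2 + (hy s x y)\<^sup>2 - q s x * (h s x y)\<^sup>2) = G s - P s"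
      unfolding G_def P_def by (rule sqint_diff) (intro cont2_lin c2)+
    thus ?thesis by (simp add: diff_divide_distrib)
  qed
  define a where "a = (\<lambda>x. th t * (x + r))"
  define X where "X = (\<lambda>x y. (- (th t * (hx t x y)\<^sup>2) - 2 * (a x * (hx t x y * hxx t x y)))
      - th t * ((hx t x y)\<^sup>2 + h t x y * hxx t x y)
      + (th t * (hy t x y)\<^sup>2 + 2 * (a x * (hy t x y * hxy t x y)))
      - ((2 * (th t)\<^sup>2 * (x + r) + th1 t * (x + r)) * (a x * (h t x y)\<^sup>2)
         + q t x * (th t * (h t x y)\<^sup>2) + 2 * (q t x * (a x * (h t x y * hx t x y))))
      + drift * (hx t x y * hxy t x y + hy t x y * hxx t x y))"
  define Y where "Y = (\<lambda>x y. - 2 * (a x * (hxy t x y * hy t x y + hx t x y * hyy t x y))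
      - th t * ((hy t x y)\<^sup>2 + h t x y * hyy t x y)
      + drift * ((hy t x y * hyy t x y - hx t x y * hxy t x y) + q t x * (h t x y * hy t x y)))"
  have ca: "cont2 (\<lambda>x y. a x)" unfolding a_def by (intro cont2_lin cr)
  have cX: "cont2 X" unfolding X_def by (intro cont2_lin c2 ca cr)
  have cY: "cont2 Y" unfolding Y_def by (intro cont2_lin c2 ca cr)
  have dqx: "((\<lambda>x. q t x) has_real_derivative 2 * (th t)\<^sup>2 * (x + r) + th1 t * (x + r)) (at x)" for x
    unfolding q_def \<psi>_def by (rule derivative_eq_intros refl | simp)+ (simp add: field_simps)
  have dax: "(a has_real_derivative th t) (at x)" for x
    unfolding a_def by (rule derivative_eq_intros refl | simp)+
  have z: "h t x y = 0 \<and> hx t x y = 0 \<and> hy t x y = 0"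
    if "x = b \<or> x = - b \<or> y = b \<or> y = - b" for x y
    by (rule bd[OF T(2)]) (use that b in auto)
  have X0: "sqint b X = 0"
  proof (rule sqint_dx[OF cX b])
    show "((\<lambda>x. - (a x * (hx t x y)\<^sup>2) - th t * (h t x y * hx t x y) + a x * (hy t x y)\<^sup>2
        - q t x * (a x * (h t x y)\<^sup>2) + drift * (hx t x y * hy t x y)) has_real_derivative X x y) (at x)" for x y
      unfolding X_def
      by (rule derivative_eq_intros dqx dax dh refl)+ (simp add: algebra_simps power2_eq_square)
  qed (simp add: z)
  have Y0: "sqint b Y = 0"
  proof (rule sqint_dy[OF cY b])
    show "((\<lambda>y. - 2 * (a x * (hx t x y * hy t x y)) - th t * (h t x y * hy t x y)
        + drift * (1 / 2 * ((hy t x y)\<^sup>2 - (hx t x y)\<^sup>2) + q t x * (1 / 2 * (h t x y)\<^sup>2)))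
        has_real_derivative Y x y) (at y)" for x y
      unfolding Y_def
      by (rule derivative_eq_intros dh refl)+ (simp add: algebra_simps power2_eq_square)
  qed (simp add: z)
  define Z where "Z = (\<lambda>x y. 2 * th t * (hx t x y)\<^sup>2 +
           (2 * th t ^ 3 * (x + r)\<^sup>2 + 2 * th t * th1 t * (x + r)\<^sup>2 + th2 t * \<psi> x / 2) * (h t x y)\<^sup>2)"
  define B1 where "B1 = (\<lambda>x y. ht t x y * (hxx t x y + hyy t x y))"
  define B2 where "B2 = (\<lambda>x y. qt t x * (h t x y)\<^sup>2 + 2 * (q t x * (h t x y * ht t x y)))"
  have cB: "cont2 B1" "cont2 B2" unfolding B1_def B2_def by (intro cont2_lin c2)+
  have cc: "cont2 (\<lambda>x y. k)" for k by (intro cont2_x continuous_intros)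
  have cZ: "cont2 Z"
    unfolding Z_def power3_eq_cube divide_inverse
    by (intro cont2_lin c2 cr cc)
  have pt: "(\<lambda>x y. S x y * A x y) = (\<lambda>x y. ((X x y + Y x y) + Z x y) - (B1 x y + 1 / 2 * B2 x y))"
  proof (intro ext)
    fix x y
    show "S x y * A x y = ((X x y + Y x y) + Z x y) - (B1 x y + 1 / 2 * B2 x y)"
      unfolding S_def A_def X_def Y_def Z_def B1_def B2_def a_def qt_def
      by (simp add: algebra_simps power2_eq_square power3_eq_cube q_def)
  qed
  have "sqint b (\<lambda>x y. S x y * A x y)
      = ((sqint b X + sqint b Y) + sqint b Z) - (sqint b B1 + 1 / 2 * sqint b B2)"
    unfolding pt
    by (simp only: sqint_add sqint_diff sqint_cmult cont2_lin cX cY cZ cB)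
  hence eq: "sqint b (\<lambda>x y. S x y * A x y) - sqint b Z = - 2 * sqint b B1 / 2 - sqint b B2 / 2"
    by (simp add: X0 Y0)
  have "((\<lambda>s. G s / 2 - P s / 2) has_real_derivative - 2 * sqint b B1 / 2 - sqint b B2 / 2) (at t)"
    unfolding B1_def B2_def by (intro DERIV_diff DERIV_cdivide dG dP)
  hence "((\<lambda>s. sqint b (\<lambda>x y. (hx s x y)\<^sup>2 + (hy s x y)\<^sup>2 - q s x * (h s x y)\<^sup>2) / 2)
      has_real_derivative - 2 * sqint b B1 / 2 - sqint b B2 / 2) (at t)"
    by (rule has_field_derivative_transform_within_open[OF _ T]) (use Deq in auto)
  thus ?thesis unfolding eq[symmetric] Z_def .
qed

text \<open>
  Here \<open>h = E v\<close> with \<open>E\<close> the weight, \<open>S + A\<close> is \<open>E\<close> times the operator applied to \<open>v\<close>, and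
  \<open>4 S A \<le> (S + A)\<^sup>2\<close>. The inequality is stated at a fixed time, as a differential inequality for the
  boundary term of the time integration.
\<close>
lemma carleman_inequality:
  fixes th th1 th2 :: "real \<Rightarrow> real" and r C0 drift :: real
  assumes v: "C12 T v vt vx vy vxx vxy vyy" and T: "open T" "t \<in> T" and b: "b \<ge> 0"
    and bd: "\<And>s x y. s \<in> T \<Longrightarrow> \<not> (\<bar>x\<bar> < b \<and> \<bar>y\<bar> < b) \<Longrightarrow> v s x y = 0 \<and> vx s x y = 0 \<and> vy s x y = 0"
    and th: "\<And>s. s \<in> T \<Longrightarrow> (th has_real_derivative th1 s) (at s)"
      "\<And>s. s \<in> T \<Longrightarrow> (th1 has_real_derivative th2 s) (at s)" "continuous_on T th2"
    and pos: "th t \<ge> 0"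
  defines "\<psi> \<equiv> \<lambda>x. (x + r)\<^sup>2 / 2 - C0"
  defines "q \<equiv> \<lambda>s x. (th s)\<^sup>2 * (x + r)\<^sup>2 + th1 s * \<psi> x"
  defines "E \<equiv> \<lambda>s x. exp (th s * \<psi> x)"
  shows "\<exists>D'. ((\<lambda>s. sqint b (\<lambda>x y. (E s x)\<^sup>2 * ((th s * (x + r) * v s x y + vx s x y)\<^sup>2
            + (vy s x y)\<^sup>2 - q s x * (v s x y)\<^sup>2)) / 2) has_real_derivative D') (at t) \<and>
     D' + sqint b (\<lambda>x y. (2 * th t ^ 3 * (x + r)\<^sup>2 + 2 * th t * th1 t * (x + r)\<^sup>2 + th2 t * \<psi> x / 2)
              * ((E t x)\<^sup>2 * (v t x y)\<^sup>2))
       \<le> sqint b (\<lambda>x y. (E t x)\<^sup>2 * (vt t x y - (vxx t x y + vyy t x y) - drift * vy t x y)\<^sup>2) / 4"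
proof -
  have cth: "continuous_on T th" "continuous_on T th1"
    using th by (auto intro!: continuous_at_imp_continuous_on DERIV_isCont)
  have cr: "cont2 (\<lambda>x y. x + r)" by (intro cont2_x continuous_intros)
  have c\<psi>: "cont2 (\<lambda>x y. \<psi> x)" unfolding \<psi>_def by (intro cont2_x continuous_intros) auto
  have cc: "cont3 T (\<lambda>s x y. k)" for k by (intro cont3_time continuous_intros)
  note c = C12_cont[OF v] cont3_time[OF cth(1)] cont3_time[OF cth(2)] cont3_time[OF th(3)]
    cont3_space[OF cr] cont3_space[OF c\<psi>] cc
  have cE: "cont3 T (\<lambda>s x y. E s x)"
    unfolding E_def using cont3_bin(3)[OF c(8) c(12)]
    by (auto simp: case_prod_unfold intro: continuous_on_exp)
  have dth: "(th has_real_derivative th1 s) (at s)" if "s \<in> T" for s using th that by simp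
  have dE: "C12 T (\<lambda>s x y. E s x) (\<lambda>s x y. th1 s * \<psi> x * E s x) (\<lambda>s x y. th s * (x + r) * E s x)
     (\<lambda>s x y. 0) (\<lambda>s x y. (th s + (th s * (x + r))\<^sup>2) * E s x) (\<lambda>s x y. 0) (\<lambda>s x y. 0)"
    unfolding C12_def
  proof (intro conjI ballI allI)
    fix s x y assume s: "s \<in> T"
    show "((\<lambda>s. E s x) has_real_derivative th1 s * \<psi> x * E s x) (at s)"
      unfolding E_def by (rule derivative_eq_intros dth[OF s] refl | simp)+
    show *: "((\<lambda>x. E s x) has_real_derivative th s * (x + r) * E s x) (at x)"
      unfolding E_def \<psi>_def by (rule derivative_eq_intros refl | simp)+
    show "((\<lambda>x. th s * (x + r) * E s x) has_real_derivative
        (th s + (th s * (x + r))\<^sup>2) * E s x) (at x)"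
      by (rule derivative_eq_intros * refl)+ (simp add: algebra_simps power2_eq_square)
  qed (auto intro!: cont3_lin c cE)
  note h = C12_mult[OF dE v]
  note c = c cE
  note c2 = c[THEN cont3_cont2, OF T(2)]
  have id: "(\<lambda>s. sqint b (\<lambda>x y. (E s x)\<^sup>2 * ((th s * (x + r) * v s x y + vx s x y)\<^sup>2
            + (vy s x y)\<^sup>2 - q s x * (v s x y)\<^sup>2)) / 2) = 
    (\<lambda>s. sqint b (\<lambda>x y. (th s * (x + r) * E s x * v s x y + E s x * vx s x y)\<^sup>2 +
       (0 * v s x y + E s x * vy s x y)\<^sup>2 - q s x * (E s x * v s x y)\<^sup>2) / 2)"
    by (intro ext arg_cong2[where f=divide] arg_cong2[where f=sqint] refl)
       (simp add: algebra_simps power2_eq_square)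
  define S where "S = (\<lambda>x y. - (((th t + (th t * (x + r))\<^sup>2) * E t x * v t x y
        + 2 * (th t * (x + r) * E t x * vx t x y) + E t x * vxx t x y)
      + (0 * v t x y + 2 * (0 * vy t x y) + E t x * vyy t x y)) - q t x * (E t x * v t x y))"
  define A where "A = (\<lambda>x y. (th1 t * \<psi> x * E t x * v t x y + E t x * vt t x y)
     + 2 * (th t * (x + r)) * (th t * (x + r) * E t x * v t x y + E t x * vx t x y)
     + th t * (E t x * v t x y) - drift * (0 * v t x y + E t x * vy t x y))"
  define Z where "Z = (\<lambda>x y. 2 * th t * (th t * (x + r) * E t x * v t x y + E t x * vx t x y)\<^sup>2 +
       (2 * th t ^ 3 * (x + r)\<^sup>2 + 2 * th t * th1 t * (x + r)\<^sup>2 + th2 t * \<psi> x / 2)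
        * (E t x * v t x y)\<^sup>2)"
  define W where "W = (\<lambda>x y. (2 * th t ^ 3 * (x + r)\<^sup>2 + 2 * th t * th1 t * (x + r)\<^sup>2 + th2 t * \<psi> x / 2)
              * ((E t x)\<^sup>2 * (v t x y)\<^sup>2))"
  define R where "R = (\<lambda>x y. (E t x)\<^sup>2 * (vt t x y - (vxx t x y + vyy t x y) - drift * vy t x y)\<^sup>2)"
  have D: "((\<lambda>s. sqint b (\<lambda>x y. (E s x)\<^sup>2 * ((th s * (x + r) * v s x y + vx s x y)\<^sup>2
            + (vy s x y)\<^sup>2 - q s x * (v s x y)\<^sup>2)) / 2) has_real_derivative
     sqint b (\<lambda>x y. S x y * A x y) - sqint b Z) (at t)"
    unfolding id
    unfolding S_def A_def Z_def q_def \<psi>_def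
    by (rule carleman_identity[OF h[unfolded \<psi>_def] T b _ th]) (use bd in auto)
  have cS: "cont2 S" unfolding S_def q_def by (intro cont2_lin c2)
  have cA: "cont2 A" unfolding A_def by (intro cont2_lin c2)
  have cZ: "cont2 Z" unfolding Z_def power3_eq_cube divide_inverse by (intro cont2_lin c2)
  have cW: "cont2 W" unfolding W_def power3_eq_cube divide_inverse by (intro cont2_lin c2)
  have cR: "cont2 R" unfolding R_def by (intro cont2_lin c2)
  have "sqint b W \<le> sqint b Z"
    by (rule sqint_mono[OF cW cZ]) (use pos in \<open>simp add: W_def Z_def power_mult_distrib\<close>)
  moreover have "sqint b (\<lambda>x y. S x y * A x y) \<le> sqint b (\<lambda>x y. 1 / 4 * R x y)"
  proof (rule sqint_mono)
    fix x y
    have "S x y + A x y = E t x * (vt t x y - (vxx t x y + vyy t x y) - drift * vy t x y)"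
      by (simp add: S_def A_def q_def algebra_simps power2_eq_square)
    hence "(S x y + A x y)\<^sup>2 = R x y" by (simp add: R_def power_mult_distrib)
    moreover have "4 * (S x y * A x y) \<le> (S x y + A x y)\<^sup>2"
      using zero_le_power2[of "S x y - A x y"] by (simp add: power2_eq_square algebra_simps)
    ultimately show "S x y * A x y \<le> 1 / 4 * R x y" by simp
  qed (intro cont2_lin cS cA cR)+
  ultimately have "sqint b (\<lambda>x y. S x y * A x y) - sqint b Z + sqint b W \<le> sqint b R / 4"
    using sqint_cmult[of b "1 / 4" R] by linarith
  thus ?thesis using D unfolding W_def R_def by blast
qed

section \<open>Smooth cut-off functions\<close>

text \<open>
  Smooth functions on the half-line whose first derivative vanishes at 0 extend by a constant;
  iterating this on powers and rational functions yields the smooth step and the convex function below.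
\<close>
lemma pos_part_comp_deriv:
  fixes G G1 :: "real \<Rightarrow> real"
  assumes G: "\<And>p. p \<ge> 0 \<Longrightarrow> (G has_real_derivative G1 p) (at p)" and z: "G1 0 = 0"
  shows "((\<lambda>s. G (max 0 s)) has_real_derivative G1 (max 0 s)) (at s)"
proof (cases s "0 :: real" rule: linorder_cases)
  case less
  have "((\<lambda>s. G 0) has_real_derivative 0) (at s)" by simp
  hence "((\<lambda>s. G (max 0 s)) has_real_derivative 0) (at s)"
    by (rule has_field_derivative_transform_within_open[of _ _ _ "{..<0}"]) (use less in auto)
  thus ?thesis using less z by simp
next
  case greater
  have "((\<lambda>s. G (max 0 s)) has_real_derivative G1 s) (at s)"
    by (rule has_field_derivative_transform_within_open[OF G, of _ "{0<..}"]) (use greater in auto)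
  thus ?thesis using greater by simp
next
  case equal
  have "((\<lambda>y. (G (max 0 y) - G (max 0 0)) / (y - 0)) \<longlongrightarrow> 0) (at 0)"
  proof (rule Lim_null_comparison)
    have "((\<lambda>y. (G y - G 0) / (y - 0)) \<longlongrightarrow> 0) (at 0)"
      using G[of 0] z by (simp add: has_field_derivative_iff)
    thus "((\<lambda>y. \<bar>(G y - G 0) / (y - 0)\<bar>) \<longlongrightarrow> 0) (at 0)"
      by (rule tendsto_rabs_zero)
    show "\<forall>\<^sub>F y in at 0. norm ((G (max 0 y) - G (max 0 0)) / (y - 0)) \<le> \<bar>(G y - G 0) / (y - 0)\<bar>"
    proof (rule always_eventually, rule allI)
      fix y :: real
      show "norm ((G (max 0 y) - G (max 0 0)) / (y - 0)) \<le> \<bar>(G y - G 0) / (y - 0)\<bar>"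
      proof (cases "y \<ge> 0")
        case False
        hence "max 0 y = 0" by simp
        thus ?thesis
          using abs_ge_zero[of "(G y - G 0) / (y - 0)"] by (simp only: max.idem diff_self div_0 norm_zero)
      qed simp
    qed
  qed
  thus ?thesis using equal z by (simp add: has_field_derivative_iff)
qed

text \<open>
  The step is the antiderivative of \<open>s\<^sup>3 (1 - s)\<^sup>3\<close> on \<open>[0,1]\<close>. Beyond 1 the polynomial is continued by
  terms in \<open>r = s - 1\<close>, since \<open>p\<^sup>3 (1 - p)\<^sup>3 = - r\<^sup>3 (1 + r)\<^sup>3\<close> for \<open>p = 1 + r\<close>. The bound \<open>k \<le> 1\<close> makes \<open>k\<close>
  itself dominate \<open>k\<^sup>2\<close>, so that a function of class \<open>C\<^sup>2\<close> dominates the squared gradient of a cut-off.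
\<close>
lemma smooth_step_exists:
  obtains g k k1 k2 :: "real \<Rightarrow> real" and c :: real where
    "c > 0"
    "\<And>s. (g has_real_derivative k s) (at s)" "\<And>s. (k has_real_derivative k1 s) (at s)"
    "\<And>s. (k1 has_real_derivative k2 s) (at s)" "continuous_on UNIV k2"
    "\<And>s. s \<le> 0 \<Longrightarrow> g s = 0 \<and> k s = 0 \<and> k1 s = 0 \<and> k2 s = 0"
    "\<And>s. s \<ge> 1 \<Longrightarrow> g s = c \<and> k s = 0 \<and> k1 s = 0 \<and> k2 s = 0"
    "\<And>s. 0 \<le> k s \<and> k s \<le> 1"
proof -
  define p where "p = (\<lambda>s :: real. max 0 s)"
  define r where "r = (\<lambda>s :: real. max 0 (s - 1))"
  define g where "g = (\<lambda>s. p s ^ 4 / 4 - 3 * p s ^ 5 / 5 + p s ^ 6 / 2 - p s ^ 7 / 7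
      + r s ^ 4 / 4 + 3 * r s ^ 5 / 5 + r s ^ 6 / 2 + r s ^ 7 / 7)"
  define k where "k = (\<lambda>s. p s ^ 3 - 3 * p s ^ 4 + 3 * p s ^ 5 - p s ^ 6
      + r s ^ 3 + 3 * r s ^ 4 + 3 * r s ^ 5 + r s ^ 6)"
  define k1 where "k1 = (\<lambda>s. 3 * p s ^ 2 - 12 * p s ^ 3 + 15 * p s ^ 4 - 6 * p s ^ 5
      + 3 * r s ^ 2 + 12 * r s ^ 3 + 15 * r s ^ 4 + 6 * r s ^ 5)"
  define k2 where "k2 = (\<lambda>s. 6 * p s - 36 * p s ^ 2 + 60 * p s ^ 3 - 30 * p s ^ 4
      + 6 * r s + 36 * r s ^ 2 + 60 * r s ^ 3 + 30 * r s ^ 4)"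
  have dp: "((\<lambda>s. p s ^ m) has_real_derivative real m * p s ^ (m - 1)) (at s)" if "m \<ge> 2" for m s
    unfolding p_def
    by (rule pos_part_comp_deriv[where G="\<lambda>z. z ^ m"]) (use that in \<open>auto intro!: derivative_eq_intros\<close>)
  have dr: "((\<lambda>s. r s ^ m) has_real_derivative real m * r s ^ (m - 1)) (at s)" if "m \<ge> 2" for m s
  proof -
    have "((\<lambda>s. s - 1) has_real_derivative 1) (at s)" for s :: real
      by (auto intro!: derivative_eq_intros)
    from DERIV_chain2[OF dp[OF that, of "s - 1"] this] show ?thesis by (simp add: r_def p_def)
  qed
  have d1: "(g has_real_derivative k s) (at s)" for s
    unfolding g_def k_def by (rule derivative_eq_intros dp dr refl | simp)+ (simp add: field_simps)?
  have d2: "(k has_real_derivative k1 s) (at s)" for s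
    unfolding k_def k1_def by (rule derivative_eq_intros dp dr refl | simp)+
  have d3: "(k1 has_real_derivative k2 s) (at s)" for s
    unfolding k1_def k2_def by (rule derivative_eq_intros dp dr refl | simp)+
  have c: "continuous_on UNIV k2"
    unfolding k2_def p_def r_def by (intro continuous_intros)
  have z0: "g s = 0 \<and> k s = 0 \<and> k1 s = 0 \<and> k2 s = 0" if "s \<le> 0" for s
    using that by (simp add: g_def k_def k1_def k2_def p_def r_def)
  have z1: "g s = 1 / 140 \<and> k s = 0 \<and> k1 s = 0 \<and> k2 s = 0" if "s \<ge> 1" for s
  proof -
    have e: "p s = r s + 1" using that by (simp add: p_def r_def)
    show ?thesis unfolding g_def k_def k1_def k2_def e
      by (simp add: field_simps power2_eq_square eval_nat_numeral)
  qed
  have bk: "0 \<le> k s \<and> k s \<le> 1" for s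
  proof (cases "0 \<le> s \<and> s \<le> 1")
    case True
    hence "k s = s ^ 3 * (1 - s) ^ 3"
      by (simp add: k_def p_def r_def algebra_simps eval_nat_numeral)
    moreover have "s ^ 3 * (1 - s) ^ 3 \<le> 1 * 1"
      using True by (intro mult_mono power_le_one) auto
    ultimately show ?thesis using True by simp
  qed (use z0[of s] z1[of s] in auto)
  show thesis by (rule that[of "1 / 140" g k k1 k2]) (use d1 d2 d3 c z0 z1 bk in auto)
qed

lemma radial_C12:
  assumes g: "\<And>s. (g has_real_derivative g1 s) (at s)" and g1: "\<And>s. (g1 has_real_derivative g2 s) (at s)"
    and c: "continuous_on UNIV g2"
  shows "C12 T (\<lambda>t x y. g (A - (x\<^sup>2 + y\<^sup>2))) (\<lambda>t x y. 0)
    (\<lambda>t x y. - 2 * x * g1 (A - (x\<^sup>2 + y\<^sup>2))) (\<lambda>t x y. - 2 * y * g1 (A - (x\<^sup>2 + y\<^sup>2)))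
    (\<lambda>t x y. 4 * x\<^sup>2 * g2 (A - (x\<^sup>2 + y\<^sup>2)) - 2 * g1 (A - (x\<^sup>2 + y\<^sup>2)))
    (\<lambda>t x y. 4 * x * y * g2 (A - (x\<^sup>2 + y\<^sup>2)))
    (\<lambda>t x y. 4 * y\<^sup>2 * g2 (A - (x\<^sup>2 + y\<^sup>2)) - 2 * g1 (A - (x\<^sup>2 + y\<^sup>2)))"
proof -
  have cg: "continuous_on UNIV g" "continuous_on UNIV g1"
    using g g1 by (auto intro!: continuous_at_imp_continuous_on DERIV_isCont)
  have cc: "cont2 (\<lambda>x y. G (A - (x\<^sup>2 + y\<^sup>2)))" if "continuous_on UNIV G" for G
    unfolding case_prod_unfold
    by (rule continuous_on_compose2[OF that]) (auto intro!: continuous_intros)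
  have "cont2 (\<lambda>x y. 4 * x\<^sup>2 * g2 (A - (x\<^sup>2 + y\<^sup>2)) - 2 * g1 (A - (x\<^sup>2 + y\<^sup>2)))"
    "cont2 (\<lambda>x y. 4 * y\<^sup>2 * g2 (A - (x\<^sup>2 + y\<^sup>2)) - 2 * g1 (A - (x\<^sup>2 + y\<^sup>2)))"
    "cont2 (\<lambda>x y. 4 * x * y * g2 (A - (x\<^sup>2 + y\<^sup>2)))"
    "cont2 (\<lambda>x y. - 2 * x * g1 (A - (x\<^sup>2 + y\<^sup>2)))" "cont2 (\<lambda>x y. - 2 * y * g1 (A - (x\<^sup>2 + y\<^sup>2)))"
    using cc[OF cg(1)] cc[OF cg(2)] cc[OF c] unfolding case_prod_unfold
    by (intro continuous_intros; simp)+
  note c3 = this[THEN cont3_space] cc[OF cg(1), THEN cont3_space]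
  have i: "((\<lambda>s. A - (s\<^sup>2 + y\<^sup>2)) has_real_derivative - 2 * x) (at x)"
    "((\<lambda>s. A - (y\<^sup>2 + s\<^sup>2)) has_real_derivative - 2 * x) (at x)" for x y :: real
    by (auto intro!: derivative_eq_intros)
  note ch = DERIV_chain2[OF g i(1)] DERIV_chain2[OF g i(2)] DERIV_chain2[OF g1 i(1)] DERIV_chain2[OF g1 i(2)]
  show ?thesis
    unfolding C12_def
  proof (intro conjI ballI allI)
    fix t x y :: real
    show "((\<lambda>s. g (A - (s\<^sup>2 + y\<^sup>2))) has_real_derivative - 2 * x * g1 (A - (x\<^sup>2 + y\<^sup>2))) (at x)"
      by (rule ch[THEN DERIV_cong]) simp
    show "((\<lambda>s. g (A - (x\<^sup>2 + s\<^sup>2))) has_real_derivative - 2 * y * g1 (A - (x\<^sup>2 + y\<^sup>2))) (at y)"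
      by (rule ch(2)[THEN DERIV_cong]) simp
    show "((\<lambda>s. - 2 * s * g1 (A - (s\<^sup>2 + y\<^sup>2))) has_real_derivative
        4 * x\<^sup>2 * g2 (A - (x\<^sup>2 + y\<^sup>2)) - 2 * g1 (A - (x\<^sup>2 + y\<^sup>2))) (at x)"
      by (rule derivative_eq_intros ch(3) refl | simp)+ (simp add: power2_eq_square)
    show "((\<lambda>s. - 2 * s * g1 (A - (x\<^sup>2 + s\<^sup>2))) has_real_derivative
        4 * y\<^sup>2 * g2 (A - (x\<^sup>2 + y\<^sup>2)) - 2 * g1 (A - (x\<^sup>2 + y\<^sup>2))) (at y)"
      by (rule derivative_eq_intros ch(4) refl | simp)+ (simp add: power2_eq_square)
    show "((\<lambda>s. - 2 * x * g1 (A - (x\<^sup>2 + s\<^sup>2))) has_real_derivative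
        4 * x * y * g2 (A - (x\<^sup>2 + y\<^sup>2))) (at y)"
      by (rule derivative_eq_intros ch(4) refl | simp)+
    show "((\<lambda>s. - 2 * y * g1 (A - (s\<^sup>2 + y\<^sup>2))) has_real_derivative
        4 * x * y * g2 (A - (x\<^sup>2 + y\<^sup>2))) (at x)"
      by (rule derivative_eq_intros ch(3) refl | simp)+
  qed (auto intro!: c3 c3[simplified] cont3_time continuous_intros)
qed

section \<open>Observability of the heat equation with drift and potential\<close>

text \<open>
  With a cut-off \<open>e\<close>, the local energy of \<open>V\<close> pays for \<open>\<integral> e |\<nabla>V|\<^sup>2\<close>. On an annulus where \<open>V\<close> is
  bounded this replaces pointwise gradient estimates.
\<close>
lemma caccioppoli_identity:
  assumes V: "C12 UNIV V Vt Vx Vy Vxx Vxy Vyy" and e: "C12 UNIV e (\<lambda>t x y. 0) ex ey exx exy eyy" and b: "b \<ge> 0"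
    and bd: "\<And>x y. \<not> (\<bar>x\<bar> < b \<and> \<bar>y\<bar> < b) \<Longrightarrow> e t x y = 0 \<and> ex t x y = 0 \<and> ey t x y = 0"
  shows "((\<lambda>t. sqint b (\<lambda>x y. e t x y * (V t x y)\<^sup>2) / 2) has_real_derivative
    sqint b (\<lambda>x y. 1 / 2 * ((exx t x y + eyy t x y) - drift * ey t x y) * (V t x y)\<^sup>2
        + e t x y * V t x y * (Vt t x y - (Vxx t x y + Vyy t x y) - drift * Vy t x y))
    - sqint b (\<lambda>x y. e t x y * ((Vx t x y)\<^sup>2 + (Vy t x y)\<^sup>2))) (at t)"
proof -
  note dV = C12_deriv[OF V UNIV_I] and de = C12_deriv[OF e UNIV_I]
  note c = C12_cont[OF V] C12_cont[OF e]
  note c2 = c[THEN cont3_cont2, OF UNIV_I]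
  have cc: "cont2 (\<lambda>x y. k)" for k by (intro cont2_x continuous_intros)
  define X where "X = (\<lambda>x y. (ex t x y * (V t x y * Vx t x y) + e t x y * ((Vx t x y)\<^sup>2 + V t x y * Vxx t x y))
     - 1 / 2 * (exx t x y * (V t x y)\<^sup>2 + 2 * (ex t x y * (V t x y * Vx t x y))))"
  define Y where "Y = (\<lambda>x y. (ey t x y * (V t x y * Vy t x y) + e t x y * ((Vy t x y)\<^sup>2 + V t x y * Vyy t x y))
     - 1 / 2 * (eyy t x y * (V t x y)\<^sup>2 + 2 * (ey t x y * (V t x y * Vy t x y)))
     + drift / 2 * (ey t x y * (V t x y)\<^sup>2 + 2 * (e t x y * (V t x y * Vy t x y))))"
  have cX: "cont2 X" unfolding X_def by (intro cont2_lin c2)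
  have cY: "cont2 Y" unfolding Y_def by (intro cont2_lin c2)
  have z: "e t x y = 0 \<and> ex t x y = 0 \<and> ey t x y = 0"
    if "x = b \<or> x = - b \<or> y = b \<or> y = - b" for x y
    by (rule bd) (use that b in auto)
  have X0: "sqint b X = 0"
  proof (rule sqint_dx[OF cX b])
    show "((\<lambda>x. e t x y * (V t x y * Vx t x y) - 1 / 2 * (ex t x y * (V t x y)\<^sup>2))
        has_real_derivative X x y) (at x)" for x y
      unfolding X_def by (rule derivative_eq_intros dV de refl)+ (simp add: algebra_simps power2_eq_square)
  qed (simp add: z)
  have Y0: "sqint b Y = 0"
  proof (rule sqint_dy[OF cY b])
    show "((\<lambda>y. e t x y * (V t x y * Vy t x y) - 1 / 2 * (ey t x y * (V t x y)\<^sup>2)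
         + drift / 2 * (e t x y * (V t x y)\<^sup>2)) has_real_derivative Y x y) (at y)" for x y
      unfolding Y_def by (rule derivative_eq_intros dV de refl)+ (simp add: algebra_simps power2_eq_square)
  qed (simp add: z)
  define W where "W = (\<lambda>x y. 1 / 2 * ((exx t x y + eyy t x y) - drift * ey t x y) * (V t x y)\<^sup>2
        + e t x y * V t x y * (Vt t x y - (Vxx t x y + Vyy t x y) - drift * Vy t x y))"
  define G where "G = (\<lambda>x y. e t x y * ((Vx t x y)\<^sup>2 + (Vy t x y)\<^sup>2))"
  have cW: "cont2 W" unfolding W_def by (intro cont2_lin c2)
  have cG: "cont2 G" unfolding G_def by (intro cont2_lin c2)
  have d: "((\<lambda>t. sqint b (\<lambda>x y. e t x y * (V t x y)\<^sup>2)) has_real_derivative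
      sqint b (\<lambda>x y. 2 * (e t x y * (V t x y * Vt t x y)))) (at t)"
    by (rule sqint_derivative[where T=UNIV and ut="\<lambda>t x y. 2 * (e t x y * (V t x y * Vt t x y))"])
       ((intro cont3_lin c open_UNIV UNIV_I | (rule derivative_eq_intros dV de refl | simp)+)+)
  have "(\<lambda>x y. e t x y * (V t x y * Vt t x y)) = (\<lambda>x y. ((X x y + Y x y) + W x y) - G x y)"
    by (intro ext) (simp add: X_def Y_def W_def G_def field_simps power2_eq_square)
  hence "sqint b (\<lambda>x y. e t x y * (V t x y * Vt t x y)) = ((sqint b X + sqint b Y) + sqint b W) - sqint b G"
    by (simp only: sqint_add sqint_diff cont2_lin cX cY cW cG)
  hence "sqint b (\<lambda>x y. 2 * (e t x y * (V t x y * Vt t x y))) / 2 = sqint b W - sqint b G"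
    by (simp add: sqint_cmult X0 Y0)
  with DERIV_cdivide[OF d, of 2]
  have "((\<lambda>t. sqint b (\<lambda>x y. e t x y * (V t x y)\<^sup>2) / 2) has_real_derivative sqint b W - sqint b G) (at t)"
    by (simp only:)
  thus ?thesis unfolding W_def G_def .
qed

text \<open>
  The factor of the Carleman weight blows up at both ends of the unit time interval, and since it
  multiplies a negative function, the weight vanishes there. \<open>weight1\<close> and \<open>weight2\<close> are its
  derivatives in \<open>t\<close>.
\<close>
definition weight :: "real \<Rightarrow> real \<Rightarrow> real" where "weight k t = k / (t * (1 - t))"
definition weight1 :: "real \<Rightarrow> real \<Rightarrow> real" where "weight1 k t = - k * (1 - 2 * t) / (t * (1 - t))\<^sup>2"
definition weight2 :: "real \<Rightarrow> real \<Rightarrow> real" where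
  "weight2 k t = 2 * k / (t * (1 - t))\<^sup>2 + 2 * k * (1 - 2 * t)\<^sup>2 / (t * (1 - t)) ^ 3"

lemma weight_deriv:
  assumes "0 < t" "t < 1"
  shows "(weight k has_real_derivative weight1 k t) (at t)"
    "(weight1 k has_real_derivative weight2 k t) (at t)"
proof -
  have p: "((\<lambda>t. t * (1 - t)) has_real_derivative 1 - 2 * t) (at t)"
    by (auto intro!: derivative_eq_intros)
  have nz: "t * (1 - t) \<noteq> 0" using assms by simp
  show "(weight k has_real_derivative weight1 k t) (at t)"
    unfolding weight_def[abs_def] weight1_def
    by (rule DERIV_cong[OF DERIV_divide[OF DERIV_const p nz]]) (simp add: power2_eq_square)
  have "((\<lambda>t. - k * (1 - 2 * t)) has_real_derivative 2 * k) (at t)"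
    by (auto intro!: derivative_eq_intros)
  moreover have "((\<lambda>t. (t * (1 - t))\<^sup>2) has_real_derivative 2 * (t * (1 - t)) * (1 - 2 * t)) (at t)"
    by (rule DERIV_cong[OF DERIV_power[OF p, of 2]]) (simp add: algebra_simps)
  moreover have "(t * (1 - t))\<^sup>2 \<noteq> 0" using nz by simp
  ultimately show "(weight1 k has_real_derivative weight2 k t) (at t)"
    unfolding weight1_def[abs_def] weight2_def
    by (rule DERIV_cong[OF DERIV_divide])
       (use nz in \<open>simp add: divide_simps, simp add: algebra_simps eval_nat_numeral\<close>)
qed

text \<open>
  For large \<open>k\<close> the cubic term of the commutator absorbs the terms with derivatives of the weight,
  because \<open>weight1 = O(weight\<^sup>2 / k)\<close> and \<open>weight2 = O(weight\<^sup>3 / k\<^sup>2)\<close>, and it also absorbs the potential.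
\<close>
lemma weight_bounds:
  fixes k t :: real
  assumes t: "0 < t" "t < 1" and k: "k \<ge> 4" "k \<ge> 5 * C0" "k \<ge> K\<^sup>2" and \<rho>: "\<rho> \<ge> 1" and \<psi>: "- C0 \<le> \<psi>" "\<psi> \<le> 0"
  shows "weight k t ^ 3 + K\<^sup>2 / 2 \<le> 2 * weight k t ^ 3 * \<rho>\<^sup>2 + 2 * weight k t * weight1 k t * \<rho>\<^sup>2 + weight2 k t * \<psi> / 2"
    and "weight k t \<ge> 1" and "\<bar>weight1 k t\<bar> \<le> (weight k t)\<^sup>2"
proof -
  define p where "p = t * (1 - t)"
  define d where "d = 1 - 2 * t"
  have p0: "p > 0" using t by (simp add: p_def)
  have "0 \<le> (1 - 2 * t)\<^sup>2" by simp
  hence p1: "p \<le> 1 / 4" by (simp add: p_def power2_eq_square algebra_simps)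
  have d: "\<bar>d\<bar> \<le> 1" using t by (auto simp: d_def)
  define h where "h = weight k t"
  have h: "h = k / p" by (simp add: h_def weight_def p_def)
  have "k * (4 * p) \<le> k * 1" using p1 k by (intro mult_left_mono) auto
  hence h4: "h \<ge> 4 * k" using p0 by (simp add: h field_simps)
  have k0: "k > 0" using k by simp
  have w1: "weight1 k t = - h\<^sup>2 * (d / k)"
    unfolding weight1_def h p_def[symmetric] d_def[symmetric]
    using p0 k0 by (simp add: field_simps power2_eq_square)
  have w2: "weight2 k t = h ^ 3 * ((2 * p + 2 * d\<^sup>2) / k\<^sup>2)"
    unfolding weight2_def h p_def[symmetric] d_def[symmetric]
    using p0 k0 by (simp add: divide_simps) (simp add: algebra_simps eval_nat_numeral)
  show "weight k t \<ge> 1" using h4 k by (simp add: h_def)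
  have dk: "\<bar>d / k\<bar> \<le> 1 / 4"
    using d k by (simp add: abs_divide divide_simps)
  show "\<bar>weight1 k t\<bar> \<le> (weight k t)\<^sup>2"
  proof -
    have "\<bar>d / k\<bar> \<le> 1" using dk by linarith
    hence "h\<^sup>2 * \<bar>d / k\<bar> \<le> h\<^sup>2 * 1" by (intro mult_left_mono) auto
    thus ?thesis unfolding w1 h_def[symmetric] by (simp add: abs_mult)
  qed
  have dk1: "d / k \<le> 1 / 4" using dk by linarith
  have h3: "h ^ 3 > 0" using h4 k0 by simp
  have hK: "h ^ 3 / 4 \<ge> K\<^sup>2 / 2"
  proof -
    have "h \<ge> 1" using h4 k by simp
    hence "h \<le> h ^ 3" using self_le_power[of h 3] by simp
    thus ?thesis using h4 k by linarith
  qed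
  have a: "2 * h * weight1 k t * \<rho>\<^sup>2 \<ge> - (1 / 2) * (h ^ 3 * \<rho>\<^sup>2)"
  proof -
    have "2 * h * weight1 k t * \<rho>\<^sup>2 = - 2 * ((h ^ 3 * \<rho>\<^sup>2) * (d / k))"
      by (simp add: w1 power2_eq_square power3_eq_cube)
    moreover have "(h ^ 3 * \<rho>\<^sup>2) * (d / k) \<le> (h ^ 3 * \<rho>\<^sup>2) * (1 / 4)"
      using dk1 h3 by (intro mult_left_mono) auto
    ultimately show ?thesis by linarith
  qed
  have b: "weight2 k t * \<psi> / 2 \<ge> - (1 / 4) * h ^ 3"
  proof -
    have "d\<^sup>2 \<le> 1" using d by (simp add: abs_le_square_iff[of d 1, simplified])
    hence "(2 * p + 2 * d\<^sup>2) * C0 \<le> (5 / 2) * C0" using p1 \<psi> by (intro mult_right_mono) auto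
    also have "\<dots> \<le> k * 1 / 2" using k by simp
    also have "\<dots> \<le> k * k / 2" using k by (intro divide_right_mono mult_left_mono) auto
    finally have "(2 * p + 2 * d\<^sup>2) / k\<^sup>2 * C0 \<le> 1 / 2"
      using k0 by (simp add: field_simps power2_eq_square)
    moreover have "(2 * p + 2 * d\<^sup>2) / k\<^sup>2 * (- \<psi>) \<le> (2 * p + 2 * d\<^sup>2) / k\<^sup>2 * C0"
      using \<psi> p0 by (intro mult_left_mono) auto
    ultimately have "h ^ 3 * ((2 * p + 2 * d\<^sup>2) / k\<^sup>2 * (- \<psi>)) \<le> h ^ 3 * (1 / 2)"
      using h3 by (intro mult_left_mono) auto
    thus ?thesis by (simp add: w2)
  qed
  have "h ^ 3 * 1 \<le> h ^ 3 * \<rho>\<^sup>2" using \<rho> h3 by (intro mult_left_mono) auto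
  thus "weight k t ^ 3 + K\<^sup>2 / 2 \<le> 2 * weight k t ^ 3 * \<rho>\<^sup>2 + 2 * weight k t * weight1 k t * \<rho>\<^sup>2 + weight2 k t * \<psi> / 2"
    using a b hK unfolding h_def[symmetric] by (simp add: mult.assoc)
qed

lemma sq_exp_le: "x > 0 \<Longrightarrow> x\<^sup>2 * exp (- 2 * x) \<le> 1 / (x :: real)"
proof -
  assume x: "x > 0"
  have "0 \<le> (x / 3 - 1 / 2)\<^sup>2" by simp
  hence "x \<le> (1 + x / 3)\<^sup>2" by (simp add: power2_eq_square field_simps)
  also have "\<dots> \<le> (exp (x / 3))\<^sup>2" using x by (intro power_mono) auto
  also have "\<dots> = exp (2 * x / 3)" by (simp add: exp_double[symmetric])
  finally have "x ^ 3 \<le> exp (2 * x / 3) ^ 3" using x by (intro power_mono) auto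
  also have "\<dots> = exp (2 * x)" by (simp add: exp_of_nat_mult[symmetric])
  finally show ?thesis using x by (simp add: exp_minus field_simps eval_nat_numeral)
qed

text \<open>
  The Carleman inequality is applied to \<open>v = \<chi> V\<close> with a cut-off \<open>\<chi>\<close> equal to a constant on the disc of
  radius \<open>\<rho>\<close> (called \<open>cu\<close> in the proof). The error terms live on an annulus where \<open>|V| \<le> M\<close>; they
  contain \<open>\<nabla>V\<close>, which is compensated by four times the Caccioppoli energy \<open>F\<close>. The sum \<open>Z = D + 4 F - C3 t\<close>
  is therefore decreasing, with \<open>- Z'\<close> at least the weighted mean square of \<open>v\<close>. The boundary
  term \<open>D\<close> tends to 0 at both ends of the unit interval whatever the size of \<open>V\<close>, so \<open>Z\<close> drops by at
  most a constant that depends on \<open>K\<close>, \<open>M\<close>, \<open>\<rho>\<close> and the drift alone, and the mean value theorem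
  provides the time \<open>t\<close>. The function \<open>P\<close> in the conclusion stands for a part of \<open>V\<^sup>2\<close> supported in the disc.
\<close>
lemma observability:
  fixes K M \<rho> drift :: real
  assumes K: "K \<ge> 0" and M: "M \<ge> 0" and \<rho>: "\<rho> > 0"
  shows "\<exists>b C. \<rho> \<le> b \<and> (\<forall>V Vt Vx Vy Vxx Vxy Vyy. C12 UNIV V Vt Vx Vy Vxx Vxy Vyy \<longrightarrow>
     (\<forall>t x y. \<bar>Vt t x y - (Vxx t x y + Vyy t x y) - drift * Vy t x y\<bar> \<le> K * \<bar>V t x y\<bar>) \<longrightarrow>
     (\<forall>t x y. \<rho>\<^sup>2 \<le> x\<^sup>2 + y\<^sup>2 \<longrightarrow> \<bar>V t x y\<bar> \<le> M) \<longrightarrow>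
     (\<exists>t\<in>{1/3..2/3}. \<forall>P. cont2 P \<longrightarrow> (\<forall>x y. 0 \<le> P x y \<and> P x y \<le> (V t x y)\<^sup>2) \<longrightarrow>
        (\<forall>x y. \<rho>\<^sup>2 \<le> x\<^sup>2 + y\<^sup>2 \<longrightarrow> P x y = 0) \<longrightarrow> sqint b P \<le> C))"
proof -
  obtain g k k1 k2 c where c: "c > 0"
    and dg: "\<And>s. (g has_real_derivative k s) (at s)" and dk: "\<And>s. (k has_real_derivative k1 s) (at s)"
    and dk1: "\<And>s. (k1 has_real_derivative k2 s) (at s)" and ck2: "continuous_on UNIV k2"
    and z0: "\<And>s. s \<le> 0 \<Longrightarrow> g s = 0 \<and> k s = 0 \<and> k1 s = 0 \<and> k2 s = 0"
    and z1: "\<And>s. s \<ge> 1 \<Longrightarrow> g s = c \<and> k s = 0 \<and> k1 s = 0 \<and> k2 s = 0"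
    and k01: "\<And>s. 0 \<le> k s \<and> k s \<le> 1"
    by (rule smooth_step_exists) blast
  have ck1: "continuous_on UNIV k1" using dk1 by (auto intro!: continuous_at_imp_continuous_on DERIV_isCont)
  define A where "A = 2 * \<rho>\<^sup>2 + 1"
  define b where "b = A + \<rho>"
  have A: "A \<ge> 1" by (simp add: A_def)
  have b: "b \<ge> \<rho>" "b \<ge> 0" "b \<ge> 1" "b\<^sup>2 \<ge> A"
  proof -
    show "b \<ge> \<rho>" "b \<ge> 0" "b \<ge> 1" using A \<rho> by (auto simp: b_def)
    hence "A * 1 \<le> b * b" using A \<rho> by (intro mult_mono) (auto simp: b_def)
    thus "b\<^sup>2 \<ge> A" by (simp add: power2_eq_square)
  qed
  define cu cux cuy cuxx cuxy cuyy where
    "cu = (\<lambda>(t :: real) x y. g (A - (x\<^sup>2 + y\<^sup>2)))" and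
    "cux = (\<lambda>(t :: real) x y. - 2 * x * k (A - (x\<^sup>2 + y\<^sup>2)))" and
    "cuy = (\<lambda>(t :: real) x y. - 2 * y * k (A - (x\<^sup>2 + y\<^sup>2)))" and
    "cuxx = (\<lambda>(t :: real) x y. 4 * x\<^sup>2 * k1 (A - (x\<^sup>2 + y\<^sup>2)) - 2 * k (A - (x\<^sup>2 + y\<^sup>2)))" and
    "cuxy = (\<lambda>(t :: real) x y. 4 * x * y * k1 (A - (x\<^sup>2 + y\<^sup>2)))" and
    "cuyy = (\<lambda>(t :: real) x y. 4 * y\<^sup>2 * k1 (A - (x\<^sup>2 + y\<^sup>2)) - 2 * k (A - (x\<^sup>2 + y\<^sup>2)))"
  note cu_defs = cu_def cux_def cuy_def cuxx_def cuxy_def cuyy_def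
  have Ccu: "C12 UNIV cu (\<lambda>t x y. 0) cux cuy cuxx cuxy cuyy"
    unfolding cu_defs by (rule radial_C12[OF dg dk ck1])
  \<comment> \<open>a cut-off of class \<open>C\<^sup>2\<close> that dominates the squared gradient of the first one\<close>
  define e ex ey exx exy eyy where
    "e = (\<lambda>(t :: real) x y. 4 * A * k (A - (x\<^sup>2 + y\<^sup>2)))" and
    "ex = (\<lambda>(t :: real) x y. - 2 * x * (4 * A * k1 (A - (x\<^sup>2 + y\<^sup>2))))" and
    "ey = (\<lambda>(t :: real) x y. - 2 * y * (4 * A * k1 (A - (x\<^sup>2 + y\<^sup>2))))" and
    "exx = (\<lambda>(t :: real) x y. 4 * x\<^sup>2 * (4 * A * k2 (A - (x\<^sup>2 + y\<^sup>2))) - 2 * (4 * A * k1 (A - (x\<^sup>2 + y\<^sup>2))))" and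
    "exy = (\<lambda>(t :: real) x y. 4 * x * y * (4 * A * k2 (A - (x\<^sup>2 + y\<^sup>2))))" and
    "eyy = (\<lambda>(t :: real) x y. 4 * y\<^sup>2 * (4 * A * k2 (A - (x\<^sup>2 + y\<^sup>2))) - 2 * (4 * A * k1 (A - (x\<^sup>2 + y\<^sup>2))))"
  note e_defs = e_def ex_def ey_def exx_def exy_def eyy_def
  have Ce: "C12 UNIV e (\<lambda>t x y. 0) ex ey exx exy eyy"
    unfolding e_defs
    by (rule radial_C12) (auto intro!: DERIV_cmult dk dk1 continuous_intros ck2)
  have out: "cu t x y = 0 \<and> cux t x y = 0 \<and> cuy t x y = 0 \<and> e t x y = 0 \<and> ex t x y = 0 \<and> ey t x y = 0"
    if "\<not> (\<bar>x\<bar> < b \<and> \<bar>y\<bar> < b)" for t x y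
  proof -
    have "b\<^sup>2 \<le> x\<^sup>2 \<or> b\<^sup>2 \<le> y\<^sup>2"
      using that b by (auto simp: abs_le_square_iff[symmetric] not_less)
    hence "b\<^sup>2 \<le> x\<^sup>2 + y\<^sup>2" using zero_le_power2[of x] zero_le_power2[of y] by linarith
    hence "A - (x\<^sup>2 + y\<^sup>2) \<le> 0" using b by simp
    from z0[OF this] show ?thesis by (simp add: cu_defs e_defs)
  qed
  have inn: "cu t x y = c \<and> cux t x y = 0 \<and> cuy t x y = 0 \<and> cuxx t x y = 0 \<and> cuyy t x y = 0
      \<and> e t x y = 0 \<and> ex t x y = 0 \<and> ey t x y = 0 \<and> exx t x y = 0 \<and> eyy t x y = 0"
    if "x\<^sup>2 + y\<^sup>2 < \<rho>\<^sup>2" for t x y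
  proof -
    have "A - (x\<^sup>2 + y\<^sup>2) \<ge> 1" using that zero_le_power2[of \<rho>] unfolding A_def by linarith
    from z1[OF this] show ?thesis by (simp add: cu_defs e_defs)
  qed
  have e04: "0 \<le> e t x y" "e t x y \<le> 4 * A" for t x y
    using k01[of "A - (x\<^sup>2 + y\<^sup>2)"] A by (auto simp: e_def)
  have grad: "(cux t x y)\<^sup>2 + (cuy t x y)\<^sup>2 \<le> e t x y" for t x y
  proof -
    let ?k = "k (A - (x\<^sup>2 + y\<^sup>2))"
    have eq: "(cux t x y)\<^sup>2 + (cuy t x y)\<^sup>2 = 4 * ((x\<^sup>2 + y\<^sup>2) * (?k * ?k))"
      by (simp add: cu_defs power2_eq_square algebra_simps)
    have "(x\<^sup>2 + y\<^sup>2) * (?k * ?k) \<le> A * ?k"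
    proof (cases "x\<^sup>2 + y\<^sup>2 \<le> A")
      case True
      have "?k * ?k \<le> ?k * 1" using k01 by (intro mult_left_mono) auto
      thus ?thesis using True k01 A by (intro mult_mono) auto
    next
      case False
      thus ?thesis using z0[of "A - (x\<^sup>2 + y\<^sup>2)"] by simp
    qed
    thus ?thesis unfolding eq by (simp add: e_def)
  qed
  note ccu = C12_cont[OF Ccu] and ce = C12_cont[OF Ce]
  have "cont3 UNIV (\<lambda>t x y. cuxx t x y + cuyy t x y + drift * cuy t x y)" by (intro cont3_lin ccu)
  from cont3_bounded[OF this, of "{0}" b]
  obtain B1 where B1: "B1 \<ge> 0" "\<And>x y. \<bar>x\<bar> \<le> b \<Longrightarrow> \<bar>y\<bar> \<le> b \<Longrightarrow>
      \<bar>cuxx 0 x y + cuyy 0 x y + drift * cuy 0 x y\<bar> \<le> B1" by auto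
  note B10 = B1(1)
  have B1: "\<bar>cuxx t x y + cuyy t x y + drift * cuy t x y\<bar> \<le> B1" if "\<bar>x\<bar> \<le> b" "\<bar>y\<bar> \<le> b" for t x y
    using B1(2)[OF that] by (simp add: cu_defs)
  have "cont3 UNIV (\<lambda>t x y. 1 / 2 * (exx t x y + eyy t x y - drift * ey t x y))" by (intro cont3_lin ce)
  from cont3_bounded[OF this, of "{0}" b]
  obtain B2 where B2: "B2 \<ge> 0" "\<And>x y. \<bar>x\<bar> \<le> b \<Longrightarrow> \<bar>y\<bar> \<le> b \<Longrightarrow>
      \<bar>1 / 2 * (exx 0 x y + eyy 0 x y - drift * ey 0 x y)\<bar> \<le> B2" by auto
  have B2': "\<bar>1 / 2 * (exx t x y + eyy t x y - drift * ey t x y)\<bar> \<le> B2" if "\<bar>x\<bar> \<le> b" "\<bar>y\<bar> \<le> b" for t x y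
    using B2(2)[OF that] by (simp add: e_defs)
  define r where "r = b + 1"
  define L where "L = 2 * b + 1"
  define C0 where "C0 = L\<^sup>2 / 2 + 1"
  \<comment> \<open>On the square \<open>\<psi>\<close> lies between \<open>- C0\<close> and \<open>- 1\<close>; the upper bound makes the weight vanish at \<open>t = 0\<close> and \<open>t = 1\<close>.\<close>
  define kk where "kk = 4 + 5 * C0 + K\<^sup>2"
  have C0: "C0 \<ge> 1" by (simp add: C0_def)
  have kk: "kk \<ge> 4" "kk \<ge> 5 * C0" "kk \<ge> K\<^sup>2" using C0 by (auto simp: kk_def)
  define \<psi> where "\<psi> = (\<lambda>x. (x + r)\<^sup>2 / 2 - C0)"
  have xr: "1 \<le> x + r" "x + r \<le> L" "- C0 \<le> \<psi> x" "\<psi> x \<le> - 1" if "\<bar>x\<bar> \<le> b" for x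
  proof -
    show 1: "1 \<le> x + r" "x + r \<le> L" using that by (auto simp: r_def L_def)
    show "- C0 \<le> \<psi> x" by (simp add: \<psi>_def)
    have "(x + r)\<^sup>2 \<le> L\<^sup>2" using 1 by (intro power_mono) auto
    thus "\<psi> x \<le> - 1" by (simp add: \<psi>_def C0_def)
  qed
  define T :: "real set" where "T = {0<..<1}"
  have T: "open T" by (simp add: T_def)
  define th th1 th2 where "th = weight kk" and "th1 = weight1 kk" and "th2 = weight2 kk"
  have dth: "\<And>s. s \<in> T \<Longrightarrow> (th has_real_derivative th1 s) (at s)"
    "\<And>s. s \<in> T \<Longrightarrow> (th1 has_real_derivative th2 s) (at s)"
    by (auto simp: T_def th_def th1_def th2_def weight_deriv)
  have cth2: "continuous_on T th2"
    unfolding th2_def weight2_def[abs_def] T_def by (intro continuous_intros) auto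
  have th: "th t \<ge> 1" "\<bar>th1 t\<bar> \<le> (th t)\<^sup>2" if "t \<in> T" for t
    using weight_bounds(2,3)[OF _ _ kk, of t 1 0] that C0 by (auto simp: T_def th_def th1_def)
  have thQ: "th t ^ 3 + K\<^sup>2 / 2 \<le> 2 * th t ^ 3 * (x + r)\<^sup>2 + 2 * th t * th1 t * (x + r)\<^sup>2 + th2 t * \<psi> x / 2"
    if "t \<in> T" "\<bar>x\<bar> \<le> b" for t x
    unfolding th_def th1_def th2_def
    using xr[OF that(2)] that(1) by (intro weight_bounds(1)[OF _ _ kk]) (auto simp: T_def)
  define Box where "Box = (2 * b)\<^sup>2"
  define C2 where "C2 = B2 * M\<^sup>2 + 4 * A * (K * M\<^sup>2)"
  define C3 where "C3 = Box * (B1\<^sup>2 * M\<^sup>2) + 4 * (Box * C2)"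
  define Fm where "Fm = Box * (4 * A * M\<^sup>2) / 2"
  have nn: "Box \<ge> 0" "C2 \<ge> 0" "C3 \<ge> 0" "Fm \<ge> 0"
    using A K B2(1) by (auto simp: Box_def C2_def C3_def Fm_def)
  define C where "C = exp (9 * kk * C0) / c\<^sup>2 * (3 * (C3 + 4 * Fm))"
  show ?thesis
  proof (rule exI[of _ b], rule exI[of _ C], intro conjI allI impI)
    show "\<rho> \<le> b" by (rule b)
    fix V Vt Vx Vy Vxx Vxy Vyy
    assume CV: "C12 UNIV V Vt Vx Vy Vxx Vxy Vyy"
      and eqn: "\<forall>t x y. \<bar>Vt t x y - (Vxx t x y + Vyy t x y) - drift * Vy t x y\<bar> \<le> K * \<bar>V t x y\<bar>"
      and far: "\<forall>t x y. \<rho>\<^sup>2 \<le> x\<^sup>2 + y\<^sup>2 \<longrightarrow> \<bar>V t x y\<bar> \<le> M"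
    have V2: "(V t x y)\<^sup>2 \<le> M\<^sup>2" if "\<rho>\<^sup>2 \<le> x\<^sup>2 + y\<^sup>2" for t x y
      using far that M by (simp add: abs_le_square_iff[symmetric])
    define gg where "gg = (\<lambda>t x y. Vt t x y - (Vxx t x y + Vyy t x y) - drift * Vy t x y)"
    have gg: "\<bar>gg t x y\<bar> \<le> K * \<bar>V t x y\<bar>" for t x y using eqn by (simp add: gg_def)
    define v vt vx vy vxx vxy vyy where
      "v = (\<lambda>t x y. cu t x y * V t x y)" and
      "vt = (\<lambda>t x y. 0 * V t x y + cu t x y * Vt t x y)" and
      "vx = (\<lambda>t x y. cux t x y * V t x y + cu t x y * Vx t x y)" and
      "vy = (\<lambda>t x y. cuy t x y * V t x y + cu t x y * Vy t x y)" and
      "vxx = (\<lambda>t x y. cuxx t x y * V t x y + 2 * (cux t x y * Vx t x y) + cu t x y * Vxx t x y)" and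
      "vxy = (\<lambda>t x y. cuxy t x y * V t x y + (cux t x y * Vy t x y + cuy t x y * Vx t x y) + cu t x y * Vxy t x y)" and
      "vyy = (\<lambda>t x y. cuyy t x y * V t x y + 2 * (cuy t x y * Vy t x y) + cu t x y * Vyy t x y)"
    note v_defs = v_def vt_def vx_def vy_def vxx_def vxy_def vyy_def
    have Cv: "C12 UNIV v vt vx vy vxx vxy vyy" unfolding v_defs by (rule C12_mult[OF Ccu CV])
    have CvT: "C12 T v vt vx vy vxx vxy vyy" by (rule C12_subset[OF Cv]) simp
    have vout: "v t x y = 0 \<and> vx t x y = 0 \<and> vy t x y = 0" if "\<not> (\<bar>x\<bar> < b \<and> \<bar>y\<bar> < b)" for t x y
      using out[OF that] by (simp add: v_defs)
    define E where "E = (\<lambda>s x. exp (th s * \<psi> x))"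
    define q where "q = (\<lambda>s x. (th s)\<^sup>2 * (x + r)\<^sup>2 + th1 s * \<psi> x)"
    define D where "D = (\<lambda>s. sqint b (\<lambda>x y. (E s x)\<^sup>2 * ((th s * (x + r) * v s x y + vx s x y)\<^sup>2
            + (vy s x y)\<^sup>2 - q s x * (v s x y)\<^sup>2)) / 2)"
    define R where "R = (\<lambda>t x y. (E t x)\<^sup>2 * (vt t x y - (vxx t x y + vyy t x y) - drift * vy t x y)\<^sup>2)"
    define QQ where "QQ = (\<lambda>t x. 2 * th t ^ 3 * (x + r)\<^sup>2 + 2 * th t * th1 t * (x + r)\<^sup>2 + th2 t * \<psi> x / 2)"
    define w where "w = (\<lambda>t x y. (E t x)\<^sup>2 * (v t x y)\<^sup>2)"
    have "\<forall>t\<in>T. \<exists>D'. (D has_real_derivative D') (at t) \<and>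
       D' + sqint b (\<lambda>x y. QQ t x * w t x y) \<le> sqint b (R t) / 4"
    proof
      fix t assume t: "t \<in> T"
      show "\<exists>D'. (D has_real_derivative D') (at t) \<and>
         D' + sqint b (\<lambda>x y. QQ t x * w t x y) \<le> sqint b (R t) / 4"
        unfolding D_def QQ_def w_def R_def E_def q_def \<psi>_def
        by (rule carleman_inequality[OF CvT T t b(2) vout dth cth2]) (use th[OF t] in auto)
    qed
    then obtain D' where D': "\<And>t. t \<in> T \<Longrightarrow> (D has_real_derivative D' t) (at t)"
       "\<And>t. t \<in> T \<Longrightarrow> D' t + sqint b (\<lambda>x y. QQ t x * w t x y) \<le> sqint b (R t) / 4"
      by metis
    define F where "F = (\<lambda>t. sqint b (\<lambda>x y. e t x y * (V t x y)\<^sup>2) / 2)"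
    define W where "W = (\<lambda>t x y. 1 / 2 * ((exx t x y + eyy t x y) - drift * ey t x y) * (V t x y)\<^sup>2
        + e t x y * V t x y * (Vt t x y - (Vxx t x y + Vyy t x y) - drift * Vy t x y))"
    define G where "G = (\<lambda>t x y. e t x y * ((Vx t x y)\<^sup>2 + (Vy t x y)\<^sup>2))"
    have F': "(F has_real_derivative sqint b (W t) - sqint b (G t)) (at t)" for t
      unfolding F_def W_def G_def by (rule caccioppoli_identity[OF CV Ce b(2)]) (use out in auto)
    note cV = C12_cont[OF CV] and cv = C12_cont[OF Cv]
    have E1: "E t x > 0" "(E t x)\<^sup>2 \<le> 1" if "t \<in> T" "\<bar>x\<bar> \<le> b" for t x
    proof -
      have "th t * \<psi> x \<le> 0" using th(1)[OF that(1)] xr(4)[OF that(2)] by (intro mult_nonneg_nonpos) auto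
      hence "E t x \<le> 1" by (simp add: E_def)
      thus "(E t x)\<^sup>2 \<le> 1" by (simp add: E_def power_le_one)
    qed (simp add: E_def)
    have cE: "cont2 (\<lambda>x y. E t x)" for t
      unfolding E_def \<psi>_def by (intro cont2_x continuous_intros) auto
    have cQ: "cont2 (\<lambda>x y. QQ t x)" "cont2 (\<lambda>x y. q t x)" for t
      unfolding QQ_def q_def \<psi>_def by (intro cont2_x continuous_intros, auto)+
    have cc: "cont2 (\<lambda>x y. k)" for k :: real by (intro cont2_x continuous_intros)
    have cxr: "cont2 (\<lambda>x y. x + r)" by (intro cont2_x continuous_intros)
    note c2 = cV[THEN cont3_cont2, OF UNIV_I] cv[THEN cont3_cont2, OF UNIV_I]
      ce[THEN cont3_cont2, OF UNIV_I] cE cQ cc cxr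
    have cw: "cont2 (w t)" for t unfolding w_def by (intro cont2_lin c2)
    have cR: "cont2 (R t)" for t unfolding R_def by (intro cont2_lin c2)
    have cW: "cont2 (W t)" for t unfolding W_def by (intro cont2_lin c2)
    have cG: "cont2 (G t)" for t unfolding G_def by (intro cont2_lin c2)
    have w0: "w t x y \<ge> 0" for t x y by (simp add: w_def)
    \<comment> \<open>The right-hand side is the potential term, the commutator with the cut-off (paid by Caccioppoli), and a constant.\<close>
    have Rb: "1 / 4 * R t x y \<le> K\<^sup>2 / 2 * w t x y + (4 * G t x y + B1\<^sup>2 * M\<^sup>2)"
      if t: "t \<in> T" and x: "\<bar>x\<bar> \<le> b" and y: "\<bar>y\<bar> \<le> b" for t x y
    proof -
      define a1 where "a1 = cu t x y * gg t x y"
      define b1 where "b1 = cux t x y * Vx t x y + cuy t x y * Vy t x y"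
      define b2 where "b2 = (cuxx t x y + cuyy t x y + drift * cuy t x y) * V t x y"
      have eq: "vt t x y - (vxx t x y + vyy t x y) - drift * vy t x y = a1 - 2 * b1 - b2"
        by (simp add: v_defs a1_def b1_def b2_def gg_def algebra_simps)
      have sq: "(a1 - 2 * b1 - b2)\<^sup>2 \<le> 2 * a1\<^sup>2 + (16 * b1\<^sup>2 + 4 * b2\<^sup>2)"
      proof -
        have "0 \<le> (a1 + 2 * b1 + b2)\<^sup>2" "0 \<le> (2 * b1 - b2)\<^sup>2" by simp_all
        thus ?thesis by (simp add: power2_eq_square algebra_simps)
      qed
      have a1: "a1\<^sup>2 \<le> K\<^sup>2 * (v t x y)\<^sup>2"
      proof -
        have "(gg t x y)\<^sup>2 \<le> (K * V t x y)\<^sup>2" using gg[of t x y] K by (simp add: abs_le_square_iff[symmetric] abs_mult)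
        hence "(cu t x y)\<^sup>2 * (gg t x y)\<^sup>2 \<le> (cu t x y)\<^sup>2 * (K * V t x y)\<^sup>2" by (intro mult_left_mono) auto
        thus ?thesis by (simp add: a1_def v_def power_mult_distrib mult_ac)
      qed
      have b1: "b1\<^sup>2 \<le> G t x y"
      proof -
        have "0 \<le> (cux t x y * Vy t x y - cuy t x y * Vx t x y)\<^sup>2" by simp
        hence "b1\<^sup>2 \<le> ((cux t x y)\<^sup>2 + (cuy t x y)\<^sup>2) * ((Vx t x y)\<^sup>2 + (Vy t x y)\<^sup>2)"
          by (simp add: b1_def power2_eq_square algebra_simps)
        also have "\<dots> \<le> G t x y" unfolding G_def by (intro mult_right_mono grad) auto
        finally show ?thesis .
      qed
      have b2: "b2\<^sup>2 \<le> B1\<^sup>2 * M\<^sup>2"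
      proof (cases "x\<^sup>2 + y\<^sup>2 < \<rho>\<^sup>2")
        case True
        thus ?thesis using inn[OF True, of t] by (simp add: b2_def)
      next
        case False
        have "(cuxx t x y + cuyy t x y + drift * cuy t x y)\<^sup>2 \<le> B1\<^sup>2"
          using power_mono[OF B1[OF x y, of t], of 2] by simp
        thus ?thesis using V2[of x y t] False unfolding b2_def power_mult_distrib
          by (intro mult_mono) auto
      qed
      have "R t x y \<le> (E t x)\<^sup>2 * (2 * a1\<^sup>2 + (16 * b1\<^sup>2 + 4 * b2\<^sup>2))"
        unfolding R_def eq using sq by (intro mult_left_mono) auto
      also have "\<dots> = (E t x)\<^sup>2 * (2 * a1\<^sup>2) + (E t x)\<^sup>2 * (16 * b1\<^sup>2 + 4 * b2\<^sup>2)" by (simp add: distrib_left)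
      also have "\<dots> \<le> (E t x)\<^sup>2 * (2 * (K\<^sup>2 * (v t x y)\<^sup>2)) + 1 * (16 * G t x y + 4 * (B1\<^sup>2 * M\<^sup>2))"
        using a1 b1 b2 E1[OF t x] by (intro add_mono mult_left_mono mult_mono) auto
      finally show ?thesis by (simp add: w_def mult_ac)
    qed
    have Wb: "W t x y \<le> C2" if x: "\<bar>x\<bar> \<le> b" and y: "\<bar>y\<bar> \<le> b" for t x y
    proof (cases "x\<^sup>2 + y\<^sup>2 < \<rho>\<^sup>2")
      case True
      thus ?thesis using inn[OF True, of t] nn by (simp add: W_def)
    next
      case False
      hence V2': "(V t x y)\<^sup>2 \<le> M\<^sup>2" using V2 by simp
      have "1 / 2 * ((exx t x y + eyy t x y) - drift * ey t x y) * (V t x y)\<^sup>2 \<le> B2 * M\<^sup>2"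
        using B2'[OF x y, of t] B2(1) V2' by (intro mult_mono) auto
      moreover have "e t x y * V t x y * gg t x y \<le> 4 * A * (K * M\<^sup>2)"
      proof -
        have "V t x y * gg t x y \<le> \<bar>V t x y\<bar> * \<bar>gg t x y\<bar>" by (metis abs_ge_self abs_mult)
        also have "\<dots> \<le> \<bar>V t x y\<bar> * (K * \<bar>V t x y\<bar>)" by (intro mult_left_mono gg) auto
        also have "\<dots> = K * (V t x y)\<^sup>2" by (simp add: power2_eq_square mult_ac abs_mult_self_eq)
        also have "\<dots> \<le> K * M\<^sup>2" using K V2' by (intro mult_left_mono)
        finally have "e t x y * (V t x y * gg t x y) \<le> e t x y * (K * M\<^sup>2)"
          using e04 by (intro mult_left_mono) auto
        also have "\<dots> \<le> 4 * A * (K * M\<^sup>2)" using e04[of t x y] K by (intro mult_right_mono) auto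
        finally show ?thesis by (simp add: mult_ac)
      qed
      moreover have "W t x y = 1 / 2 * ((exx t x y + eyy t x y) - drift * ey t x y) * (V t x y)\<^sup>2
          + e t x y * V t x y * gg t x y" by (simp add: W_def gg_def)
      ultimately show ?thesis unfolding C2_def by linarith
    qed
    have Fb: "0 \<le> F t" "F t \<le> Fm" for t
    proof -
      have "0 \<le> sqint b (\<lambda>x y. e t x y * (V t x y)\<^sup>2)"
        using e04 by (intro sqint_nonneg cont2_lin c2) auto
      thus "0 \<le> F t" by (simp add: F_def)
      have "e t x y * (V t x y)\<^sup>2 \<le> 4 * A * M\<^sup>2" for x y
      proof (cases "x\<^sup>2 + y\<^sup>2 < \<rho>\<^sup>2")
        case True
        thus ?thesis using inn[OF True, of t] A by simp
      next
        case False
        thus ?thesis using V2[of x y t] e04[of t x y] A by (intro mult_mono) auto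
      qed
      hence "sqint b (\<lambda>x y. e t x y * (V t x y)\<^sup>2) \<le> sqint b (\<lambda>x y. 4 * A * M\<^sup>2)"
        by (intro sqint_mono cont2_lin c2) auto
      thus "F t \<le> Fm" by (simp add: F_def Fm_def Box_def sqint_const b mult_ac)
    qed
    define Z where "Z = (\<lambda>t. D t + 4 * F t - C3 * t)"
    have dZ: "\<exists>Z'. (Z has_real_derivative Z') (at t) \<and> Z' \<le> - sqint b (w t) \<and> sqint b (w t) \<ge> 0"
      if t: "t \<in> T" for t
    proof (intro exI conjI)
      show "(Z has_real_derivative D' t + 4 * (sqint b (W t) - sqint b (G t)) - C3) (at t)"
        unfolding Z_def by (rule derivative_eq_intros D'(1)[OF t] F' refl | simp)+
      have w0': "sqint b (w t) \<ge> 0" by (intro sqint_nonneg cw w0)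
      have "sqint b (\<lambda>x y. (1 + K\<^sup>2 / 2) * w t x y) \<le> sqint b (\<lambda>x y. QQ t x * w t x y)"
      proof (rule sqint_mono)
        fix x y :: real assume x: "\<bar>x\<bar> \<le> b"
        have "1 \<le> th t ^ 3" using th(1)[OF t] by (rule one_le_power)
        hence "1 + K\<^sup>2 / 2 \<le> QQ t x" using thQ[OF t x] unfolding QQ_def by linarith
        thus "(1 + K\<^sup>2 / 2) * w t x y \<le> QQ t x * w t x y" by (intro mult_right_mono w0)
      qed (intro cont2_lin c2 cw)+
      moreover have "sqint b (\<lambda>x y. 1 / 4 * R t x y) \<le>
          sqint b (\<lambda>x y. K\<^sup>2 / 2 * w t x y + (4 * G t x y + B1\<^sup>2 * M\<^sup>2))"
        by (intro sqint_mono cont2_lin c2 cw cG cR Rb t)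
      moreover have "sqint b (\<lambda>x y. K\<^sup>2 / 2 * w t x y + (4 * G t x y + B1\<^sup>2 * M\<^sup>2))
          = K\<^sup>2 / 2 * sqint b (w t) + (4 * sqint b (G t) + Box * (B1\<^sup>2 * M\<^sup>2))"
        by (simp only: sqint_add sqint_cmult cont2_lin c2 cw cG sqint_const b(2) Box_def) (simp only: mult_ac)
      moreover have "sqint b (\<lambda>x y. (1 + K\<^sup>2 / 2) * w t x y) = sqint b (w t) + K\<^sup>2 / 2 * sqint b (w t)"
        unfolding sqint_cmult by (simp add: distrib_right)
      moreover have "sqint b (W t) \<le> sqint b (\<lambda>x y. C2)"
        by (intro sqint_mono cW c2 Wb)
      moreover have "sqint b (\<lambda>x y. C2) = Box * C2" by (simp add: sqint_const b Box_def)
      moreover note D'(2)[OF t] sqint_cmult[of b "1 / 4" "R t"]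
      show "D' t + 4 * (sqint b (W t) - sqint b (G t)) - C3 \<le> - sqint b (w t)"
      proof -
        have arith: "d + 4 * (wi - gi) - (bb + 4 * bc) \<le> - wt"
          if "a \<le> qi" "ra \<le> s" "s = kw + (4 * gi + bb)" "a = wt + kw" "wi \<le> c" "c = bc"
            "d + qi \<le> ri / 4" "ra = 1 / 4 * ri" for d wi gi bb bc wt a qi ra s kw c ri :: real
          using that by (simp add: field_simps)
        show ?thesis
          unfolding C3_def
          by (rule arith[OF calculation D'(2)[OF t] sqint_cmult[of b "1 / 4" "R t"]])
      qed
      show "sqint b (w t) \<ge> 0" by fact
    qed
    have mono: "Z t \<le> Z s" if "0 < s" "s \<le> t" "t < 1" for s t
    proof (rule DERIV_nonpos_imp_nonincreasing[OF that(2)])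
      fix x assume "s \<le> x" "x \<le> t"
      hence "x \<in> T" using that by (auto simp: T_def)
      from dZ[OF this] show "\<exists>y. (Z has_real_derivative y) (at x) \<and> y \<le> 0" by fastforce
    qed
    obtain N1 where N1: "\<And>s x y. s \<in> {0..1} \<Longrightarrow> \<bar>x\<bar> \<le> b \<Longrightarrow> \<bar>y\<bar> \<le> b \<Longrightarrow> \<bar>v s x y\<bar> \<le> N1"
      using cont3_bounded[OF cv(1) compact_Icc subset_UNIV, of 0 1 b] by blast
    obtain N2 where N2: "\<And>s x y. s \<in> {0..1} \<Longrightarrow> \<bar>x\<bar> \<le> b \<Longrightarrow> \<bar>y\<bar> \<le> b \<Longrightarrow> \<bar>vx s x y\<bar> \<le> N2"
      using cont3_bounded[OF cv(3) compact_Icc subset_UNIV, of 0 1 b] by blast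
    obtain N3 where N3: "\<And>s x y. s \<in> {0..1} \<Longrightarrow> \<bar>x\<bar> \<le> b \<Longrightarrow> \<bar>y\<bar> \<le> b \<Longrightarrow> \<bar>vy s x y\<bar> \<le> N3"
      using cont3_bounded[OF cv(4) compact_Icc subset_UNIV, of 0 1 b] by blast
    define Mv where "Mv = 3 * L\<^sup>2 * N1\<^sup>2 + C0 * N1\<^sup>2 + 2 * N2\<^sup>2 + N3\<^sup>2"
    have Mv: "Mv \<ge> 0" using C0 by (simp add: Mv_def)
    define C' where "C' = Box * Mv"
    have C': "C' \<ge> 0" using Mv nn by (simp add: C'_def)
    \<comment> \<open>\<open>C'\<close> depends on \<open>V\<close>; only the vanishing of the bound at the ends matters.\<close>
    have Dend: "\<bar>D t\<bar> \<le> C' * (t * (1 - t))" if t: "t \<in> T" for t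
    proof -
      define h where "h = th t"
      have h1: "h \<ge> 1" using th[OF t] by (simp add: h_def)
      have pt: "0 < t * (1 - t)" using t by (simp add: T_def)
      have "t * (1 - t) \<noteq> 0" using pt by linarith
      hence "h * (t * (1 - t)) = kk" unfolding h_def th_def weight_def by (metis nonzero_divide_eq_eq)
      hence hp: "1 / h \<le> t * (1 - t)" using kk h1 by (simp add: field_simps)
      have "\<bar>(E t x)\<^sup>2 * ((th t * (x + r) * v t x y + vx t x y)\<^sup>2 + (vy t x y)\<^sup>2 - q t x * (v t x y)\<^sup>2)\<bar>
          \<le> Mv * (t * (1 - t))" if x: "\<bar>x\<bar> \<le> b" and y: "\<bar>y\<bar> \<le> b" for x y
      proof -
        have t01: "t \<in> {0..1}" using t by (auto simp: T_def)
        have v2: "(v t x y)\<^sup>2 \<le> N1\<^sup>2" "(vx t x y)\<^sup>2 \<le> N2\<^sup>2" "(vy t x y)\<^sup>2 \<le> N3\<^sup>2"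
          using N1[OF t01 x y] N2[OF t01 x y] N3[OF t01 x y]
          by (metis abs_ge_zero abs_le_square_iff abs_of_nonneg order_trans)+
        have xr2: "(x + r)\<^sup>2 \<le> L\<^sup>2" using xr[OF x] by (intro power_mono) auto
        have h2: "h\<^sup>2 \<ge> 1" using h1 by (simp add: one_le_power)
        have i1: "(th t * (x + r) * v t x y + vx t x y)\<^sup>2 \<le> h\<^sup>2 * (2 * (L\<^sup>2 * N1\<^sup>2) + 2 * N2\<^sup>2)"
        proof -
          have "0 \<le> (th t * (x + r) * v t x y - vx t x y)\<^sup>2" by simp
          hence "(th t * (x + r) * v t x y + vx t x y)\<^sup>2
              \<le> 2 * (h\<^sup>2 * ((x + r)\<^sup>2 * (v t x y)\<^sup>2)) + 2 * (1 * (vx t x y)\<^sup>2)"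
            by (simp add: h_def power2_eq_square algebra_simps)
          also have "\<dots> \<le> 2 * (h\<^sup>2 * (L\<^sup>2 * N1\<^sup>2)) + 2 * (h\<^sup>2 * N2\<^sup>2)"
            using v2 xr2 h2 by (intro add_mono mult_mono mult_left_mono) auto
          finally show ?thesis by (simp add: algebra_simps)
        qed
        have i2: "(vy t x y)\<^sup>2 \<le> h\<^sup>2 * N3\<^sup>2"
          using mult_mono[OF h2 v2(3)] by simp
        have i3: "\<bar>q t x * (v t x y)\<^sup>2\<bar> \<le> h\<^sup>2 * ((L\<^sup>2 + C0) * N1\<^sup>2)"
        proof -
          have "\<bar>th1 t * \<psi> x\<bar> \<le> h\<^sup>2 * C0"
            unfolding abs_mult h_def using th(2)[OF t] xr(3,4)[OF x] by (intro mult_mono) auto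
          moreover have "0 \<le> h\<^sup>2 * (x + r)\<^sup>2" "h\<^sup>2 * (x + r)\<^sup>2 \<le> h\<^sup>2 * L\<^sup>2"
            using xr2 by (auto intro: mult_left_mono)
          ultimately have "\<bar>q t x\<bar> \<le> h\<^sup>2 * (L\<^sup>2 + C0)"
            unfolding q_def h_def[symmetric] distrib_left by linarith
          hence "\<bar>q t x\<bar> * (v t x y)\<^sup>2 \<le> h\<^sup>2 * (L\<^sup>2 + C0) * N1\<^sup>2"
            using v2 by (intro mult_mono) auto
          thus ?thesis by (simp add: abs_mult mult.assoc)
        qed
        have "h\<^sup>2 * Mv = h\<^sup>2 * (2 * (L\<^sup>2 * N1\<^sup>2) + 2 * N2\<^sup>2) + h\<^sup>2 * N3\<^sup>2 + h\<^sup>2 * ((L\<^sup>2 + C0) * N1\<^sup>2)"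
          by (simp add: Mv_def algebra_simps)
        hence "\<bar>(th t * (x + r) * v t x y + vx t x y)\<^sup>2 + (vy t x y)\<^sup>2 - q t x * (v t x y)\<^sup>2\<bar> \<le> h\<^sup>2 * Mv"
          using i1 i2 i3 zero_le_power2[of "th t * (x + r) * v t x y + vx t x y"]
            zero_le_power2[of "vy t x y"] by linarith
        moreover have "(E t x)\<^sup>2 \<le> exp (- 2 * h)"
        proof -
          have "h * \<psi> x \<le> h * - 1" using xr(4)[OF x] h1 by (intro mult_left_mono) auto
          thus ?thesis by (simp add: E_def h_def exp_double[symmetric] mult.commute)
        qed
        ultimately have "(E t x)\<^sup>2 * \<bar>(th t * (x + r) * v t x y + vx t x y)\<^sup>2 + (vy t x y)\<^sup>2 - q t x * (v t x y)\<^sup>2\<bar>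
            \<le> exp (- 2 * h) * (h\<^sup>2 * Mv)" by (intro mult_mono) auto
        also have "\<dots> = (h\<^sup>2 * exp (- 2 * h)) * Mv" by simp
        also have "\<dots> \<le> (t * (1 - t)) * Mv"
          using sq_exp_le[of h] h1 hp Mv by (intro mult_right_mono) auto
        finally show ?thesis by (simp add: abs_mult mult_ac)
      qed
      hence "\<bar>sqint b (\<lambda>x y. (E t x)\<^sup>2 * ((th t * (x + r) * v t x y + vx t x y)\<^sup>2
            + (vy t x y)\<^sup>2 - q t x * (v t x y)\<^sup>2))\<bar> \<le> sqint b (\<lambda>x y. Mv * (t * (1 - t)))"
        by (intro sqint_abs_le cont2_lin c2)
      also have "\<dots> = C' * (t * (1 - t))" by (simp add: sqint_const b C'_def Box_def)
      finally have "2 * \<bar>D t\<bar> \<le> C' * (t * (1 - t))" by (simp add: D_def abs_divide)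
      thus ?thesis using abs_ge_zero[of "D t"] by linarith
    qed
    have Z1: "Z (1 / 3) \<le> 4 * Fm"
    proof (rule field_le_epsilon)
      fix \<epsilon> :: real assume \<epsilon>: "\<epsilon> > 0"
      define s where "s = min (1 / 3) (\<epsilon> / (C' + 1))"
      have s: "0 < s" "s \<le> 1 / 3" "s \<le> \<epsilon> / (C' + 1)"
        using divide_pos_pos[OF \<epsilon>, of "C' + 1"] C' unfolding s_def min_def by auto
      have "(C' + 1) * s \<le> \<epsilon>" using s C' by (simp add: field_simps)
      hence "C' * s \<le> \<epsilon>" using s by (simp add: distrib_right)
      moreover have "C' * (s * (1 - s)) \<le> C' * s" using s C' by (intro mult_left_mono) auto
      moreover have "s \<in> T" using s by (auto simp: T_def)
      moreover have "0 \<le> C3 * s" using nn s by simp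
      ultimately have "Z s \<le> \<epsilon> + 4 * Fm" using Dend[of s] Fb[of s] by (simp add: Z_def)
      thus "Z (1 / 3) \<le> 4 * Fm + \<epsilon>" using mono[of s "1 / 3"] s by simp
    qed
    have Z2: "- C3 \<le> Z (2 / 3)"
    proof (rule field_le_epsilon)
      fix \<epsilon> :: real assume \<epsilon>: "\<epsilon> > 0"
      define s where "s = min (1 / 3) (\<epsilon> / (C' + 1))"
      have s: "0 < s" "s \<le> 1 / 3" "s \<le> \<epsilon> / (C' + 1)"
        using divide_pos_pos[OF \<epsilon>, of "C' + 1"] C' unfolding s_def min_def by auto
      have "(C' + 1) * s \<le> \<epsilon>" using s C' by (simp add: field_simps)
      hence "C' * s \<le> \<epsilon>" using s by (simp add: distrib_right)
      moreover have "C' * ((1 - s) * (1 - (1 - s))) \<le> C' * s" using s C' by (intro mult_left_mono) auto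
      moreover have "1 - s \<in> T" using s by (auto simp: T_def)
      moreover have "C3 * (1 - s) \<le> C3 * 1" using nn s by (intro mult_left_mono) auto
      ultimately have "- C3 - \<epsilon> \<le> Z (1 - s)" using Dend[of "1 - s"] Fb[of "1 - s"] by (simp add: Z_def)
      thus "- C3 \<le> Z (2 / 3) + \<epsilon>" using mono[of "2 / 3" "1 - s"] s by simp
    qed
    have "\<exists>t. 1 / 3 < t \<and> t < 2 / 3 \<and> sqint b (w t) \<le> 3 * (C3 + 4 * Fm)"
    proof -
      have "\<forall>t\<in>T. \<exists>Z'. (Z has_real_derivative Z') (at t) \<and> Z' \<le> - sqint b (w t)" using dZ by blast
      then obtain Z' where Z': "\<And>t. t \<in> T \<Longrightarrow> (Z has_real_derivative Z' t) (at t)"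
        "\<And>t. t \<in> T \<Longrightarrow> Z' t \<le> - sqint b (w t)" by metis
      obtain t where t: "1 / 3 < t" "t < 2 / 3" "Z (2 / 3) - Z (1 / 3) = (2 / 3 - 1 / 3) * Z' t"
        using MVT2[of "1 / 3" "2 / 3" Z Z'] Z'(1) by (auto simp: T_def)
      have "t \<in> T" using t by (simp add: T_def)
      from Z'(2)[OF this] have "sqint b (w t) \<le> 3 * (C3 + 4 * Fm)" using t(3) Z1 Z2 by simp
      thus ?thesis using t by blast
    qed
    then obtain t where t: "1 / 3 < t" "t < 2 / 3" and wt: "sqint b (w t) \<le> 3 * (C3 + 4 * Fm)" by blast
    have tT: "t \<in> T" using t by (simp add: T_def)
    have th_le: "th t \<le> 9 / 2 * kk"
    proof -
      have "0 \<le> (t - 1 / 3) * (2 / 3 - t)" using t by simp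
      moreover have "(t - 1 / 3) * (2 / 3 - t) = t * (1 - t) - 2 / 9" by (simp add: field_simps)
      ultimately have p: "t * (1 - t) \<ge> 2 / 9" by linarith
      have "kk * (2 / 9) \<le> kk * (t * (1 - t))" using p kk by (intro mult_left_mono) auto
      thus ?thesis using p unfolding th_def weight_def by (simp add: divide_simps)
    qed
    define S where "S = exp (9 * kk * C0) / c\<^sup>2"
    have S: "S > 0" using c by (simp add: S_def)
    show "\<exists>t\<in>{1/3..2/3}. \<forall>P. cont2 P \<longrightarrow> (\<forall>x y. 0 \<le> P x y \<and> P x y \<le> (V t x y)\<^sup>2) \<longrightarrow>
        (\<forall>x y. \<rho>\<^sup>2 \<le> x\<^sup>2 + y\<^sup>2 \<longrightarrow> P x y = 0) \<longrightarrow> sqint b P \<le> C"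
    proof (rule bexI[of _ t], intro allI impI)
      fix P assume P: "cont2 P" "\<forall>x y. 0 \<le> P x y \<and> P x y \<le> (V t x y)\<^sup>2"
         "\<forall>x y. \<rho>\<^sup>2 \<le> x\<^sup>2 + y\<^sup>2 \<longrightarrow> P x y = 0"
      have "sqint b P \<le> sqint b (\<lambda>x y. S * w t x y)"
      proof (rule sqint_mono)
        fix x y assume x: "\<bar>x\<bar> \<le> b" and y: "\<bar>y\<bar> \<le> b"
        show "P x y \<le> S * w t x y"
        proof (cases "x\<^sup>2 + y\<^sup>2 < \<rho>\<^sup>2")
          case False
          thus ?thesis using P(3) S w0 by simp
        next
          case True
          have "th t * (- \<psi> x) \<le> 9 / 2 * kk * C0"
            using th_le xr(3,4)[OF x] th(1)[OF tT] kk by (intro mult_mono) auto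
          hence "1 \<le> exp (9 * kk * C0 + 2 * (th t * \<psi> x))" by simp
          also have "\<dots> = exp (9 * kk * C0) * (E t x)\<^sup>2"
            by (simp add: E_def exp_double[symmetric] exp_add)
          finally have "1 * (V t x y)\<^sup>2 \<le> exp (9 * kk * C0) * (E t x)\<^sup>2 * (V t x y)\<^sup>2"
            by (intro mult_right_mono) auto
          also have "\<dots> = S * w t x y"
            using inn[OF True, of t] c by (simp add: S_def w_def v_def power_mult_distrib)
          finally show ?thesis using P(2) by (metis mult_1 order_trans)
        qed
      qed (intro P cont2_lin cw)+
      also have "\<dots> = S * sqint b (w t)" by (rule sqint_cmult)
      also have "\<dots> \<le> S * (3 * (C3 + 4 * Fm))" using wt S by (intro mult_left_mono) auto
      also have "\<dots> = C" by (simp add: S_def C_def)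
      finally show "sqint b P \<le> C" .
    qed (use t in auto)
  qed
qed

section \<open>Boundedness of damped entire solutions\<close>

text \<open>
  A convex function of class \<open>C\<^sup>2\<close> that behaves like \<open>s\<^sup>3\<close> near \<open>0+\<close> and like \<open>s\<^sup>2\<close> at infinity; it is
  smooth enough for the energy identity and, unlike a cube, controlled by a mean square.
  \<open>soft_sq1\<close> and \<open>soft_sq2\<close> are its derivatives.
\<close>
definition soft_sq :: "real \<Rightarrow> real" where "soft_sq s = (max 0 s) ^ 3 / (1 + max 0 s)"
definition soft_sq1 :: "real \<Rightarrow> real" where
  "soft_sq1 s = (3 * (max 0 s)\<^sup>2 + 2 * (max 0 s) ^ 3) / (1 + max 0 s)\<^sup>2"
definition soft_sq2 :: "real \<Rightarrow> real" where
  "soft_sq2 s = (6 * max 0 s + 6 * (max 0 s)\<^sup>2 + 2 * (max 0 s) ^ 3) / (1 + max 0 s) ^ 3"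

lemma soft_sq_deriv:
  "(soft_sq has_real_derivative soft_sq1 s) (at s)" "(soft_sq1 has_real_derivative soft_sq2 s) (at s)"
proof -
  have 1: "((\<lambda>p. p ^ 3 / (1 + p)) has_real_derivative (3 * p\<^sup>2 + 2 * p ^ 3) / (1 + p)\<^sup>2) (at p)"
    if "p \<ge> 0" for p :: real
  proof -
    have nz: "1 + p \<noteq> 0" using that by simp
    have "((\<lambda>p. p ^ 3 / (1 + p)) has_real_derivative (3 * p\<^sup>2 * (1 + p) - p ^ 3 * 1) / ((1 + p) * (1 + p))) (at p)"
      by (rule DERIV_divide[where f="\<lambda>p. p ^ 3" and g="\<lambda>p. 1 + p"])
        (use nz in \<open>auto intro!: derivative_eq_intros\<close>)
    thus ?thesis by (rule DERIV_cong) (simp add: power2_eq_square power3_eq_cube algebra_simps)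
  qed
  show "(soft_sq has_real_derivative soft_sq1 s) (at s)"
    unfolding soft_sq_def[abs_def] soft_sq1_def
    by (rule pos_part_comp_deriv[where G="\<lambda>p. p ^ 3 / (1 + p)", OF 1]) auto
  have 2: "((\<lambda>p. (3 * p\<^sup>2 + 2 * p ^ 3) / (1 + p)\<^sup>2) has_real_derivative
      (6 * p + 6 * p\<^sup>2 + 2 * p ^ 3) / (1 + p) ^ 3) (at p)" if "p \<ge> 0" for p :: real
  proof -
    have nz: "(1 + p)\<^sup>2 \<noteq> 0" "1 + p \<noteq> 0" using that by simp_all
    have "((\<lambda>p. (3 * p\<^sup>2 + 2 * p ^ 3) / (1 + p)\<^sup>2) has_real_derivative
       ((6 * p + 6 * p\<^sup>2) * (1 + p)\<^sup>2 - (3 * p\<^sup>2 + 2 * p ^ 3) * (2 * (1 + p))) / ((1 + p)\<^sup>2 * (1 + p)\<^sup>2)) (at p)"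
      by (rule DERIV_divide[where f="\<lambda>p. 3 * p\<^sup>2 + 2 * p ^ 3" and g="\<lambda>p. (1 + p)\<^sup>2"])
        (use nz in \<open>auto intro!: derivative_eq_intros\<close>)
    moreover have "((6 * p + 6 * p\<^sup>2) * (1 + p)\<^sup>2 - (3 * p\<^sup>2 + 2 * p ^ 3) * (2 * (1 + p))) / ((1 + p)\<^sup>2 * (1 + p)\<^sup>2)
       = (6 * p + 6 * p\<^sup>2 + 2 * p ^ 3) / (1 + p) ^ 3"
      using nz by (simp add: divide_simps) (simp add: algebra_simps eval_nat_numeral)
    ultimately show ?thesis by simp
  qed
  show "(soft_sq1 has_real_derivative soft_sq2 s) (at s)"
    unfolding soft_sq1_def[abs_def] soft_sq2_def
    by (rule pos_part_comp_deriv[where G="\<lambda>p. (3 * p\<^sup>2 + 2 * p ^ 3) / (1 + p)\<^sup>2", OF 2]) auto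
qed

lemma soft_sq_cont: "continuous_on UNIV soft_sq" "continuous_on UNIV soft_sq1" "continuous_on UNIV soft_sq2"
proof -
  have "1 + max 0 s \<noteq> 0" for s :: real by (simp add: add_nonneg_eq_0_iff)
  thus "continuous_on UNIV soft_sq" "continuous_on UNIV soft_sq1" "continuous_on UNIV soft_sq2"
    unfolding soft_sq_def[abs_def] soft_sq1_def[abs_def] soft_sq2_def[abs_def]
    by (auto intro!: continuous_intros simp del: add_eq_0_iff)
qed

lemma soft_sq_facts:
  "s \<le> 0 \<Longrightarrow> soft_sq s = 0 \<and> soft_sq1 s = 0" "0 \<le> soft_sq s" "0 \<le> soft_sq1 s" "0 \<le> soft_sq2 s"
  "s > 0 \<Longrightarrow> soft_sq s > 0" "soft_sq s \<le> soft_sq1 s * s" "s \<ge> 0 \<Longrightarrow> soft_sq s \<le> s\<^sup>2"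
proof -
  show "soft_sq s \<le> soft_sq1 s * s"
  proof (cases "s \<ge> 0")
    case True
    have "0 \<le> s ^ 3 * (2 + s)" using True by simp
    thus ?thesis using True
      by (simp add: soft_sq_def soft_sq1_def divide_simps) (simp add: algebra_simps eval_nat_numeral)
  qed (simp add: soft_sq_def soft_sq1_def)
  show "soft_sq s \<le> s\<^sup>2" if "s \<ge> 0"
    using that by (simp add: soft_sq_def divide_simps) (simp add: algebra_simps eval_nat_numeral)
qed (auto simp: soft_sq_def soft_sq1_def soft_sq2_def)

lemma C12_time_shift:
  assumes "C12 UNIV V Vt Vx Vy Vxx Vxy Vyy"
  shows "C12 UNIV (\<lambda>t. V (t + a)) (\<lambda>t. Vt (t + a)) (\<lambda>t. Vx (t + a)) (\<lambda>t. Vy (t + a))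
    (\<lambda>t. Vxx (t + a)) (\<lambda>t. Vxy (t + a)) (\<lambda>t. Vyy (t + a))"
proof -
  have c: "cont3 UNIV (\<lambda>t. g (t + a))" if "cont3 UNIV g" for g
  proof -
    have "continuous_on UNIV (\<lambda>p :: real \<times> real \<times> real. (fst p + a, snd p))" by (intro continuous_intros)
    from continuous_on_compose2[of UNIV "\<lambda>(t, x, y). g t x y", OF _ this] that
    show ?thesis by (auto simp: case_prod_unfold)
  qed
  show ?thesis
    unfolding C12_def
  proof (intro conjI ballI allI)
    fix t x y
    show "((\<lambda>s. V (s + a) x y) has_real_derivative Vt (t + a) x y) (at t)"
      using C12_deriv(1)[OF assms, of "t + a"] by (simp add: DERIV_shift)
  qed (use C12_deriv[OF assms] C12_cont[OF assms] c in auto)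
qed

text \<open>
  The excess mass \<open>m(t) = \<integral> soft_sq (V - M)\<close> satisfies \<open>m' \<le> - lam m\<close>, hence \<open>m(T) \<le> exp (- lam n) m(T - n)\<close> up to
  a time shift of at most one unit. Observability bounds the right-hand factor uniformly in \<open>n\<close>, so
  \<open>m\<close> vanishes. Without such a bound a solution growing backward in time like \<open>exp (- lam t)\<close> or faster
  would be compatible with the decay.
\<close>
lemma bounded_above_of_damped:
  fixes K M \<rho> drift lam :: real
  assumes CV: "C12 UNIV V Vt Vx Vy Vxx Vxy Vyy" and K: "K \<ge> 0" and M: "M \<ge> 0" and \<rho>: "\<rho> > 0" and lam: "lam > 0"
    and eqn: "\<And>t x y. \<bar>Vt t x y - (Vxx t x y + Vyy t x y) - drift * Vy t x y\<bar> \<le> K * \<bar>V t x y\<bar>"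
    and far: "\<And>t x y. \<rho>\<^sup>2 \<le> x\<^sup>2 + y\<^sup>2 \<Longrightarrow> \<bar>V t x y\<bar> \<le> M"
    and dmp: "\<And>t x y. V t x y > M \<Longrightarrow>
       Vt t x y - (Vxx t x y + Vyy t x y) - drift * Vy t x y \<le> - lam * (V t x y - M)"
  shows "V T x0 y0 \<le> M"
proof -
  from observability[OF K M \<rho>, of drift] obtain b C where b: "\<rho> \<le> b"
    and obs: "\<And>V Vt Vx Vy Vxx Vxy Vyy. C12 UNIV V Vt Vx Vy Vxx Vxy Vyy \<Longrightarrow>
     (\<forall>t x y. \<bar>Vt t x y - (Vxx t x y + Vyy t x y) - drift * Vy t x y\<bar> \<le> K * \<bar>V t x y\<bar>) \<Longrightarrow>
     (\<forall>t x y. \<rho>\<^sup>2 \<le> x\<^sup>2 + y\<^sup>2 \<longrightarrow> \<bar>V t x y\<bar> \<le> M) \<Longrightarrow>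
     (\<exists>t\<in>{1/3..2/3}. \<forall>P. cont2 P \<longrightarrow> (\<forall>x y. 0 \<le> P x y \<and> P x y \<le> (V t x y)\<^sup>2) \<longrightarrow>
        (\<forall>x y. \<rho>\<^sup>2 \<le> x\<^sup>2 + y\<^sup>2 \<longrightarrow> P x y = 0) \<longrightarrow> sqint b P \<le> C)"
    by blast
  have b0: "b > 0" using b \<rho> by simp
  note dV = C12_deriv[OF CV UNIV_I] and c = C12_cont[OF CV]
  define P P1 P2 where "P = (\<lambda>t x y. soft_sq (V t x y - M))" and
    "P1 = (\<lambda>t x y. soft_sq1 (V t x y - M))" and "P2 = (\<lambda>t x y. soft_sq2 (V t x y - M))"
  have cP: "cont3 UNIV P" "cont3 UNIV P1" "cont3 UNIV P2"
    unfolding P_def P1_def P2_def case_prod_unfold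
    by (rule continuous_on_compose2[OF soft_sq_cont(1)] continuous_on_compose2[OF soft_sq_cont(2)]
          continuous_on_compose2[OF soft_sq_cont(3)],
        use c(1) in \<open>auto simp: case_prod_unfold intro!: continuous_intros\<close>)+
  note c2 = c[THEN cont3_cont2, OF UNIV_I] cP[THEN cont3_cont2, OF UNIV_I]
  have sh: "((\<lambda>s. g (h s - M)) has_real_derivative g' * h') (at z)"
    if "(h has_real_derivative h') (at z)" "(g has_real_derivative g') (at (h z - M))" for g h g' h' z
    by (rule DERIV_chain2[where f=g and g="\<lambda>s. h s - M", OF that(2)])
       (use that(1) in \<open>auto intro!: derivative_eq_intros\<close>)
  have dPt: "((\<lambda>s. P s x y) has_real_derivative P1 t x y * Vt t x y) (at t)" for t x y
    unfolding P_def P1_def by (rule sh[OF dV(1) soft_sq_deriv(1)])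
  have dPy: "((\<lambda>s. P t x s) has_real_derivative P1 t x y * Vy t x y) (at y)" for t x y
    unfolding P_def P1_def by (rule sh[OF dV(3) soft_sq_deriv(1)])
  have dP1x: "((\<lambda>s. P1 t s y) has_real_derivative P2 t x y * Vx t x y) (at x)" for t x y
    unfolding P1_def P2_def by (rule sh[OF dV(2) soft_sq_deriv(2)])
  have dP1y: "((\<lambda>s. P1 t x s) has_real_derivative P2 t x y * Vy t x y) (at y)" for t x y
    unfolding P1_def P2_def by (rule sh[OF dV(3) soft_sq_deriv(2)])
  have zero: "P t x y = 0 \<and> P1 t x y = 0" if "\<rho>\<^sup>2 \<le> x\<^sup>2 + y\<^sup>2" for t x y
    using far[OF that, of t] soft_sq_facts(1)[of "V t x y - M"] by (simp add: P_def P1_def abs_le_iff)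
  have bb: "\<rho>\<^sup>2 \<le> b\<^sup>2" using b \<rho> by (intro power_mono) auto
  have zb: "P t x y = 0 \<and> P1 t x y = 0" if "x = b \<or> x = - b \<or> y = b \<or> y = - b" for t x y
  proof (rule zero)
    have "b\<^sup>2 \<le> x\<^sup>2 \<or> b\<^sup>2 \<le> y\<^sup>2" using that by auto
    thus "\<rho>\<^sup>2 \<le> x\<^sup>2 + y\<^sup>2" using bb zero_le_power2[of x] zero_le_power2[of y] by linarith
  qed
  define m where "m = (\<lambda>t. sqint b (P t))"
  have m0: "m t \<ge> 0" for t
    unfolding m_def by (intro sqint_nonneg c2) (simp add: P_def soft_sq_facts)
  have dm: "\<exists>m'. (m has_real_derivative m') (at t) \<and> m' \<le> - lam * m t" for t
  proof (intro exI conjI)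
    show "(m has_real_derivative sqint b (\<lambda>x y. P1 t x y * Vt t x y)) (at t)"
      unfolding m_def
      by (rule sqint_derivative[where T=UNIV and ut="\<lambda>t x y. P1 t x y * Vt t x y"])
         (intro open_UNIV UNIV_I cont3_lin c cP dPt)+
    define X where "X = (\<lambda>x y. P2 t x y * (Vx t x y)\<^sup>2 + P1 t x y * Vxx t x y)"
    define Y where "Y = (\<lambda>x y. P2 t x y * (Vy t x y)\<^sup>2 + P1 t x y * Vyy t x y + drift * (P1 t x y * Vy t x y))"
    define Z where "Z = (\<lambda>x y. P1 t x y * (Vt t x y - (Vxx t x y + Vyy t x y) - drift * Vy t x y)
       - P2 t x y * ((Vx t x y)\<^sup>2 + (Vy t x y)\<^sup>2))"
    have cX: "cont2 X" unfolding X_def by (intro cont2_lin c2)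
    have cY: "cont2 Y" unfolding Y_def by (intro cont2_lin c2)
    have cZ: "cont2 Z" unfolding Z_def by (intro cont2_lin c2)
    have X0: "sqint b X = 0"
    proof (rule sqint_dx[OF cX])
      show "((\<lambda>s. P1 t s y * Vx t s y) has_real_derivative X x y) (at x)" for x y
        unfolding X_def
        by (rule DERIV_cong[OF DERIV_mult[OF dP1x dV(4)]]) (simp add: power2_eq_square algebra_simps)
    qed (use zb b0 in auto)
    have Y0: "sqint b Y = 0"
    proof (rule sqint_dy[OF cY])
      show "((\<lambda>s. P1 t x s * Vy t x s + drift * P t x s) has_real_derivative Y x y) (at y)" for x y
        unfolding Y_def
        by (rule DERIV_cong[OF DERIV_add[OF DERIV_mult[OF dP1y dV(7)] DERIV_cmult[OF dPy]]])
           (simp add: power2_eq_square algebra_simps)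
    qed (use zb b0 in auto)
    have eq: "(\<lambda>x y. P1 t x y * Vt t x y) = (\<lambda>x y. (X x y + Y x y) + Z x y)"
      by (intro ext) (simp add: X_def Y_def Z_def algebra_simps)
    have "sqint b (\<lambda>x y. P1 t x y * Vt t x y) = sqint b Z"
      unfolding eq by (simp add: sqint_add cont2_bin cX cY cZ X0 Y0)
    also have "\<dots> \<le> sqint b (\<lambda>x y. - lam * P t x y)"
    proof (rule sqint_mono[OF cZ])
      fix x y
      have "P1 t x y * (Vt t x y - (Vxx t x y + Vyy t x y) - drift * Vy t x y) \<le> - lam * P t x y"
      proof (cases "V t x y > M")
        case True
        have "P1 t x y * (Vt t x y - (Vxx t x y + Vyy t x y) - drift * Vy t x y)
            \<le> P1 t x y * (- lam * (V t x y - M))"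
          using dmp[OF True] by (intro mult_left_mono) (simp_all add: P1_def soft_sq_facts)
        also have "\<dots> = - lam * (P1 t x y * (V t x y - M))" by simp
        also have "\<dots> \<le> - lam * P t x y"
          using lam soft_sq_facts(6)[of "V t x y - M"] by (simp add: P_def P1_def)
        finally show ?thesis .
      qed (simp add: P_def P1_def soft_sq_facts)
      moreover have "0 \<le> P2 t x y * ((Vx t x y)\<^sup>2 + (Vy t x y)\<^sup>2)"
        by (simp add: P2_def soft_sq_facts)
      ultimately show "Z x y \<le> - lam * P t x y" unfolding Z_def by linarith
    qed (intro cont2_lin c2)
    also have "\<dots> = - lam * m t" unfolding m_def by (rule sqint_cmult)
    finally show "sqint b (\<lambda>x y. P1 t x y * Vt t x y) \<le> - lam * m t" .
  qed
  have decay: "m t * exp (lam * t) \<le> m s * exp (lam * s)" if "s \<le> t" for s t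
  proof (rule DERIV_nonpos_imp_nonincreasing[OF that])
    fix z
    obtain m' where m': "(m has_real_derivative m') (at z)" "m' \<le> - lam * m z" using dm by blast
    have "((\<lambda>t. m t * exp (lam * t)) has_real_derivative (m' + lam * m z) * exp (lam * z)) (at z)"
      by (rule derivative_eq_intros m' refl)+ (simp add: algebra_simps)
    moreover have "(m' + lam * m z) * exp (lam * z) \<le> 0"
      using m'(2) by (intro mult_nonpos_nonneg) auto
    ultimately show "\<exists>d. ((\<lambda>t. m t * exp (lam * t)) has_real_derivative d) (at z) \<and> d \<le> 0" by blast
  qed
  have bound: "m T * exp (lam * n) \<le> C" if n: "n \<ge> 0" for n
  proof -
    \<comment> \<open>observation on the unit interval that ends at \<open>T - n\<close>\<close>
    define a where "a = T - 1 - n"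
    obtain t where t: "t \<in> {1/3..2/3}" and Q: "\<And>Q. cont2 Q \<Longrightarrow> (\<forall>x y. 0 \<le> Q x y \<and> Q x y \<le> (V (t + a) x y)\<^sup>2) \<Longrightarrow>
        (\<forall>x y. \<rho>\<^sup>2 \<le> x\<^sup>2 + y\<^sup>2 \<longrightarrow> Q x y = 0) \<Longrightarrow> sqint b Q \<le> C"
      using obs[OF C12_time_shift[OF CV, of a]] eqn far by blast
    have "m (t + a) \<le> C"
      unfolding m_def
    proof (rule Q)
      show "\<forall>x y. 0 \<le> P (t + a) x y \<and> P (t + a) x y \<le> (V (t + a) x y)\<^sup>2"
      proof (intro allI conjI)
        fix x y
        show "0 \<le> P (t + a) x y" by (simp add: P_def soft_sq_facts)
        show "P (t + a) x y \<le> (V (t + a) x y)\<^sup>2"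
        proof (cases "V (t + a) x y \<ge> M")
          case True
          have "P (t + a) x y \<le> (V (t + a) x y - M)\<^sup>2"
            unfolding P_def using True by (intro soft_sq_facts) simp
          also have "\<dots> \<le> (V (t + a) x y)\<^sup>2" using True M by (intro power_mono) auto
          finally show ?thesis .
        next
          case False
          hence "P (t + a) x y = 0" using soft_sq_facts(1) by (simp add: P_def)
          thus ?thesis by simp
        qed
      qed
    qed (use c2 zero in auto)
    moreover have "m T * exp (lam * T) \<le> m (t + a) * exp (lam * (t + a))"
      using t n by (intro decay) (auto simp: a_def)
    moreover have "m (t + a) * exp (lam * (t + a)) \<le> m (t + a) * exp (lam * (T - n))"
      using t lam m0 by (intro mult_left_mono) (auto simp: a_def)
    ultimately have "m T * exp (lam * T) \<le> C * exp (lam * (T - n))"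
      by (meson exp_ge_zero mult_right_mono order_trans)
    hence "m T * exp (lam * T) * exp (- lam * (T - n)) \<le> C * exp (lam * (T - n)) * exp (- lam * (T - n))"
      by (intro mult_right_mono) auto
    thus ?thesis by (simp add: mult.assoc exp_add[symmetric] algebra_simps)
  qed
  have "m T = 0"
  proof (rule ccontr)
    assume "m T \<noteq> 0"
    hence mp: "m T > 0" using m0[of T] by simp
    have C: "C \<ge> 0" using bound[of 0] mp by simp
    define n where "n = C / (m T * lam)"
    have "n \<ge> 0" using C mp lam by (simp add: n_def)
    have "m T * (1 + lam * n) \<le> m T * exp (lam * n)" using mp by (intro mult_left_mono) auto
    also have "\<dots> \<le> C" by (rule bound) fact
    finally have "m T + C \<le> C" using mp lam by (simp add: n_def algebra_simps)
    thus False using mp by simp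
  qed
  show ?thesis
  proof (cases "\<bar>x0\<bar> \<le> b \<and> \<bar>y0\<bar> \<le> b")
    case True
    have "P T x0 y0 = 0"
      by (rule sqint_zero_imp[OF c2(8) _ _ b0]) (use \<open>m T = 0\<close> True in \<open>auto simp: m_def P_def soft_sq_facts\<close>)
    thus ?thesis using soft_sq_facts(5)[of "V T x0 y0 - M"] by (force simp: P_def)
  next
    case False
    hence "b\<^sup>2 \<le> x0\<^sup>2 \<or> b\<^sup>2 \<le> y0\<^sup>2" using b0 by (auto simp: abs_le_square_iff[symmetric])
    hence "\<rho>\<^sup>2 \<le> x0\<^sup>2 + y0\<^sup>2" using bb zero_le_power2[of x0] zero_le_power2[of y0] by linarith
    from far[OF this, of T] show ?thesis by (simp add: abs_le_iff)
  qed
qed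

text \<open>
  The chain rule along a moving point, where only one of the two partial derivatives is assumed to be
  continuous.
\<close>
lemma moving_derivative:
  assumes ut: "((\<lambda>s. u s y) has_real_derivative ut) (at t)"
    and uy: "\<And>s y. ((\<lambda>y. u s y) has_real_derivative uy s y) (at y)"
    and c: "continuous_on UNIV (\<lambda>(s, y). uy s y)" and y: "y = y0 + v * t"
  shows "((\<lambda>s. u s (y0 + v * s)) has_real_derivative ut + v * uy t y) (at t)"
proof -
  have "((\<lambda>(s, y). u s y) has_derivative (\<lambda>(hs, hy). ut * hs + blinfun_apply (blinfun_mult_right (uy t y)) hy))
      (at (t, y) within UNIV \<times> UNIV)"
  proof (rule has_derivative_partialsI)
    show "((\<lambda>s. u s y) has_derivative (\<lambda>hs. ut * hs)) (at t within UNIV)"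
      using ut by (simp add: has_field_derivative_def)
    show "(u s has_derivative blinfun_apply (blinfun_mult_right (uy s y))) (at y within UNIV)" for s y
      using uy[of s y] by (simp add: has_field_derivative_def)
    have "continuous_on UNIV (\<lambda>p. blinfun_mult_right (case p of (s, y) \<Rightarrow> uy s y))"
      by (intro continuous_intros c)
    thus "continuous (at (t, y) within UNIV \<times> UNIV) (\<lambda>(s, y). blinfun_mult_right (uy s y))"
      by (simp add: continuous_on_eq_continuous_at case_prod_unfold)
  qed auto
  hence d: "((\<lambda>(s, y). u s y) has_derivative (\<lambda>(hs, hy). ut * hs + uy t y * hy)) (at (t, y0 + v * t))"
    by (simp add: y)
  have "((\<lambda>s. (s, y0 + v * s)) has_derivative (\<lambda>h. (h, v * h))) (at t)"
    by (auto intro!: derivative_eq_intros)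
  from has_derivative_compose[OF this d]
  have "((\<lambda>s. u s (y0 + v * s)) has_derivative (\<lambda>h. ut * h + uy t y * (v * h))) (at t)" by simp
  moreover have "(\<lambda>h. ut * h + uy t y * (v * h)) = (*) (ut + v * uy t y)"
    by (intro ext) (simp add: algebra_simps)
  ultimately show ?thesis by (simp add: has_field_derivative_def)
qed

lemma C12_moving:
  assumes V: "C12 UNIV V Vt Vx Vy Vxx Vxy Vyy"
  shows "C12 UNIV (\<lambda>t x y. V t x (y + v * t)) (\<lambda>t x y. Vt t x (y + v * t) + v * Vy t x (y + v * t))
    (\<lambda>t x y. Vx t x (y + v * t)) (\<lambda>t x y. Vy t x (y + v * t))
    (\<lambda>t x y. Vxx t x (y + v * t)) (\<lambda>t x y. Vxy t x (y + v * t)) (\<lambda>t x y. Vyy t x (y + v * t))"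
proof -
  note d = C12_deriv[OF V UNIV_I] and c = C12_cont[OF V]
  have cm: "cont3 UNIV (\<lambda>t x y. g t x (y + v * t))" if "cont3 UNIV g" for g
  proof -
    have "continuous_on UNIV (\<lambda>p :: real \<times> real \<times> real. (fst p, fst (snd p), snd (snd p) + v * fst p))"
      by (intro continuous_intros)
    from continuous_on_compose2[of UNIV "\<lambda>(t, x, y). g t x y", OF _ this] that
    show ?thesis by (auto simp: case_prod_unfold)
  qed
  have cs: "cont3 UNIV (\<lambda>t x y. Vt t x (y + v * t) + v * Vy t x (y + v * t))"
    by (intro cont3_lin cm c)
  have sh: "((\<lambda>s. g (s + a)) has_real_derivative D) (at z)" if "(g has_real_derivative D) (at (z + a))" for g D z a
    using that by (simp add: DERIV_shift)
  show ?thesis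
    unfolding C12_def
  proof (intro conjI ballI allI)
    fix t x y :: real
    have "continuous_on UNIV (\<lambda>p :: real \<times> real. (fst p, x, snd p))" by (intro continuous_intros)
    from continuous_on_compose2[of UNIV "\<lambda>(t, x, y). Vy t x y", OF _ this] c(4)
    have cy: "continuous_on UNIV (\<lambda>(s, y). Vy s x y)" by (auto simp: case_prod_unfold)
    show "((\<lambda>s. V s x (y + v * s)) has_real_derivative Vt t x (y + v * t) + v * Vy t x (y + v * t)) (at t)"
      by (rule moving_derivative[OF d(1) d(3) cy refl])
    show "((\<lambda>s. V t x (s + v * t)) has_real_derivative Vy t x (y + v * t)) (at y)"
      by (rule sh[OF d(3)])
    show "((\<lambda>s. Vx t x (s + v * t)) has_real_derivative Vxy t x (y + v * t)) (at y)"
      by (rule sh[OF d(5)])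
    show "((\<lambda>s. Vy t x (s + v * t)) has_real_derivative Vyy t x (y + v * t)) (at y)"
      by (rule sh[OF d(7)])
  qed (use d c cm cs in auto)
qed

section \<open>Comparison and sliding for bistable equations\<close>

text \<open>
  Dissipativity is assumed in the integrated form in which the maximum principle uses it: an ordered
  pair of values on the same stable side. It extends to values outside \<open>[0,1]\<close>, which confines bounded
  solutions to \<open>[0,1]\<close>.
\<close>
locale bistable =
  fixes f :: "real \<Rightarrow> real \<Rightarrow> real \<Rightarrow> real" and K lam \<sigma> :: real
  assumes f0: "f x y 0 = 0" and f1: "f x y 1 = 0"
    and K: "K > 0" and lip: "\<bar>f x y u - f x y v\<bar> \<le> K * \<bar>u - v\<bar>"
    and lam: "lam > 0" and sig: "0 < \<sigma>" "\<sigma> < 1 / 2"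
    and diss: "v < u \<Longrightarrow> u \<le> \<sigma> \<or> 1 - \<sigma> \<le> v \<Longrightarrow> f x y u - f x y v \<le> - lam * (u - v)"
begin

definition sol :: "(real \<Rightarrow> real \<Rightarrow> real \<Rightarrow> real) \<Rightarrow> bool" where
  "sol u \<longleftrightarrow> jcont u \<and> (\<forall>t x y. has_heat u t x y (f x y (u t x y)))"

definition sol01 :: "(real \<Rightarrow> real \<Rightarrow> real \<Rightarrow> real) \<Rightarrow> bool" where
  "sol01 u \<longleftrightarrow> sol u \<and> (\<forall>t x y. 0 \<le> u t x y \<and> u t x y \<le> 1)"

lemma sol01D:
  assumes "sol01 u"
  shows "jcont u" "has_heat u t x y (f x y (u t x y))" "0 \<le> u t x y" "u t x y \<le> 1"
    "\<bar>u t x y\<bar> \<le> 1" "\<bar>f x y (u t x y)\<bar> \<le> K"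
proof -
  show 1: "jcont u" "has_heat u t x y (f x y (u t x y))" "0 \<le> u t x y" "u t x y \<le> 1"
    using assms by (auto simp: sol01_def sol_def)
  show "\<bar>u t x y\<bar> \<le> 1" using 1 by simp
  have "K * u t x y \<le> K * 1" using 1 K by (intro mult_left_mono) auto
  thus "\<bar>f x y (u t x y)\<bar> \<le> K" using lip[of x y "u t x y" 0] f0[of x y] 1 by simp
qed

lemma sol01_shift: "sol01 u \<Longrightarrow> sol01 (\<lambda>t. u (t + a))"
  unfolding sol01_def sol_def
proof safe
  assume c: "jcont u" and h: "\<forall>t x y. has_heat u t x y (f x y (u t x y))"
  show "jcont (\<lambda>t. u (t + a))"
    unfolding case_prod_beta by (intro jcont_compose[OF c] continuous_intros)
  fix t x y show "has_heat (\<lambda>t. u (t + a)) t x y (f x y (u (t + a) x y))"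
    using has_heat_shift[of u t a x 0 y 0] h by simp
qed auto

lemma bounded_sol_in_unit_interval:
  assumes u: "sol u" and M: "\<And>t x y. \<bar>u t x y\<bar> \<le> M"
  shows "sol01 u"
proof -
  have c: "jcont u" and h: "\<And>t x y. has_heat u t x y (f x y (u t x y))" using u by (auto simp: sol_def)
  have one: "has_heat (\<lambda>t x y. 1) t x y 0" for t x y
    by (rule has_heatI[where a=0 and b=0 and d=0 and ux="\<lambda>_. 0" and uy="\<lambda>_. 0"]) auto
  have "u t x y - 1 \<le> 0" for t x y
  proof (rule max_principle[where w="\<lambda>t x y. u t x y - 1" and G=UNIV and lam=lam and B=M and t=t and x=x and y=y])
    show "jcont (\<lambda>t x y. u t x y - 1)" using c by (auto simp: case_prod_unfold intro!: continuous_intros)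
    show "u t x y - 1 \<le> M" for t x y using M[of t x y] by simp
    fix t x y assume "u t x y - 1 > 0"
    hence "f x y (u t x y) - 0 \<le> - lam * (u t x y - 1)"
      using diss[of 1 "u t x y" x y] f1 sig by simp
    thus "(t, x, y) \<in> interior UNIV \<and> (\<exists>H. has_heat (\<lambda>t x y. u t x y - 1) t x y H \<and> H \<le> - lam * (u t x y - 1))"
      using has_heat_diff[OF h one, of t x y] by auto
  qed (use lam in auto)
  moreover have "- u t x y \<le> 0" for t x y
  proof (rule max_principle[where w="\<lambda>t x y. - u t x y" and G=UNIV and lam=lam and B=M and t=t and x=x and y=y])
    show "jcont (\<lambda>t x y. - u t x y)" using c by (auto simp: case_prod_unfold intro!: continuous_intros)
    show "- u t x y \<le> M" for t x y using M[of t x y] by simp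
    fix t x y assume "- u t x y > 0"
    hence "- f x y (u t x y) \<le> - lam * (- u t x y)"
      using diss[of "u t x y" 0 x y] f0 sig by simp
    thus "(t, x, y) \<in> interior UNIV \<and> (\<exists>H. has_heat (\<lambda>t x y. - u t x y) t x y H \<and> H \<le> - lam * (- u t x y))"
      using has_heat_minus[OF h, of t x y] by auto
  qed (use lam in auto)
  ultimately show ?thesis using u by (auto simp: sol01_def)
qed

text \<open>
  If \<open>u > v\<close> at some point, one of the first two alternatives holds there, and both values are on the
  same stable side.
\<close>
lemma comparison:
  assumes u: "sol01 u" and v: "sol01 v"
    and "\<And>t x y. u t x y \<le> \<sigma> \<or> 1 - \<sigma> \<le> v t x y \<or> u t x y \<le> v t x y"
  shows "u t x y \<le> v t x y"
proof -
  have "u t x y - v t x y \<le> 0"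
  proof (rule max_principle[where w="\<lambda>t x y. u t x y - v t x y" and G=UNIV and lam=lam and B=1 and t=t and x=x and y=y])
    show "jcont (\<lambda>t x y. u t x y - v t x y)"
      using sol01D(1)[OF u] sol01D(1)[OF v] by (auto simp: case_prod_unfold intro!: continuous_intros)
    show "u t x y - v t x y \<le> 1" for t x y using sol01D(4)[OF u, of t x y] sol01D(3)[OF v, of t x y] by simp
    fix t x y assume "u t x y - v t x y > 0"
    hence "f x y (u t x y) - f x y (v t x y) \<le> - lam * (u t x y - v t x y)"
      using assms(3)[of t x y] by (intro diss) auto
    thus "(t, x, y) \<in> interior UNIV \<and> (\<exists>H. has_heat (\<lambda>t x y. u t x y - v t x y) t x y H \<and> H \<le> - lam * (u t x y - v t x y))"
      using has_heat_diff[OF sol01D(2)[OF u] sol01D(2)[OF v], of t x y] by auto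
  qed (use lam in auto)
  thus ?thesis by simp
qed

lemma sol01_time_modulus:
  assumes "sol01 u" "e > 0"
  shows "\<exists>h>0. \<forall>t s x y. \<bar>t - s\<bar> \<le> h \<longrightarrow> \<bar>u t x y - u s x y\<bar> \<le> e"
  by (rule time_modulus[OF sol01D(1,2,5,6)[OF assms(1)] assms(2)])

lemma sol01_lipschitz:
  assumes "sol01 u"
  shows "\<bar>u t x1 y1 - u t x2 y2\<bar> \<le> (K + 3) * (\<bar>x1 - x2\<bar> + \<bar>y1 - y2\<bar>)"
  using space_lipschitz[OF sol01D(1,2,5,6)[OF assms], of t x1 y1 x2 y2] by (simp add: algebra_simps)

text \<open>
  The difference of two ordered solutions is a nonnegative supersolution of \<open>w\<^sub>t - \<Delta>w = - K w\<close>. A gap at a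
  point persists on a disc by the Lipschitz bound, and the lower barrier does the rest. The constant
  is independent of the solutions, which stands in for compactness.
\<close>
lemma gap_propagates:
  assumes \<delta>: "\<delta> > 0" and \<rho>: "\<rho> > 0" and T1: "T1 > 0"
  shows "\<exists>\<epsilon>>0. \<forall>u v t1 x1 y1 t x y. sol01 u \<longrightarrow> sol01 v \<longrightarrow> (\<forall>t x y. u t x y \<le> v t x y) \<longrightarrow>
     \<delta> \<le> v t1 x1 y1 - u t1 x1 y1 \<longrightarrow> T1 \<le> t - t1 \<longrightarrow> t - t1 \<le> T2 \<longrightarrow>
     (x - x1)\<^sup>2 + (y - y1)\<^sup>2 \<le> \<rho>\<^sup>2 \<longrightarrow> \<epsilon> \<le> v t x y - u t x y"
proof -
  define N where "N = K + 3"
  have N: "N > 0" using K by (simp add: N_def)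
  define r where "r = \<delta> / (8 * N)"
  have r: "r > 0" using \<delta> N by (simp add: r_def)
  have d2: "\<delta> / 2 > 0" using \<delta> by simp
  obtain \<epsilon> where \<epsilon>: "\<epsilon> > 0" and B: "\<And>w t1 x1 y1 t x y.
     jcont w \<Longrightarrow> (\<forall>t x y. 0 \<le> w t x y) \<Longrightarrow>
     (\<forall>t x y. \<exists>H. has_heat w t x y H \<and> - K * w t x y \<le> H) \<Longrightarrow>
     (\<forall>x y. (x - x1)\<^sup>2 + (y - y1)\<^sup>2 \<le> r\<^sup>2 \<longrightarrow> \<delta> / 2 \<le> w t1 x y) \<Longrightarrow>
     T1 \<le> t - t1 \<Longrightarrow> t - t1 \<le> T2 \<Longrightarrow> (x - x1)\<^sup>2 + (y - y1)\<^sup>2 \<le> \<rho>\<^sup>2 \<Longrightarrow> \<epsilon> \<le> w t x y"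
    using lower_barrier[OF K r d2 \<rho> T1, of T2] by blast
  show ?thesis
  proof (intro exI[of _ \<epsilon>] conjI allI impI \<epsilon>)
    fix u v t1 x1 y1 t x y
    assume u: "sol01 u" and v: "sol01 v" and le: "\<forall>t x y. u t x y \<le> v t x y"
      and \<delta>1: "\<delta> \<le> v t1 x1 y1 - u t1 x1 y1"
      and t: "T1 \<le> t - t1" "t - t1 \<le> T2" and z: "(x - x1)\<^sup>2 + (y - y1)\<^sup>2 \<le> \<rho>\<^sup>2"
    show "\<epsilon> \<le> v t x y - u t x y"
    proof (rule B[where w="\<lambda>t x y. v t x y - u t x y", OF _ _ _ _ t z])
      show "jcont (\<lambda>t x y. v t x y - u t x y)"
        using sol01D(1)[OF u] sol01D(1)[OF v] by (auto simp: case_prod_unfold intro!: continuous_intros)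
      show "\<forall>t x y. 0 \<le> v t x y - u t x y" using le by simp
      show "\<forall>t x y. \<exists>H. has_heat (\<lambda>t x y. v t x y - u t x y) t x y H \<and> - K * (v t x y - u t x y) \<le> H"
      proof (intro allI exI conjI)
        fix t x y
        show "has_heat (\<lambda>t x y. v t x y - u t x y) t x y (f x y (v t x y) - f x y (u t x y))"
          by (intro has_heat_diff sol01D u v)
        show "- K * (v t x y - u t x y) \<le> f x y (v t x y) - f x y (u t x y)"
          using lip[of x y "v t x y" "u t x y"] le[rule_format, of t x y] by (simp add: abs_le_iff)
      qed
      show "\<forall>x y. (x - x1)\<^sup>2 + (y - y1)\<^sup>2 \<le> r\<^sup>2 \<longrightarrow> \<delta> / 2 \<le> v t1 x y - u t1 x y"
      proof (intro allI impI)
        fix x y assume xy: "(x - x1)\<^sup>2 + (y - y1)\<^sup>2 \<le> r\<^sup>2"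
        have "(x - x1)\<^sup>2 \<le> r\<^sup>2" "(y - y1)\<^sup>2 \<le> r\<^sup>2"
          using xy zero_le_power2[of "x - x1"] zero_le_power2[of "y - y1"] by linarith+
        hence "\<bar>x - x1\<bar> \<le> r" "\<bar>y - y1\<bar> \<le> r" using r by (auto simp: abs_le_square_iff[symmetric])
        hence "N * (\<bar>x - x1\<bar> + \<bar>y - y1\<bar>) \<le> N * (2 * r)" using N by (intro mult_left_mono) auto
        also have "\<dots> = \<delta> / 4" using N by (simp add: r_def field_simps)
        finally show "\<delta> / 2 \<le> v t1 x y - u t1 x y"
          using sol01_lipschitz[OF u, of t1 x y x1 y1] sol01_lipschitz[OF v, of t1 x y x1 y1] \<delta>1
          unfolding N_def[symmetric] by linarith
      qed
    qed
  qed
qed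

text \<open>
  The set of admissible thresholds is closed by continuity, and \<open>step\<close> says that it is open from the
  left away from 0.
\<close>
lemma sliding:
  assumes u: "sol01 u" and v: "sol01 v"
    and start: "\<And>\<tau> t x y. \<tau> \<ge> \<tau>s \<Longrightarrow> u t x y \<le> \<sigma> \<or> 1 - \<sigma> \<le> v (t + \<kappa> * \<tau>) x y"
    and step: "\<And>\<tau>1. \<tau>1 > 0 \<Longrightarrow> (\<And>\<tau> t x y. \<tau> \<ge> \<tau>1 \<Longrightarrow> u t x y \<le> v (t + \<kappa> * \<tau>) x y) \<Longrightarrow>
       \<exists>h>0. \<forall>\<tau> t x y. 0 \<le> \<tau> \<longrightarrow> \<tau>1 - h \<le> \<tau> \<longrightarrow> \<tau> \<le> \<tau>1 \<longrightarrow>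
         u t x y \<le> \<sigma> \<or> 1 - \<sigma> \<le> v (t + \<kappa> * \<tau>) x y \<or> u t x y \<le> v (t + \<kappa> * \<tau>) x y"
    and \<tau>: "\<tau> \<ge> 0"
  shows "u t x y \<le> v (t + \<kappa> * \<tau>) x y"
proof -
  define A where "A = {a. a \<ge> 0 \<and> (\<forall>\<tau>\<ge>a. \<forall>t x y. u t x y \<le> v (t + \<kappa> * \<tau>) x y)}"
  have "u t x y \<le> v (t + \<kappa> * \<tau>) x y" if "\<tau> \<ge> max 0 \<tau>s" for \<tau> t x y
  proof (rule comparison[OF u sol01_shift[OF v]])
    show "u t x y \<le> \<sigma> \<or> 1 - \<sigma> \<le> v (t + \<kappa> * \<tau>) x y \<or> u t x y \<le> v (t + \<kappa> * \<tau>) x y" for t x y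
      using start[of \<tau> t x y] that by auto
  qed
  hence "max 0 \<tau>s \<in> A" by (simp add: A_def)
  hence ne: "A \<noteq> {}" by auto
  have bd: "bdd_below A" by (auto simp: A_def intro!: bdd_belowI[of _ 0])
  define a where "a = Inf A"
  have a0: "a \<ge> 0" unfolding a_def by (rule cInf_greatest[OF ne]) (auto simp: A_def)
  have above: "u t x y \<le> v (t + \<kappa> * \<tau>) x y" if lt: "\<tau> > a" for \<tau> t x y
  proof -
    obtain a' where "a' \<in> A" "a' < \<tau>" using cInf_lessD[OF ne lt[unfolded a_def]] by blast
    thus ?thesis by (auto simp: A_def)
  qed
  have at: "u t x y \<le> v (t + \<kappa> * a) x y" for t x y
  proof (rule tendsto_lowerbound)
    have "continuous_on UNIV (\<lambda>s. v (t + \<kappa> * s) x y)"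
      by (intro jcont_compose[OF sol01D(1)[OF v]] continuous_intros)
    hence "isCont (\<lambda>s. v (t + \<kappa> * s) x y) a" by (simp add: continuous_on_eq_continuous_at)
    thus "((\<lambda>s. v (t + \<kappa> * s) x y) \<longlongrightarrow> v (t + \<kappa> * a) x y) (at_right a)"
      by (auto simp: isCont_def intro: tendsto_mono[OF at_le])
    show "\<forall>\<^sub>F s in at_right a. u t x y \<le> v (t + \<kappa> * s) x y"
      using above by (auto simp: eventually_at_right_field intro!: exI[of _ "a + 1"])
  qed simp
  have upto: "u t x y \<le> v (t + \<kappa> * \<tau>) x y" if "\<tau> \<ge> a" for \<tau> t x y
    using above[of \<tau>] at that by (cases "\<tau> = a") auto
  have "a = 0"
  proof (rule ccontr)
    assume "a \<noteq> 0"
    hence ap: "a > 0" using a0 by simp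
    from step[OF ap upto] obtain h where h: "h > 0" and H: "\<And>\<tau> t x y. 0 \<le> \<tau> \<Longrightarrow> a - h \<le> \<tau> \<Longrightarrow> \<tau> \<le> a \<Longrightarrow>
         u t x y \<le> \<sigma> \<or> 1 - \<sigma> \<le> v (t + \<kappa> * \<tau>) x y \<or> u t x y \<le> v (t + \<kappa> * \<tau>) x y" by blast
    define a' where "a' = max 0 (a - h)"
    have "a' \<in> A"
    proof -
      have "u t x y \<le> v (t + \<kappa> * \<tau>) x y" if "\<tau> \<ge> a'" for \<tau> t x y
      proof (cases "\<tau> \<ge> a")
        case False
        show ?thesis
        proof (rule comparison[OF u sol01_shift[OF v]])
          show "u t x y \<le> \<sigma> \<or> 1 - \<sigma> \<le> v (t + \<kappa> * \<tau>) x y \<or> u t x y \<le> v (t + \<kappa> * \<tau>) x y" for t x y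
            by (rule H) (use that False in \<open>simp_all add: a'_def\<close>)
        qed
      qed (rule upto)
      thus ?thesis by (simp add: A_def a'_def)
    qed
    hence "a \<le> a'" unfolding a_def by (intro cInf_lower bd)
    thus False using h ap by (auto simp: a'_def)
  qed
  thus ?thesis using upto \<tau> by simp
qed

section \<open>Monotonicity of fronts\<close>

text \<open>
  A front is represented as a function of space-time; uniform limits in the phase are what remains of
  the profile.
\<close>
definition front :: "real \<Rightarrow> real \<Rightarrow> real \<Rightarrow> (real \<Rightarrow> real \<Rightarrow> real \<Rightarrow> real) \<Rightarrow> bool" where
  "front e1 e2 c u \<longleftrightarrow> sol01 u \<and> c \<noteq> 0 \<and> e1\<^sup>2 + e2\<^sup>2 = 1 \<and>
     (\<forall>\<epsilon>>0. \<exists>A\<ge>0. \<forall>t x y. (A \<le> x * e1 + y * e2 - c * t \<longrightarrow> u t x y \<le> \<epsilon>) \<and>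
        (x * e1 + y * e2 - c * t \<le> - A \<longrightarrow> 1 - \<epsilon> \<le> u t x y))"

lemma front_limits:
  assumes "front e1 e2 c u" "\<epsilon> > 0"
  obtains A where "A \<ge> 0" "\<And>t x y. A \<le> x * e1 + y * e2 - c * t \<Longrightarrow> u t x y \<le> \<epsilon>"
    "\<And>t x y. x * e1 + y * e2 - c * t \<le> - A \<Longrightarrow> 1 - \<epsilon> \<le> u t x y"
proof -
  from assms have "\<exists>A\<ge>0. \<forall>t x y. (A \<le> x * e1 + y * e2 - c * t \<longrightarrow> u t x y \<le> \<epsilon>) \<and>
        (x * e1 + y * e2 - c * t \<le> - A \<longrightarrow> 1 - \<epsilon> \<le> u t x y)" unfolding front_def by blast
  thus thesis using that by blast
qed

text \<open>
  In \<open>n\<close> shifts, with \<open>n\<close> large, the value at a point of phase \<open>B\<close> rises from below \<open>1/4\<close> to above \<open>3/4\<close>, so one of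
  these shifts gains at least \<open>1 / (2 n)\<close>. Starting at a time sufficiently far in the past and at a nearby
  point, this gain happens within bounded distance of a given point \<open>(t, x, y)\<close> of the strip and at
  least one time unit earlier, and it propagates to \<open>(t, x, y)\<close>.
\<close>
lemma front_strict:
  assumes fr: "front e1 e2 c u" and \<tau>: "\<tau> > 0"
    and le: "\<And>t x y. u t x y \<le> u (t + 1 / c * \<tau>) x y" and A: "A \<ge> 0"
  shows "\<exists>\<delta>>0. \<forall>t x y. \<bar>x * e1 + y * e2 - c * t\<bar> \<le> A \<longrightarrow> \<delta> \<le> u (t + 1 / c * \<tau>) x y - u t x y"
proof -
  have u: "sol01 u" and c: "c \<noteq> 0" and e: "e1\<^sup>2 + e2\<^sup>2 = 1" using fr by (auto simp: front_def)
  obtain B where B: "B \<ge> 0" "\<And>t x y. B \<le> x * e1 + y * e2 - c * t \<Longrightarrow> u t x y \<le> 1 / 4"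
    "\<And>t x y. x * e1 + y * e2 - c * t \<le> - B \<Longrightarrow> 1 - 1 / 4 \<le> u t x y"
    by (rule front_limits[OF fr, of "1 / 4"], simp, blast)
  obtain n :: nat where n: "2 * B / \<tau> + 1 \<le> real n" using real_arch_simple by blast
  have n0: "real n \<ge> 1"
  proof -
    have "0 \<le> 2 * B / \<tau>" using B(1) \<tau> by simp
    thus ?thesis using n by linarith
  qed
  have n1: "real n * \<tau> \<ge> 2 * B"
  proof -
    have "2 * B / \<tau> \<le> real n" using n by linarith
    thus ?thesis using \<tau> by (simp add: field_simps)
  qed
  define v where "v = (\<lambda>t. u (t + 1 / c * \<tau>))"
  have v: "sol01 v" unfolding v_def by (rule sol01_shift[OF u])
  \<comment> \<open>the time taken by \<open>n\<close> shifts, which go backward if \<open>c < 0\<close>\<close>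
  define S where "S = real n * \<tau> / \<bar>c\<bar>"
  have S: "S \<ge> 0" using \<tau> by (simp add: S_def)
  define \<rho> where "\<rho> = B + A + \<bar>c\<bar> + real n * \<tau> + 1"
  have \<rho>: "\<rho> > 0" using B(1) A \<tau> by (simp add: \<rho>_def add_nonneg_pos)
  obtain \<epsilon> where \<epsilon>: "\<epsilon> > 0" and gap: "\<And>t1 x1 y1 t x y.
     1 / (2 * real n) \<le> v t1 x1 y1 - u t1 x1 y1 \<Longrightarrow> 1 \<le> t - t1 \<Longrightarrow> t - t1 \<le> 1 + 2 * S \<Longrightarrow>
     (x - x1)\<^sup>2 + (y - y1)\<^sup>2 \<le> \<rho>\<^sup>2 \<Longrightarrow> \<epsilon> \<le> v t x y - u t x y"
  proof -
    have "1 / (2 * real n) > 0" using n0 by simp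
    from gap_propagates[OF this \<rho> zero_less_one, of "1 + 2 * S"] u v le show ?thesis
      using that unfolding v_def by blast
  qed
  show ?thesis
  proof (intro exI[of _ \<epsilon>] conjI \<epsilon> allI impI)
    fix t x y assume \<xi>: "\<bar>x * e1 + y * e2 - c * t\<bar> \<le> A"
    define t0 where "t0 = t - 1 - S"
    define l where "l = B - (x * e1 + y * e2 - c * t0)"
    define x1 y1 where "x1 = x + l * e1" and "y1 = y + l * e2"
    have "x1 * e1 + y1 * e2 = x * e1 + y * e2 + l * (e1\<^sup>2 + e2\<^sup>2)"
      by (simp add: x1_def y1_def power2_eq_square algebra_simps)
    hence \<xi>1: "x1 * e1 + y1 * e2 - c * t0 = B" by (simp add: e l_def)
    define g where "g = (\<lambda>j :: nat. u (t0 + real j * (1 / c * \<tau>)) x1 y1)"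
    have "g n - g 0 \<ge> 1 / 2"
    proof -
      have "x1 * e1 + y1 * e2 - c * (t0 + real n * (1 / c * \<tau>)) = B - real n * \<tau>"
        using \<xi>1 c by (simp add: algebra_simps)
      hence "g n \<ge> 3 / 4" unfolding g_def using n1 B(3)[of x1 y1 "t0 + real n * (1 / c * \<tau>)"] by simp
      moreover have "g 0 \<le> 1 / 4" unfolding g_def using \<xi>1 by (intro B(2)) simp
      ultimately show ?thesis by simp
    qed
    hence sum: "(\<Sum>j<n. g (Suc j) - g j) \<ge> 1 / 2" by (simp add: sum_lessThan_telescope)
    have "\<exists>j<n. 1 / (2 * real n) \<le> g (Suc j) - g j"
    proof (rule ccontr)
      assume "\<not> ?thesis"
      hence "(\<Sum>j<n. g (Suc j) - g j) < (\<Sum>j<n. 1 / (2 * real n))"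
        using n0 by (intro sum_strict_mono) (auto simp: not_le lessThan_empty_iff)
      also have "\<dots> = 1 / 2" using n0 by simp
      finally show False using sum by simp
    qed
    then obtain j where j: "j < n" "1 / (2 * real n) \<le> g (Suc j) - g j" by blast
    define t1 where "t1 = t0 + real j * (1 / c * \<tau>)"
    have "g (Suc j) = v t1 x1 y1" by (simp add: g_def v_def t1_def algebra_simps add_divide_distrib)
    hence j2: "1 / (2 * real n) \<le> v t1 x1 y1 - u t1 x1 y1" using j by (simp add: g_def t1_def)
    have jS: "\<bar>real j * (1 / c * \<tau>)\<bar> \<le> S"
    proof -
      have "real j * \<tau> \<le> real n * \<tau>" using j \<tau> by (intro mult_right_mono) auto
      thus ?thesis using \<tau> by (simp add: S_def abs_mult divide_right_mono)
    qed
    have t1: "1 \<le> t - t1" "t - t1 \<le> 1 + 2 * S" unfolding t1_def t0_def using jS by linarith+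
    have "\<bar>l\<bar> \<le> \<rho>"
    proof -
      have cS: "\<bar>c * S\<bar> = real n * \<tau>" using c \<tau> by (simp add: S_def abs_mult)
      have "l = B - (x * e1 + y * e2 - c * t) - c - c * S"
        by (simp add: l_def t0_def algebra_simps)
      thus ?thesis using \<xi> cS B(1) unfolding \<rho>_def by linarith
    qed
    hence "l\<^sup>2 \<le> \<rho>\<^sup>2" using \<rho> by (simp add: abs_le_square_iff[symmetric])
    moreover have "(x - x1)\<^sup>2 + (y - y1)\<^sup>2 = l\<^sup>2 * (e1\<^sup>2 + e2\<^sup>2)"
      by (simp add: x1_def y1_def power2_eq_square algebra_simps)
    ultimately have "(x - x1)\<^sup>2 + (y - y1)\<^sup>2 \<le> \<rho>\<^sup>2" by (simp add: e)
    from gap[OF j2 t1 this] show "\<epsilon> \<le> u (t + 1 / c * \<tau>) x y - u t x y" by (simp add: v_def)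
  qed
qed

text \<open>
  Outside a strip of bounded phase, either \<open>u\<close> is small or its shift is large; inside, the strict gap
  survives a small change of the shift by uniform continuity in time.
\<close>
lemma front_mono:
  assumes fr: "front e1 e2 c u" and \<tau>: "\<tau> \<ge> 0"
  shows "u t x y \<le> u (t + 1 / c * \<tau>) x y"
proof -
  have u: "sol01 u" and c: "c \<noteq> 0" using fr by (auto simp: front_def)
  obtain A where A: "A \<ge> 0" "\<And>t x y. A \<le> x * e1 + y * e2 - c * t \<Longrightarrow> u t x y \<le> \<sigma>"
    "\<And>t x y. x * e1 + y * e2 - c * t \<le> - A \<Longrightarrow> 1 - \<sigma> \<le> u t x y"
    by (rule front_limits[OF fr sig(1)], blast)
  have shift: "x * e1 + y * e2 - c * (t + 1 / c * \<tau>) = x * e1 + y * e2 - c * t - \<tau>" for t x y \<tau>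
    using c by (simp add: algebra_simps)
  show ?thesis
  proof (rule sliding[OF u u _ _ \<tau>, where \<tau>s="2 * A"])
    fix \<tau> t x y assume "2 * A \<le> \<tau>"
    thus "u t x y \<le> \<sigma> \<or> 1 - \<sigma> \<le> u (t + 1 / c * \<tau>) x y"
      using A(2)[of x y t] A(3)[of x y "t + 1 / c * \<tau>"] unfolding shift by linarith
  next
    fix \<tau>1 :: real assume \<tau>1: "\<tau>1 > 0" and le: "\<And>\<tau> t x y. \<tau>1 \<le> \<tau> \<Longrightarrow> u t x y \<le> u (t + 1 / c * \<tau>) x y"
    obtain \<delta> where \<delta>: "\<delta> > 0" "\<And>t x y. \<bar>x * e1 + y * e2 - c * t\<bar> \<le> A \<Longrightarrow> \<delta> \<le> u (t + 1 / c * \<tau>1) x y - u t x y"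
      using front_strict[OF fr \<tau>1 le[OF order_refl] A(1)] by blast
    obtain h where h: "h > 0" "\<And>t s x y. \<bar>t - s\<bar> \<le> h \<Longrightarrow> \<bar>u t x y - u s x y\<bar> \<le> \<delta>"
      using sol01_time_modulus[OF u \<delta>(1)] by blast
    show "\<exists>h>0. \<forall>\<tau> t x y. 0 \<le> \<tau> \<longrightarrow> \<tau>1 - h \<le> \<tau> \<longrightarrow> \<tau> \<le> \<tau>1 \<longrightarrow>
         u t x y \<le> \<sigma> \<or> 1 - \<sigma> \<le> u (t + 1 / c * \<tau>) x y \<or> u t x y \<le> u (t + 1 / c * \<tau>) x y"
    proof (intro exI[of _ "h * \<bar>c\<bar>"] conjI allI impI)
      show "h * \<bar>c\<bar> > 0" using h c by simp
      fix \<tau> t x y assume t: "0 \<le> \<tau>" "\<tau>1 - h * \<bar>c\<bar> \<le> \<tau>" "\<tau> \<le> \<tau>1"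
      show "u t x y \<le> \<sigma> \<or> 1 - \<sigma> \<le> u (t + 1 / c * \<tau>) x y \<or> u t x y \<le> u (t + 1 / c * \<tau>) x y"
      proof (cases "\<bar>x * e1 + y * e2 - c * t\<bar> \<le> A")
        case False
        thus ?thesis using A(2)[of x y t] A(3)[of x y "t + 1 / c * \<tau>"] t(1) unfolding shift by linarith
      next
        case True
        have "\<bar>(t + 1 / c * \<tau>) - (t + 1 / c * \<tau>1)\<bar> = (\<tau>1 - \<tau>) / \<bar>c\<bar>"
        proof -
          have "(t + 1 / c * \<tau>) - (t + 1 / c * \<tau>1) = (\<tau> - \<tau>1) / c" by (simp add: diff_divide_distrib)
          thus ?thesis using t(3) by (simp add: abs_divide)
        qed
        also have "\<dots> \<le> h" using t c by (simp add: field_simps)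
        finally have "\<bar>u (t + 1 / c * \<tau>) x y - u (t + 1 / c * \<tau>1) x y\<bar> \<le> \<delta>" by (rule h)
        thus ?thesis using \<delta>(2)[OF True] by linarith
      qed
    qed
  qed
qed

end

context bistable begin

section \<open>Solutions with two fronts meeting in a tip\<close>

text \<open>
  Here \<open>pa\<close> and \<open>pb\<close> are the phases of the two fronts, and \<open>(x, y - s t)\<close> is the position relative to
  the tip. In the step, points close to the tip of \<open>u\<close> or to that of the shifted \<open>v\<close> lie in the box of size
  \<open>R + \<tau>1\<close> around the former, where the gap comes from propagation. All other points are far from both tips,
  and there \<open>u\<close> and the shifted \<open>v\<close> are close to the maximum of the fronts and to its shift.
\<close>
lemma two_front_comparison:
  fixes s \<alpha> \<beta> :: real
  assumes fa: "front (cos \<alpha>) (sin \<alpha>) (s * sin \<alpha>) a" and fb: "front (cos \<beta>) (sin \<beta>) (s * sin \<beta>) b"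
    and ang: "0 < \<alpha>" "\<alpha> < \<beta>" "\<beta> < pi"
    and u: "sol01 u" and v: "sol01 v"
    and au: "\<And>\<epsilon>. \<epsilon> > 0 \<Longrightarrow> \<exists>R. \<forall>t x y. R\<^sup>2 < x\<^sup>2 + (y - s * t)\<^sup>2 \<longrightarrow> \<bar>u t x y - max (a t x y) (b t x y)\<bar> \<le> \<epsilon>"
    and av: "\<And>\<epsilon>. \<epsilon> > 0 \<Longrightarrow> \<exists>R. \<forall>t x y. R\<^sup>2 < x\<^sup>2 + (y - s * t)\<^sup>2 \<longrightarrow> \<bar>v t x y - max (a t x y) (b t x y)\<bar> \<le> \<epsilon>"
  shows "u t x y \<le> v t x y"
proof -
  have sa: "sin \<alpha> > 0" "sin \<alpha> \<le> 1" and sb: "sin \<beta> > 0" "sin \<beta> \<le> 1"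
    using ang by (auto intro: sin_gt_zero)
  have s: "s \<noteq> 0" using fa by (auto simp: front_def)
  have a01: "sol01 a" and b01: "sol01 b" using fa fb by (auto simp: front_def)
  define um where "um = (\<lambda>t x y. max (a t x y) (b t x y))"
  have shift: "1 / (s * sin \<theta>) * (\<tau> * sin \<theta>) = 1 / s * \<tau>" if "sin \<theta> > 0" for \<theta> \<tau>
    using that by simp
  have ma: "a (t + 1 / s * \<tau>) x y \<le> a (t + 1 / s * \<tau>') x y" if "\<tau> \<le> \<tau>'" for t x y \<tau> \<tau>'
    using front_mono[OF fa, of "(\<tau>' - \<tau>) * sin \<alpha>" "t + 1 / s * \<tau>" x y] that sa
    unfolding shift[OF sa(1)] by (simp add: algebra_simps diff_divide_distrib)
  have mb: "b (t + 1 / s * \<tau>) x y \<le> b (t + 1 / s * \<tau>') x y" if "\<tau> \<le> \<tau>'" for t x y \<tau> \<tau>'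
    using front_mono[OF fb, of "(\<tau>' - \<tau>) * sin \<beta>" "t + 1 / s * \<tau>" x y] that sb
    unfolding shift[OF sb(1)] by (simp add: algebra_simps diff_divide_distrib)
  have ya: "y - s * (t + 1 / s * \<tau>) = y - s * t - \<tau>" for t y \<tau> using s by (simp add: algebra_simps)
  define pa where "pa = (\<lambda>t x y. x * cos \<alpha> + (y - s * t) * sin \<alpha>)"
  define pb where "pb = (\<lambda>t x y. x * cos \<beta> + (y - s * t) * sin \<beta>)"
  have pas: "pa (t + 1 / s * \<tau>) x y = pa t x y - \<tau> * sin \<alpha>" for t x y \<tau>
    unfolding pa_def ya by (simp add: algebra_simps)
  have pbs: "pb (t + 1 / s * \<tau>) x y = pb t x y - \<tau> * sin \<beta>" for t x y \<tau>
    unfolding pb_def ya by (simp add: algebra_simps)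
  have lims: "\<exists>A\<ge>0. \<forall>t x y. (A \<le> pa t x y \<longrightarrow> a t x y \<le> \<epsilon>) \<and> (pa t x y \<le> - A \<longrightarrow> 1 - \<epsilon> \<le> a t x y)
      \<and> (A \<le> pb t x y \<longrightarrow> b t x y \<le> \<epsilon>) \<and> (pb t x y \<le> - A \<longrightarrow> 1 - \<epsilon> \<le> b t x y)" if e: "\<epsilon> > 0" for \<epsilon>
  proof -
    have eqa: "x * cos \<alpha> + y * sin \<alpha> - s * sin \<alpha> * t = pa t x y" for t x y
      by (simp add: pa_def algebra_simps)
    have eqb: "x * cos \<beta> + y * sin \<beta> - s * sin \<beta> * t = pb t x y" for t x y
      by (simp add: pb_def algebra_simps)
    obtain A where A: "A \<ge> 0" "\<And>t x y. A \<le> pa t x y \<Longrightarrow> a t x y \<le> \<epsilon>"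
      "\<And>t x y. pa t x y \<le> - A \<Longrightarrow> 1 - \<epsilon> \<le> a t x y"
      by (rule front_limits[OF fa e], unfold eqa, blast)
    obtain B where B: "B \<ge> 0" "\<And>t x y. B \<le> pb t x y \<Longrightarrow> b t x y \<le> \<epsilon>"
      "\<And>t x y. pb t x y \<le> - B \<Longrightarrow> 1 - \<epsilon> \<le> b t x y"
      by (rule front_limits[OF fb e], unfold eqb, blast)
    show ?thesis
      by (rule exI[of _ "max A B"]) (use A B in \<open>auto simp: le_max_iff_disj\<close>)
  qed
  have asym: "\<exists>R\<ge>0. \<forall>t x y. R\<^sup>2 < x\<^sup>2 + (y - s * t)\<^sup>2 \<longrightarrow>
      \<bar>u t x y - um t x y\<bar> \<le> \<epsilon> \<and> \<bar>v t x y - um t x y\<bar> \<le> \<epsilon>" if e: "\<epsilon> > 0" for \<epsilon>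
  proof -
    obtain R where R: "\<And>t x y. R\<^sup>2 < x\<^sup>2 + (y - s * t)\<^sup>2 \<Longrightarrow> \<bar>u t x y - um t x y\<bar> \<le> \<epsilon>"
      using au[OF e] unfolding um_def by blast
    obtain R' where R': "\<And>t x y. R'\<^sup>2 < x\<^sup>2 + (y - s * t)\<^sup>2 \<Longrightarrow> \<bar>v t x y - um t x y\<bar> \<le> \<epsilon>"
      using av[OF e] unfolding um_def by blast
    have "R\<^sup>2 \<le> (max \<bar>R\<bar> \<bar>R'\<bar>)\<^sup>2" "R'\<^sup>2 \<le> (max \<bar>R\<bar> \<bar>R'\<bar>)\<^sup>2"
      by (simp_all add: abs_le_square_iff[symmetric])
    thus ?thesis using R R' by (intro exI[of _ "max \<bar>R\<bar> \<bar>R'\<bar>"]) force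
  qed
  have comp: "\<bar>x\<bar> \<le> R \<and> \<bar>y\<bar> \<le> R" if "\<not> R\<^sup>2 < x\<^sup>2 + y\<^sup>2" "R \<ge> 0" for x y R :: real
  proof -
    have "x\<^sup>2 \<le> R\<^sup>2" "y\<^sup>2 \<le> R\<^sup>2" using that zero_le_power2[of x] zero_le_power2[of y] by linarith+
    thus ?thesis using that by (simp add: abs_le_square_iff[symmetric])
  qed
  have lin: "\<bar>x * cos \<theta> + y * sin \<theta>\<bar> \<le> \<bar>x\<bar> + \<bar>y\<bar>" for x y \<theta> :: real
  proof -
    have "\<bar>x * cos \<theta>\<bar> \<le> \<bar>x\<bar> * 1" "\<bar>y * sin \<theta>\<bar> \<le> \<bar>y\<bar> * 1" unfolding abs_mult
      by (intro mult_left_mono; simp)+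
    thus ?thesis by linarith
  qed
  have s2: "\<sigma> / 2 > 0" using sig by simp
  obtain A where A: "A \<ge> 0" "\<And>t x y. A \<le> pa t x y \<Longrightarrow> a t x y \<le> \<sigma> / 2"
    "\<And>t x y. pa t x y \<le> - A \<Longrightarrow> 1 - \<sigma> / 2 \<le> a t x y"
    "\<And>t x y. A \<le> pb t x y \<Longrightarrow> b t x y \<le> \<sigma> / 2"
    "\<And>t x y. pb t x y \<le> - A \<Longrightarrow> 1 - \<sigma> / 2 \<le> b t x y"
    using lims[OF s2] by blast
  have um_lower: "a t x y \<le> um t x y" "b t x y \<le> um t x y" for t x y by (auto simp: um_def)
  have "\<exists>\<tau>s. \<forall>\<tau> t x y. \<tau>s \<le> \<tau> \<longrightarrow> u t x y \<le> \<sigma> \<or> 1 - \<sigma> \<le> v (t + 1 / s * \<tau>) x y"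
  proof -
    define m where "m = min (sin \<alpha>) (sin \<beta>)"
    have m: "m > 0" "m \<le> sin \<alpha>" "m \<le> sin \<beta>" "m \<le> 1" using sa sb by (auto simp: m_def min_le_iff_disj)
    obtain R where R: "R \<ge> 0" "\<And>t x y. R\<^sup>2 < x\<^sup>2 + (y - s * t)\<^sup>2 \<Longrightarrow>
      \<bar>u t x y - um t x y\<bar> \<le> \<sigma> / 2 \<and> \<bar>v t x y - um t x y\<bar> \<le> \<sigma> / 2" using asym[OF s2] by blast
    define C where "C = 2 * A + 2 * R + 1"
    have C: "C > 0" using A(1) R(1) by (simp add: C_def)
    show ?thesis
    proof (intro exI[of _ "C / m"] allI impI)
      fix \<tau> t x y assume \<tau>: "C / m \<le> \<tau>"
      have \<tau>m: "C \<le> \<tau> * m" using \<tau> m by (simp add: field_simps)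
      have \<tau>0: "\<tau> \<ge> 0" using \<tau> C m order_trans[of 0 "C / m" \<tau>] by simp
      have \<tau>1: "\<tau> * m \<le> \<tau> * sin \<alpha>" "\<tau> * m \<le> \<tau> * sin \<beta>" "\<tau> * m \<le> \<tau> * 1"
        using m \<tau>0 by (intro mult_left_mono; simp)+
      note big = \<tau>m[unfolded C_def] \<tau>1 A(1) R(1)
      let ?t = "t + 1 / s * \<tau>"
      show "u t x y \<le> \<sigma> \<or> 1 - \<sigma> \<le> v ?t x y"
      proof (cases "R\<^sup>2 < x\<^sup>2 + (y - s * t)\<^sup>2")
        case False
        note z = comp[OF False R(1)]
        have "R < \<bar>y - s * t - \<tau>\<bar>" using z big by linarith
        hence "R\<^sup>2 < (y - s * t - \<tau>)\<^sup>2" using R(1) by (simp add: abs_le_square_iff[symmetric] not_le[symmetric])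
        hence far: "R\<^sup>2 < x\<^sup>2 + (y - s * ?t)\<^sup>2" unfolding ya using zero_le_power2[of x] by linarith
        have "pa ?t x y \<le> - A"
          using lin[of x \<alpha> "y - s * t"] z big unfolding pas unfolding pa_def by linarith
        from A(3)[OF this] R(2)[OF far] um_lower(1)[of ?t x y] show ?thesis by linarith
      next
        case far: True
        show ?thesis
        proof (cases "R\<^sup>2 < x\<^sup>2 + (y - s * ?t)\<^sup>2")
          case False
          note z = comp[OF False R(1), unfolded ya]
          have "A \<le> pa t x y"
            using lin[of x \<alpha> "y - s * t - \<tau>"] z big pas[of t \<tau> x y] unfolding pa_def ya by linarith
          moreover have "A \<le> pb t x y"
            using lin[of x \<beta> "y - s * t - \<tau>"] z big pbs[of t \<tau> x y] unfolding pb_def ya by linarith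
          ultimately have "um t x y \<le> \<sigma> / 2" using A(2)[of t x y] A(4)[of t x y] unfolding um_def by (intro max.boundedI)
          thus ?thesis using R(2)[OF far] by linarith
        next
          case far': True
          show ?thesis
          proof (rule ccontr)
            assume n: "\<not> ?thesis"
            have 1: "um t x y > \<sigma> / 2" using n R(2)[OF far] by linarith
            have 2: "um ?t x y < 1 - \<sigma> / 2" using n R(2)[OF far'] by linarith
            have "a t x y > \<sigma> / 2 \<or> b t x y > \<sigma> / 2" using 1 by (auto simp: um_def)
            thus False
            proof
              assume "a t x y > \<sigma> / 2"
              hence "pa t x y < A" using A(2)[of t x y] by linarith
              hence "pa ?t x y \<le> - A" unfolding pas using big by linarith
              from A(3)[OF this] 2 um_lower(1)[of ?t x y] show False by linarith
            next
              assume "b t x y > \<sigma> / 2"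
              hence "pb t x y < A" using A(4)[of t x y] by linarith
              hence "pb ?t x y \<le> - A" unfolding pbs using big by linarith
              from A(5)[OF this] 2 um_lower(2)[of ?t x y] show False by linarith
            qed
          qed
        qed
      qed
    qed
  qed
  then obtain \<tau>s where start: "\<And>\<tau> t x y. \<tau>s \<le> \<tau> \<Longrightarrow> u t x y \<le> \<sigma> \<or> 1 - \<sigma> \<le> v (t + 1 / s * \<tau>) x y"
    by blast
  have step: "\<exists>h>0. \<forall>\<tau> t x y. 0 \<le> \<tau> \<longrightarrow> \<tau>1 - h \<le> \<tau> \<longrightarrow> \<tau> \<le> \<tau>1 \<longrightarrow>
         u t x y \<le> \<sigma> \<or> 1 - \<sigma> \<le> v (t + 1 / s * \<tau>) x y \<or> u t x y \<le> v (t + 1 / s * \<tau>) x y"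
    if \<tau>1: "\<tau>1 > 0" and le: "\<And>\<tau> t x y. \<tau>1 \<le> \<tau> \<Longrightarrow> u t x y \<le> v (t + 1 / s * \<tau>) x y" for \<tau>1
  proof -
    have "\<exists>\<delta>>0. \<forall>t x y. \<bar>pa t x y\<bar> \<le> A \<longrightarrow> \<delta> \<le> a (t + 1 / s * (\<tau>1 / 2)) x y - a t x y"
    proof -
      have "\<exists>\<delta>>0. \<forall>t x y. \<bar>x * cos \<alpha> + y * sin \<alpha> - s * sin \<alpha> * t\<bar> \<le> A \<longrightarrow>
          \<delta> \<le> a (t + 1 / (s * sin \<alpha>) * (\<tau>1 / 2 * sin \<alpha>)) x y - a t x y"
        by (rule front_strict[OF fa _ _ A(1)], use \<tau>1 sa in simp, rule front_mono[OF fa], use \<tau>1 sa in simp)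
      thus ?thesis unfolding shift[OF sa(1)] pa_def by (simp add: algebra_simps)
    qed
    then obtain \<delta>a where \<delta>a: "\<delta>a > 0" "\<And>t x y. \<bar>pa t x y\<bar> \<le> A \<Longrightarrow> \<delta>a \<le> a (t + 1 / s * (\<tau>1 / 2)) x y - a t x y"
      by blast
    have "\<exists>\<delta>>0. \<forall>t x y. \<bar>pb t x y\<bar> \<le> A \<longrightarrow> \<delta> \<le> b (t + 1 / s * (\<tau>1 / 2)) x y - b t x y"
    proof -
      have "\<exists>\<delta>>0. \<forall>t x y. \<bar>x * cos \<beta> + y * sin \<beta> - s * sin \<beta> * t\<bar> \<le> A \<longrightarrow>
          \<delta> \<le> b (t + 1 / (s * sin \<beta>) * (\<tau>1 / 2 * sin \<beta>)) x y - b t x y"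
        by (rule front_strict[OF fb _ _ A(1)], use \<tau>1 sb in simp, rule front_mono[OF fb], use \<tau>1 sb in simp)
      thus ?thesis unfolding shift[OF sb(1)] pb_def by (simp add: algebra_simps)
    qed
    then obtain \<delta>b where \<delta>b: "\<delta>b > 0" "\<And>t x y. \<bar>pb t x y\<bar> \<le> A \<Longrightarrow> \<delta>b \<le> b (t + 1 / s * (\<tau>1 / 2)) x y - b t x y"
      by blast
    define \<delta> where "\<delta> = min \<delta>a \<delta>b"
    have \<delta>: "\<delta> > 0" "\<delta> \<le> \<delta>a" "\<delta> \<le> \<delta>b" using \<delta>a(1) \<delta>b(1) by (auto simp: \<delta>_def)
    \<comment> \<open>The two approximation errors \<open>\<epsilon>\<close> and the contribution \<open>\<delta> / 4\<close> of the other front leave a gap of \<open>\<delta> / 4\<close>.\<close>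
    define \<epsilon> where "\<epsilon> = min (\<delta> / 4) (\<sigma> / 2)"
    have \<epsilon>: "\<epsilon> > 0" "\<epsilon> \<le> \<delta> / 4" "\<epsilon> \<le> \<sigma> / 2" using \<delta>(1) s2 by (auto simp: \<epsilon>_def)
    obtain R where R: "R \<ge> 0" "\<And>t x y. R\<^sup>2 < x\<^sup>2 + (y - s * t)\<^sup>2 \<Longrightarrow>
      \<bar>u t x y - um t x y\<bar> \<le> \<epsilon> \<and> \<bar>v t x y - um t x y\<bar> \<le> \<epsilon>" using asym[OF \<epsilon>(1)] by blast
    have \<delta>4: "\<delta> / 4 > 0" using \<delta> by simp
    obtain B where B: "B \<ge> 0" "\<And>t x y. B \<le> pb t x y \<Longrightarrow> b t x y \<le> \<delta> / 4"
      using lims[OF \<delta>4] by blast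
    define k where "k = sin (\<beta> - \<alpha>)"
    have k: "k > 0" unfolding k_def using ang by (intro sin_gt_zero) auto
    define l where "l = R + \<tau>1 + 1 + B / k"
    have l: "l > R + \<tau>1" "l * k \<ge> B" "l > 0"
    proof -
      have "B / k \<ge> 0" using B k by simp
      thus "l > R + \<tau>1" "l > 0" using R(1) \<tau>1 by (auto simp: l_def)
      have "(R + \<tau>1 + 1) * k \<ge> 0" using R(1) \<tau>1 k by simp
      thus "l * k \<ge> B" using k by (simp add: l_def distrib_right)
    qed
    define \<rho> where "\<rho> = 2 * (R + \<tau>1 + l + \<bar>s\<bar>)"
    have \<rho>: "\<rho> > 0" using R(1) \<tau>1 l by (simp add: \<rho>_def add_pos_nonneg)
    have v1: "sol01 (\<lambda>t. v (t + 1 / s * \<tau>1))" by (rule sol01_shift[OF v])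
    obtain \<eta> where \<eta>: "\<eta> > 0" and gap: "\<And>t1 x1 y1 t x y.
        \<delta> / 4 \<le> v (t1 + 1 / s * \<tau>1) x1 y1 - u t1 x1 y1 \<Longrightarrow> 1 \<le> t - t1 \<Longrightarrow> t - t1 \<le> 1 \<Longrightarrow>
        (x - x1)\<^sup>2 + (y - y1)\<^sup>2 \<le> \<rho>\<^sup>2 \<Longrightarrow> \<eta> \<le> v (t + 1 / s * \<tau>1) x y - u t x y"
      using gap_propagates[OF \<delta>4 \<rho> zero_less_one, of 1] u v1 le[OF order_refl] by blast
    have near: "\<eta> \<le> v (t + 1 / s * \<tau>1) x y - u t x y"
      if xy: "\<bar>x\<bar> \<le> R + \<tau>1" "\<bar>y - s * t\<bar> \<le> R + \<tau>1" for t x y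
    proof (rule gap)
      \<comment> \<open>One time unit earlier, a point of phase 0 of the front \<open>a\<close>, at distance \<open>l\<close> from the tip on the side where
        the phase of \<open>b\<close> is large: there the maximum of the fronts is essentially \<open>a\<close>.\<close>
      let ?t1 = "t - 1" and ?x1 = "- l * sin \<alpha>" and ?y1 = "s * (t - 1) + l * cos \<alpha>"
      show "1 \<le> t - ?t1" "t - ?t1 \<le> 1" by simp_all
      have pa0: "pa ?t1 ?x1 ?y1 = 0" by (simp add: pa_def)
      have "pb ?t1 ?x1 ?y1 = l * k" by (simp add: pb_def k_def sin_diff algebra_simps)
      hence b1: "b ?t1 ?x1 ?y1 \<le> \<delta> / 4" using l by (intro B(2)) simp
      have "?x1\<^sup>2 + (l * cos \<alpha>)\<^sup>2 = l\<^sup>2 * ((sin \<alpha>)\<^sup>2 + (cos \<alpha>)\<^sup>2)"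
        unfolding distrib_left by (simp add: power_mult_distrib)
      hence n1: "?x1\<^sup>2 + (l * cos \<alpha>)\<^sup>2 = l\<^sup>2" by (simp only: sin_cos_squared_add mult_1_right)
      have "R\<^sup>2 < l\<^sup>2" using l R(1) \<tau>1 by (intro power_strict_mono) auto
      hence far: "R\<^sup>2 < ?x1\<^sup>2 + (?y1 - s * ?t1)\<^sup>2" using n1 by simp
      have far': "R\<^sup>2 < ?x1\<^sup>2 + (?y1 - s * (?t1 + 1 / s * \<tau>1))\<^sup>2"
      proof (rule ccontr)
        assume "\<not> ?thesis"
        hence le: "?x1\<^sup>2 + (l * cos \<alpha> - \<tau>1)\<^sup>2 \<le> R\<^sup>2" unfolding ya by (simp add: not_less)
        have "l * cos \<alpha> \<le> l * 1" using l by (intro mult_left_mono) auto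
        hence "\<tau>1 * (l * cos \<alpha>) \<le> \<tau>1 * l" using \<tau>1 by (intro mult_left_mono) auto
        hence "(l - \<tau>1)\<^sup>2 \<le> ?x1\<^sup>2 + (l * cos \<alpha> - \<tau>1)\<^sup>2"
          using n1 by (simp add: power2_diff algebra_simps)
        hence "(l - \<tau>1)\<^sup>2 \<le> R\<^sup>2" using le by linarith
        moreover have "R\<^sup>2 < (l - \<tau>1)\<^sup>2" using l R(1) by (intro power_strict_mono) auto
        ultimately show False by linarith
      qed
      have "um ?t1 ?x1 ?y1 \<le> a ?t1 ?x1 ?y1 + \<delta> / 4"
        using b1 sol01D(3)[OF a01, of ?t1 ?x1 ?y1] \<delta>4 unfolding um_def by (simp add: max_def)
      moreover have "\<delta>a \<le> a (?t1 + 1 / s * (\<tau>1 / 2)) ?x1 ?y1 - a ?t1 ?x1 ?y1"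
        using A(1) pa0 by (intro \<delta>a(2)) simp
      moreover have "a (?t1 + 1 / s * (\<tau>1 / 2)) ?x1 ?y1 \<le> a (?t1 + 1 / s * \<tau>1) ?x1 ?y1"
        using \<tau>1 by (intro ma) simp
      ultimately show "\<delta> / 4 \<le> v (?t1 + 1 / s * \<tau>1) ?x1 ?y1 - u ?t1 ?x1 ?y1"
        using R(2)[OF far] R(2)[OF far'] um_lower(1)[of "?t1 + 1 / s * \<tau>1" ?x1 ?y1] \<epsilon>(2) \<delta>(2)
        by linarith
      have ls: "\<bar>l * sin \<alpha>\<bar> \<le> l" and lc: "\<bar>l * cos \<alpha>\<bar> \<le> l"
        using l(3) mult_left_mono[OF abs_sin_le_one, of l \<alpha>] mult_left_mono[OF abs_cos_le_one, of l \<alpha>]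
        by (simp_all add: abs_mult)
      have "x - ?x1 = x + l * sin \<alpha>" by simp
      hence "\<bar>x - ?x1\<bar> \<le> R + \<tau>1 + l + \<bar>s\<bar>" using ls xy by linarith
      moreover have "y - ?y1 = (y - s * t) + s - l * cos \<alpha>" by (simp add: algebra_simps)
      then have "\<bar>y - ?y1\<bar> \<le> R + \<tau>1 + l + \<bar>s\<bar>" using lc xy by linarith
      ultimately have "\<bar>x - ?x1\<bar> \<le> \<rho> / 2" "\<bar>y - ?y1\<bar> \<le> \<rho> / 2"
        by (simp_all add: \<rho>_def)
      hence "(x - ?x1)\<^sup>2 \<le> (\<rho> / 2)\<^sup>2" "(y - ?y1)\<^sup>2 \<le> (\<rho> / 2)\<^sup>2"
        using \<rho> by (simp_all only: abs_le_square_iff[symmetric])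
      moreover have "(\<rho> / 2)\<^sup>2 + (\<rho> / 2)\<^sup>2 \<le> \<rho>\<^sup>2" by (simp add: power2_eq_square)
      ultimately show "(x - ?x1)\<^sup>2 + (y - ?y1)\<^sup>2 \<le> \<rho>\<^sup>2" by linarith
    qed
    obtain h where h: "h > 0" "\<And>t t' x y. \<bar>t - t'\<bar> \<le> h \<Longrightarrow> \<bar>v t x y - v t' x y\<bar> \<le> \<eta>"
      using sol01_time_modulus[OF v \<eta>] by blast
    show ?thesis
    proof (intro exI[of _ "min (\<tau>1 / 2) (h * \<bar>s\<bar>)"] conjI allI impI)
      show "min (\<tau>1 / 2) (h * \<bar>s\<bar>) > 0" using \<tau>1 h s by simp
      fix \<tau> t x y
      assume t0: "0 \<le> \<tau>" and "\<tau>1 - min (\<tau>1 / 2) (h * \<bar>s\<bar>) \<le> \<tau>" and t1: "\<tau> \<le> \<tau>1"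
      hence th: "\<tau>1 / 2 \<le> \<tau>" "\<tau>1 - \<tau> \<le> h * \<bar>s\<bar>" by (auto simp: min_def split: if_splits)
      let ?t = "t + 1 / s * \<tau>"
      show "u t x y \<le> \<sigma> \<or> 1 - \<sigma> \<le> v ?t x y \<or> u t x y \<le> v ?t x y"
      proof (cases "\<bar>x\<bar> \<le> R + \<tau>1 \<and> \<bar>y - s * t\<bar> \<le> R + \<tau>1")
        case True
        have "\<bar>?t - (t + 1 / s * \<tau>1)\<bar> = (\<tau>1 - \<tau>) / \<bar>s\<bar>"
        proof -
          have "?t - (t + 1 / s * \<tau>1) = (\<tau> - \<tau>1) / s" by (simp add: diff_divide_distrib)
          thus ?thesis using t1 by (simp add: abs_divide)
        qed
        also have "\<dots> \<le> h" using th s by (simp add: field_simps)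
        finally have "\<bar>v ?t x y - v (t + 1 / s * \<tau>1) x y\<bar> \<le> \<eta>" by (rule h)
        thus ?thesis using near[of x y t] True by linarith
      next
        case False
        have far: "R\<^sup>2 < x\<^sup>2 + (y - s * t)\<^sup>2"
          using comp[of R x "y - s * t"] R(1) False \<tau>1 by linarith
        have far': "R\<^sup>2 < x\<^sup>2 + (y - s * ?t)\<^sup>2"
          unfolding ya using comp[of R x "y - s * t - \<tau>"] R(1) False t0 t1 by linarith
        show ?thesis
        proof (rule ccontr)
          assume n: "\<not> ?thesis"
          have 1: "um t x y > \<sigma> / 2" using n R(2)[OF far] \<epsilon>(3) by linarith
          have 2: "um ?t x y < 1 - \<sigma> / 2" using n R(2)[OF far'] \<epsilon>(3) by linarith
          have "um t x y + \<delta> \<le> um ?t x y"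
          proof (cases "a t x y \<ge> b t x y")
            case True
            hence e: "um t x y = a t x y" by (simp add: um_def)
            have "pa t x y < A" using A(2)[of t x y] 1 e by linarith
            moreover have "- A < pa ?t x y" using A(3)[of ?t x y] 2 um_lower(1)[of ?t x y] by linarith
            moreover have "0 \<le> \<tau> * sin \<alpha>" using t0 sa by simp
            ultimately have "\<bar>pa t x y\<bar> \<le> A" unfolding pas by linarith
            from \<delta>a(2)[OF this] have "\<delta> \<le> a (t + 1 / s * (\<tau>1 / 2)) x y - a t x y" using \<delta> by linarith
            thus ?thesis using ma[OF th(1), of t x y] um_lower(1)[of ?t x y] e by linarith
          next
            case False
            hence e: "um t x y = b t x y" by (simp add: um_def)
            have "pb t x y < A" using A(4)[of t x y] 1 e by linarith
            moreover have "- A < pb ?t x y" using A(5)[of ?t x y] 2 um_lower(2)[of ?t x y] by linarith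
            moreover have "0 \<le> \<tau> * sin \<beta>" using t0 sb by simp
            ultimately have "\<bar>pb t x y\<bar> \<le> A" unfolding pbs by linarith
            from \<delta>b(2)[OF this] have "\<delta> \<le> b (t + 1 / s * (\<tau>1 / 2)) x y - b t x y" using \<delta> by linarith
            thus ?thesis using mb[OF th(1), of t x y] um_lower(2)[of ?t x y] e by linarith
          qed
          thus False using n R(2)[OF far] R(2)[OF far'] \<epsilon>(2) \<delta>(1) by linarith
        qed
      qed
    qed
  qed
  have "u t x y \<le> v (t + 1 / s * 0) x y"
    by (rule sliding[OF u v start step order_refl])
  thus ?thesis by simp
qed

end

section \<open>Pulsating fronts and uniqueness\<close>

lemma classical_C12:
  assumes "classical_entire_solution f u"
  obtains ut ux uy uxx uxy uyy where "C12 UNIV u ut ux uy uxx uxy uyy"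
    "\<And>t x y. ut t x y - (uxx t x y + uyy t x y) = f x y (u t x y)"
proof -
  from assms obtain ut ux uy uxx uxy uyy where
    c: "\<forall>g\<in>{u, ut, ux, uy, uxx, uxy, uyy}. continuous_on UNIV (\<lambda>(t, x, y). g t x y)" and
    d: "\<forall>t x y.
           ((\<lambda>s. u s x y) has_real_derivative ut t x y) (at t) \<and>
           ((\<lambda>s. u t s y) has_real_derivative ux t x y) (at x) \<and>
           ((\<lambda>s. u t x s) has_real_derivative uy t x y) (at y) \<and>
           ((\<lambda>s. ux t s y) has_real_derivative uxx t x y) (at x) \<and>
           ((\<lambda>s. ux t x s) has_real_derivative uxy t x y) (at y) \<and>
           ((\<lambda>s. uy t s y) has_real_derivative uxy t x y) (at x) \<and>
           ((\<lambda>s. uy t x s) has_real_derivative uyy t x y) (at y) \<and>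
           ut t x y - (uxx t x y + uyy t x y) = f x y (u t x y)"
    unfolding classical_entire_solution_def by (elim exE conjE)
  have "C12 UNIV u ut ux uy uxx uxy uyy"
    unfolding C12_def UNIV_Times_UNIV using c d by blast
  thus thesis by (rule that) (use d in blast)
qed

lemma C12_minus:
  assumes "C12 UNIV u ut ux uy uxx uxy uyy"
  shows "C12 UNIV (\<lambda>t x y. - u t x y) (\<lambda>t x y. - ut t x y) (\<lambda>t x y. - ux t x y) (\<lambda>t x y. - uy t x y)
    (\<lambda>t x y. - uxx t x y) (\<lambda>t x y. - uxy t x y) (\<lambda>t x y. - uyy t x y)"
  unfolding C12_def using C12_cont[OF assms, THEN cont3_un(1)] C12_deriv[OF assms]
  by (auto intro!: DERIV_minus)

lemma asymptotic_away_from_tipD: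
  assumes "asymptotic_away_from_tip s V W" "\<epsilon> > 0"
  shows "\<exists>R. \<forall>t x y. R\<^sup>2 < x\<^sup>2 + (y - s * t)\<^sup>2 \<longrightarrow> \<bar>V t x y - W t x y\<bar> \<le> \<epsilon>"
proof -
  define S where "S = (\<lambda>R. SUP (t, x, y)\<in>{(t, x, y). x\<^sup>2 + (y - s * t)\<^sup>2 > R\<^sup>2}. ereal \<bar>V t x y - W t x y\<bar>)"
  have "(S \<longlongrightarrow> 0) at_top" using assms(1) by (simp add: asymptotic_away_from_tip_def S_def)
  hence "\<forall>\<^sub>F R in at_top. S R < ereal \<epsilon>" using assms(2) by (intro order_tendstoD(2)) auto
  then obtain R where R: "S R < ereal \<epsilon>" by (auto simp: eventually_at_top_linorder)
  show ?thesis
  proof (intro exI allI impI)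
    fix t x y assume "R\<^sup>2 < x\<^sup>2 + (y - s * t)\<^sup>2"
    hence "ereal \<bar>V t x y - W t x y\<bar> \<le> S R"
      unfolding S_def by (intro SUP_upper2[of "(t, x, y)"]) auto
    hence "ereal \<bar>V t x y - W t x y\<bar> < ereal \<epsilon>" using R by (rule le_less_trans)
    thus "\<bar>V t x y - W t x y\<bar> \<le> \<epsilon>" by simp
  qed
qed

text \<open>
  Dissipativity is the mean value theorem applied on an interval inside one of the two stable ranges.
\<close>
lemma bistable_interpretation:
  assumes "regular_nonlinearity f" "bistable_nonlinearity f"
  obtains K lam \<sigma> where "bistable f K lam \<sigma>"
proof -
  from assms(2) obtain lam \<sigma> K where l: "lam > 0" and \<sigma>: "\<sigma> \<in> {0<..<1/2}"
    and d: "\<And>x y u. u \<in> {..\<sigma>} \<union> {1 - \<sigma>..} \<Longrightarrow> - deriv (f x y) u \<ge> lam"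
    and lip: "\<And>x y. K-lipschitz_on UNIV (f x y)" and z: "\<And>x y. f x y 0 = 0 \<and> f x y 1 = 0"
    unfolding bistable_nonlinearity_def by blast
  have df: "(f x y has_real_derivative deriv (f x y) u) (at u)" for x y u
    using assms(1) unfolding regular_nonlinearity_def
    by (simp add: DERIV_deriv_iff_real_differentiable)
  have K0: "K \<ge> 0" using lip[of 0 0] by (rule lipschitz_on_nonneg)
  have "bistable f (K + 1) lam \<sigma>"
  proof
    fix x y u v :: real
    show "f x y 0 = 0" "f x y 1 = 0" using z by auto
    have "\<bar>f x y u - f x y v\<bar> \<le> K * \<bar>u - v\<bar>"
      using lipschitz_onD[OF lip[of x y], of u v] by (simp add: dist_real_def)
    thus "\<bar>f x y u - f x y v\<bar> \<le> (K + 1) * \<bar>u - v\<bar>" by (simp add: distrib_right)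
    assume vu: "v < u" "u \<le> \<sigma> \<or> 1 - \<sigma> \<le> v"
    obtain w where w: "v < w" "w < u" "f x y u - f x y v = (u - v) * deriv (f x y) w"
      using MVT2[OF vu(1), of "f x y" "deriv (f x y)"] df by blast
    have "lam \<le> - deriv (f x y) w" using w vu(2) by (intro d) auto
    hence "(u - v) * deriv (f x y) w \<le> (u - v) * (- lam)" using vu by (intro mult_left_mono) auto
    thus "f x y u - f x y v \<le> - lam * (u - v)" using w(3) by (simp add: mult.commute)
  qed (use l \<sigma> K0 in auto)
  thus thesis by (rule that)
qed

context bistable begin

lemma classical_sol:
  assumes "classical_entire_solution f u"
  shows "sol u"
proof -
  from classical_C12[OF assms] obtain ut ux uy uxx uxy uyy where
    C: "C12 UNIV u ut ux uy uxx uxy uyy" and e: "\<And>t x y. ut t x y - (uxx t x y + uyy t x y) = f x y (u t x y)"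
    by blast
  have "has_heat u t x y (f x y (u t x y))" for t x y
    by (rule has_heatI[OF C12_deriv(1)[OF C UNIV_I] C12_deriv(2)[OF C UNIV_I] C12_deriv(4)[OF C UNIV_I]
          C12_deriv(3)[OF C UNIV_I] C12_deriv(7)[OF C UNIV_I] e[symmetric]])
  thus ?thesis using C12_cont(1)[OF C] by (simp add: sol_def)
qed

text \<open>
  The limits bound \<open>U\<close> only for large phases. For phases in \<open>[-A, A]\<close>, periodicity moves \<open>(x, y)\<close> into one
  cell, and solving for \<open>t\<close>, which is possible as \<open>c \<noteq> 0\<close>, places the point in a compact set of space-time.
\<close>
lemma pulsating_front_is_front:
  assumes L: "L1 > 0" "L2 > 0" and pf: "pulsating_front L1 L2 f (dir \<theta>) U c" and c: "c \<noteq> 0"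
  shows "front (cos \<theta>) (sin \<theta>) c (\<lambda>t x y. U (x * cos \<theta> + y * sin \<theta> - c * t) x y)"
proof -
  define u where "u = (\<lambda>t x y. U (x * cos \<theta> + y * sin \<theta> - c * t) x y)"
  have per: "U \<xi> (x + of_int k1 * L1) (y + of_int k2 * L2) = U \<xi> x y" for \<xi> x y and k1 k2 :: int
    using pf by (auto simp: pulsating_front_def)
  have s: "sol u"
    using pf by (intro classical_sol) (simp add: pulsating_front_def u_def dir_def inner_prod_def)
  have lim: "\<exists>A\<ge>0. \<forall>\<xi> x y. (A \<le> \<xi> \<longrightarrow> \<bar>U \<xi> x y\<bar> \<le> \<epsilon>) \<and> (\<xi> \<le> - A \<longrightarrow> \<bar>U \<xi> x y - 1\<bar> \<le> \<epsilon>)"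
    if e: "\<epsilon> > 0" for \<epsilon>
  proof -
    have u0: "uniform_limit UNIV (\<lambda>\<xi> (x, y). U \<xi> x y) (\<lambda>_. 0) at_top"
      and u1: "uniform_limit UNIV (\<lambda>\<xi> (x, y). U \<xi> x y) (\<lambda>_. 1) at_bot"
      using pf by (auto simp: pulsating_front_def)
    obtain A where A: "\<And>\<xi> x y. A \<le> \<xi> \<Longrightarrow> \<bar>U \<xi> x y\<bar> < \<epsilon>"
      using uniform_limitD[OF u0 e] by (auto simp: eventually_at_top_linorder dist_real_def)
    obtain B where B: "\<And>\<xi> x y. \<xi> \<le> B \<Longrightarrow> \<bar>U \<xi> x y - 1\<bar> < \<epsilon>"
      using uniform_limitD[OF u1 e] by (auto simp: eventually_at_bot_linorder dist_real_def)
    show ?thesis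
    proof (intro exI[of _ "max \<bar>A\<bar> \<bar>B\<bar>"] conjI allI impI)
      fix \<xi> x y
      show "\<bar>U \<xi> x y\<bar> \<le> \<epsilon>" if "max \<bar>A\<bar> \<bar>B\<bar> \<le> \<xi>"
        by (rule less_imp_le, rule A, use that in linarith)
      show "\<bar>U \<xi> x y - 1\<bar> \<le> \<epsilon>" if "\<xi> \<le> - max \<bar>A\<bar> \<bar>B\<bar>"
        by (rule less_imp_le, rule B, use that in linarith)
    qed simp
  qed
  obtain A where A: "A \<ge> 0" "\<And>\<xi> x y. A \<le> \<xi> \<Longrightarrow> \<bar>U \<xi> x y\<bar> \<le> 1" "\<And>\<xi> x y. \<xi> \<le> - A \<Longrightarrow> \<bar>U \<xi> x y - 1\<bar> \<le> 1"
    using lim[OF zero_less_one] by blast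
  have "\<exists>M. \<forall>t x y. \<bar>u t x y\<bar> \<le> M"
  proof -
    define b where "b = (L1 + L2 + A) / \<bar>c\<bar> + L1 + L2"
    have cont: "continuous_on (UNIV \<times> UNIV) (\<lambda>(t, x, y). u t x y)" using s by (simp add: sol_def)
    obtain M where M: "\<And>t x y. t \<in> {- b..b} \<Longrightarrow> \<bar>x\<bar> \<le> b \<Longrightarrow> \<bar>y\<bar> \<le> b \<Longrightarrow> \<bar>u t x y\<bar> \<le> M"
      using cont3_bounded[OF cont compact_Icc subset_UNIV, of "- b" b b] by blast
    have UM: "\<bar>U \<xi> x y\<bar> \<le> M" if \<xi>: "\<bar>\<xi>\<bar> \<le> A" for \<xi> x y
    proof -
      define x' where "x' = x + of_int (- \<lfloor>x / L1\<rfloor>) * L1"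
      define y' where "y' = y + of_int (- \<lfloor>y / L2\<rfloor>) * L2"
      have x': "0 \<le> x'" "x' \<le> L1" and y': "0 \<le> y'" "y' \<le> L2"
      proof -
        have "of_int \<lfloor>x / L1\<rfloor> * L1 \<le> x / L1 * L1" "x / L1 * L1 \<le> (of_int \<lfloor>x / L1\<rfloor> + 1) * L1"
          "of_int \<lfloor>y / L2\<rfloor> * L2 \<le> y / L2 * L2" "y / L2 * L2 \<le> (of_int \<lfloor>y / L2\<rfloor> + 1) * L2"
          using L by (intro mult_right_mono; linarith)+
        thus "0 \<le> x'" "x' \<le> L1" "0 \<le> y'" "y' \<le> L2"
          using L by (simp_all add: x'_def y'_def distrib_right)
      qed
      define t where "t = (x' * cos \<theta> + y' * sin \<theta> - \<xi>) / c"
      have "x' * cos \<theta> + y' * sin \<theta> - c * t = \<xi>" using c by (simp add: t_def)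
      hence "u t x' y' = U \<xi> x' y'" by (simp add: u_def)
      moreover have "U \<xi> x' y' = U \<xi> x y" unfolding x'_def y'_def by (rule per)
      moreover have "\<bar>u t x' y'\<bar> \<le> M"
      proof (rule M)
        have "\<bar>x' * cos \<theta>\<bar> \<le> L1" "\<bar>y' * sin \<theta>\<bar> \<le> L2"
          using x' y' mult_mono[of "\<bar>x'\<bar>" L1 "\<bar>cos \<theta>\<bar>" 1] mult_mono[of "\<bar>y'\<bar>" L2 "\<bar>sin \<theta>\<bar>" 1]
          by (simp_all add: abs_mult)
        hence "\<bar>x' * cos \<theta> + y' * sin \<theta> - \<xi>\<bar> \<le> L1 + L2 + A" using \<xi> by linarith
        hence "\<bar>t\<bar> \<le> (L1 + L2 + A) / \<bar>c\<bar>" by (simp add: t_def abs_divide divide_right_mono)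
        moreover have "0 \<le> (L1 + L2 + A) / \<bar>c\<bar>" using L A(1) by simp
        ultimately show "t \<in> {- b..b}" "\<bar>x'\<bar> \<le> b" "\<bar>y'\<bar> \<le> b"
          using L x' y' by (auto simp: b_def abs_le_iff)
      qed
      ultimately show ?thesis by simp
    qed
    have "\<bar>U \<xi> x y\<bar> \<le> max M 2" for \<xi> x y
      using UM[of \<xi> x y] A(2)[of \<xi> x y] A(3)[of \<xi> x y] by linarith
    thus ?thesis unfolding u_def by blast
  qed
  hence u01: "sol01 u" using bounded_sol_in_unit_interval[OF s] by blast
  have "\<exists>A\<ge>0. \<forall>t x y. (A \<le> x * cos \<theta> + y * sin \<theta> - c * t \<longrightarrow> u t x y \<le> \<epsilon>) \<and>
        (x * cos \<theta> + y * sin \<theta> - c * t \<le> - A \<longrightarrow> 1 - \<epsilon> \<le> u t x y)" if e: "\<epsilon> > 0" for \<epsilon>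
  proof -
    obtain A where A: "A \<ge> 0" "\<And>\<xi> x y. A \<le> \<xi> \<Longrightarrow> \<bar>U \<xi> x y\<bar> \<le> \<epsilon>"
      "\<And>\<xi> x y. \<xi> \<le> - A \<Longrightarrow> \<bar>U \<xi> x y - 1\<bar> \<le> \<epsilon>" using lim[OF e] by blast
    show ?thesis
    proof (intro exI[of _ A] conjI allI impI A(1))
      fix t x y
      let ?\<xi> = "x * cos \<theta> + y * sin \<theta> - c * t"
      show "u t x y \<le> \<epsilon>" if "A \<le> ?\<xi>" using A(2)[OF that, of x y] unfolding u_def by linarith
      show "1 - \<epsilon> \<le> u t x y" if "?\<xi> \<le> - A" using A(3)[OF that, of x y] unfolding u_def by linarith
    qed
  qed
  thus ?thesis using u01 c unfolding front_def u_def[symmetric] by simp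
qed

text \<open>
  In the frame moving with the tip, \<open>V\<close> is bounded by 2 outside a fixed disc and damped wherever it exceeds
  2, so boundedness of damped solutions applies to \<open>V\<close> and to \<open>- V\<close>.
\<close>
lemma asymptotic_solution_in_unit_interval:
  assumes V: "classical_entire_solution f V"
    and as: "asymptotic_away_from_tip s V W" and W: "\<And>t x y. 0 \<le> W t x y \<and> W t x y \<le> 1"
  shows "sol01 V"
proof (rule bounded_sol_in_unit_interval[OF classical_sol[OF V]])
  obtain R where R: "\<And>t x y. R\<^sup>2 < x\<^sup>2 + (y - s * t)\<^sup>2 \<Longrightarrow> \<bar>V t x y - W t x y\<bar> \<le> 1"
    using asymptotic_away_from_tipD[OF as zero_less_one] by blast
  define \<rho> where "\<rho> = \<bar>R\<bar> + 1"
  have \<rho>: "\<rho> > 0" by (simp add: \<rho>_def)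
  have R\<rho>: "R\<^sup>2 < \<rho>\<^sup>2" using power_strict_mono[of "\<bar>R\<bar>" \<rho> 2] by (simp add: \<rho>_def)
  from classical_C12[OF V] obtain Vt Vx Vy Vxx Vxy Vyy where
    C: "C12 UNIV V Vt Vx Vy Vxx Vxy Vyy" and e: "\<And>t x y. Vt t x y - (Vxx t x y + Vyy t x y) = f x y (V t x y)"
    by blast
  have far: "\<bar>V t x (y + s * t)\<bar> \<le> 2" if "\<rho>\<^sup>2 \<le> x\<^sup>2 + y\<^sup>2" for t x y
    using R[of x "y + s * t" t] W[of t x "y + s * t"] that R\<rho> by (simp add: abs_le_iff)
  have eq: "(Vt t x (y + s * t) + s * Vy t x (y + s * t)) - (Vxx t x (y + s * t) + Vyy t x (y + s * t))
      - s * Vy t x (y + s * t) = f x (y + s * t) (V t x (y + s * t))" for t x y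
    using e[of t x "y + s * t"] by simp
  have fK: "\<bar>f x y u\<bar> \<le> K * \<bar>u\<bar>" for x y u using lip[of x y u 0] f0 by simp
  have up: "V t x (y + s * t) \<le> 2" for t x y
  proof (rule bounded_above_of_damped[OF C12_moving[OF C, of s] _ _ \<rho> lam, where drift=s and K=K and M=2])
    fix t x y :: real
    show "\<bar>(Vt t x (y + s * t) + s * Vy t x (y + s * t)) - (Vxx t x (y + s * t) + Vyy t x (y + s * t))
      - s * Vy t x (y + s * t)\<bar> \<le> K * \<bar>V t x (y + s * t)\<bar>" unfolding eq by (rule fK)
    show "(Vt t x (y + s * t) + s * Vy t x (y + s * t)) - (Vxx t x (y + s * t) + Vyy t x (y + s * t))
      - s * Vy t x (y + s * t) \<le> - lam * (V t x (y + s * t) - 2)" if "V t x (y + s * t) > 2"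
    proof -
      have "f x (y + s * t) (V t x (y + s * t)) \<le> - lam * (V t x (y + s * t) - 1)"
        using diss[of 1 "V t x (y + s * t)" x "y + s * t"] f1 sig that by simp
      also have "\<dots> \<le> - lam * (V t x (y + s * t) - 2)" using lam by simp
      finally show ?thesis unfolding eq .
    qed
  qed (use K far in auto)
  have eq': "(- (Vt t x (y + s * t) + s * Vy t x (y + s * t))) - (- Vxx t x (y + s * t) + - Vyy t x (y + s * t))
      - s * - Vy t x (y + s * t) = - f x (y + s * t) (V t x (y + s * t))" for t x y
    using eq[of t x y] by simp
  have lo: "- V t x (y + s * t) \<le> 2" for t x y
  proof (rule bounded_above_of_damped[OF C12_minus[OF C12_moving[OF C, of s]] _ _ \<rho> lam, where drift=s and K=K and M=2])
    fix t x y :: real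
    show "\<bar>(- (Vt t x (y + s * t) + s * Vy t x (y + s * t))) - (- Vxx t x (y + s * t) + - Vyy t x (y + s * t))
      - s * - Vy t x (y + s * t)\<bar> \<le> K * \<bar>- V t x (y + s * t)\<bar>" unfolding eq' abs_minus_cancel by (rule fK)
    show "(- (Vt t x (y + s * t) + s * Vy t x (y + s * t))) - (- Vxx t x (y + s * t) + - Vyy t x (y + s * t))
      - s * - Vy t x (y + s * t) \<le> - lam * (- V t x (y + s * t) - 2)" if "- V t x (y + s * t) > 2"
    proof -
      have "- f x (y + s * t) (V t x (y + s * t)) \<le> - lam * (- V t x (y + s * t))"
        using diss[of "V t x (y + s * t)" 0 x "y + s * t"] f0 sig that by simp
      also have "\<dots> \<le> - lam * (- V t x (y + s * t) - 2)" using lam by (simp add: algebra_simps)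
      finally show ?thesis unfolding eq' .
    qed
  qed (use K far in auto)
  show "\<bar>V t x y\<bar> \<le> 2" for t x y
    using up[of t x "y - s * t"] lo[of t x "y - s * t"] by (simp add: abs_le_iff)
qed

end

theorem theorem1p8:
  fixes L1 L2 \<alpha> \<beta> c\<^sub>\<alpha>\<^sub>\<beta> :: real
    and f :: "real \<Rightarrow> real \<Rightarrow> real \<Rightarrow> real"
    and U :: "real \<times> real \<Rightarrow> real \<Rightarrow> real \<Rightarrow> real \<Rightarrow> real"
    and c :: "real \<times> real \<Rightarrow> real"
    and V V' :: "real \<Rightarrow> real \<Rightarrow> real \<Rightarrow> real"
  assumes "L1 > 0" and "L2 > 0"
    and "regular_nonlinearity f"
    and "periodic_nonlinearity L1 L2 f"
    and "bistable_nonlinearity f"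
    and "integral ({0..L1} \<times> {0..L2} \<times> {0..1}) (\<lambda>(x, y, u). f x y u) > 0"
    and "\<And>e. norm e = 1 \<Longrightarrow> pulsating_front L1 L2 f e (U e) (c e)"
    and "\<And>e. norm e = 1 \<Longrightarrow> c e \<noteq> 0"
    and "\<And>e. norm e = 1 \<Longrightarrow> U e 0 0 0 = 1 / 2"
    and "0 < \<alpha>" and "\<alpha> < \<beta>" and "\<beta> < pi"
    and "c (dir \<alpha>) / sin \<alpha> = c\<^sub>\<alpha>\<^sub>\<beta>" and "c (dir \<beta>) / sin \<beta> = c\<^sub>\<alpha>\<^sub>\<beta>"
    and "classical_entire_solution f V"
    and "asymptotic_away_from_tip c\<^sub>\<alpha>\<^sub>\<beta> V (U_minus U c \<alpha> \<beta>)"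
    and "classical_entire_solution f V'"
    and "asymptotic_away_from_tip c\<^sub>\<alpha>\<^sub>\<beta> V' (U_minus U c \<alpha> \<beta>)"
  shows "\<forall>t x y. V' t x y = V t x y"
proof -
  obtain K lam \<sigma> where "bistable f K lam \<sigma>" using bistable_interpretation[OF assms(3,5)] .
  then interpret bistable f K lam \<sigma> .
  have nd: "norm (dir \<theta>) = 1" for \<theta> by (simp add: dir_def norm_Pair)
  have sa: "sin \<alpha> > 0" and sb: "sin \<beta> > 0" using assms(10-12) by (auto intro: sin_gt_zero)
  have ca: "c (dir \<alpha>) = c\<^sub>\<alpha>\<^sub>\<beta> * sin \<alpha>" using assms(13) sa by (simp add: field_simps)
  have cb: "c (dir \<beta>) = c\<^sub>\<alpha>\<^sub>\<beta> * sin \<beta>" using assms(14) sb by (simp add: field_simps)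
  define a where "a = (\<lambda>t x y. U (dir \<alpha>) (x * cos \<alpha> + y * sin \<alpha> - c (dir \<alpha>) * t) x y)"
  define b where "b = (\<lambda>t x y. U (dir \<beta>) (x * cos \<beta> + y * sin \<beta> - c (dir \<beta>) * t) x y)"
  have fa: "front (cos \<alpha>) (sin \<alpha>) (c\<^sub>\<alpha>\<^sub>\<beta> * sin \<alpha>) a"
    unfolding a_def ca[symmetric] by (intro pulsating_front_is_front[OF assms(1,2)] assms(7,8) nd)
  have fb: "front (cos \<beta>) (sin \<beta>) (c\<^sub>\<alpha>\<^sub>\<beta> * sin \<beta>) b"
    unfolding b_def cb[symmetric] by (intro pulsating_front_is_front[OF assms(1,2)] assms(7,8) nd)
  have Um: "U_minus U c \<alpha> \<beta> = (\<lambda>t x y. max (a t x y) (b t x y))"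
    by (intro ext) (simp add: U_minus_def a_def b_def)
  have a01: "sol01 a" and b01: "sol01 b" using fa fb by (auto simp: front_def)
  have W: "0 \<le> max (a t x y) (b t x y) \<and> max (a t x y) (b t x y) \<le> 1" for t x y
    using sol01D(3,4)[OF a01, of t x y] sol01D(3,4)[OF b01, of t x y] by auto
  note as = assms(16)[unfolded Um] assms(18)[unfolded Um]
  have V: "sol01 V" and V': "sol01 V'"
    by (rule asymptotic_solution_in_unit_interval[OF assms(15) as(1) W]
          asymptotic_solution_in_unit_interval[OF assms(17) as(2) W])+
  note lim = as[THEN asymptotic_away_from_tipD]
  have "V' t x y \<le> V t x y" for t x y
    by (rule two_front_comparison[OF fa fb assms(10-12) V' V lim(2) lim(1)])
  moreover have "V t x y \<le> V' t x y" for t x y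
    by (rule two_front_comparison[OF fa fb assms(10-12) V V' lim(1) lim(2)])
  ultimately show ?thesis by (simp add: order_antisym)
qed

end
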